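(* Let $m\geq 2$ and $\gamma\geq 0$ be real numbers. If $(f_n)_{n\in\mathbb{N}}\subset H^1_+$ is a sequence such that $\|f_n\|_{L^2}=\|f_n\|_{L^{2m+2}}=1$ for all $n$ and $\lim_{n\to+\infty}I_m^{(\gamma)}(f_n)=J_m^{(\gamma)}$, then there exist a profile $U\in G_m^{(\gamma)}(1,1)$, a strictly increasing function $\psi:\mathbb{N}\to\mathbb{N}$ and a real-valued sequence $(x_n)_{n\in\mathbb{N}}$ such that $$\lim_{n\to+\infty}\|f_{\psi(n)}-U(\cdot-x_n)\|_{H^1}=0.$$
   Context: $L^2_+$ is the space of complex-valued $f\in L^2(\mathbb{R})$ whose Fourier transform vanishes on $(-\infty,0)$, and $H^1_+=H^1(\mathbb{R})\cap L^2_+$. $|D|^{s}$ is the Fourier multiplier with symbol $|\xi|^{s}$. For $f\in H^1(\mathbb{R})\setminus\{0\}$, $$I_m^{(\gamma)}(f)=\frac{\|\partial_x f\|_{L^2}^m\|f\|_{L^2}^{m+2}+\gamma\,\||D|^{1/2}f\|_{L^2}^{2m}\|f\|_{L^2}^2}{\|f\|_{L^{2m+2}}^{2m+2}},$$ $J_m^{(\gamma)}=\inf_{f\in H^1_+\setminus\{0\}}I_m^{(\gamma)}(f)$, $G_m^{(\gamma)}=\{f\in H^1_+\setminus\{0\}: I_m^{(\gamma)}(f)=J_m^{(\gamma)}\}$, and for $a,b>0$, $G_m^{(\gamma)}(a,b)=\{f\in G_m^{(\gamma)}:\|f\|_{L^2}=a,\ \|f\|_{L^{2m+2}}=b\}$.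 *)

theory Defs
  imports "HOL-Analysis.Analysis"
begin

text \<open>
  Elements of Lebesgue and Sobolev spaces are represented by Borel measurable functions
  on the real line; equality of elements is equality almost everywhere, and in particular
  \<open>f \<noteq> 0\<close> is rendered as \<open>\<not> (AE x in lborel. f x = 0)\<close>.
\<close>

definition Lp :: "real \<Rightarrow> (real \<Rightarrow> complex) set" where
  "Lp p = {f. f \<in> borel_measurable lborel \<and> integrable lborel (\<lambda>x. cmod (f x) powr p)}"

definition Lp_norm :: "real \<Rightarrow> (real \<Rightarrow> complex) \<Rightarrow> real" where
  "Lp_norm p f = (LINT x|lborel. cmod (f x) powr p) powr (1 / p)"

text \<open>
  The Fourier transform on \<open>L\<^sup>2\<close> is the \<open>L\<^sup>2\<close>-limit of the transforms of the truncations of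
  \<open>f\<close> to \<open>[-R, R]\<close>. The kernel \<open>exp (- i x \<xi>)\<close> makes \<open>\<xi>\<close> the symbol of \<open>D = - i d/dx\<close>.
\<close>

definition has_fourier_L2 :: "(real \<Rightarrow> complex) \<Rightarrow> (real \<Rightarrow> complex) \<Rightarrow> bool" where
  "has_fourier_L2 f F \<longleftrightarrow> F \<in> Lp 2 \<and>
     ((\<lambda>R::real. \<integral>\<^sup>+\<xi>. ennreal ((cmod (F \<xi> -
          (LINT x:{-R..R}|lborel. exp (- \<i> * complex_of_real (x * \<xi>)) * f x)))\<^sup>2) \<partial>lborel)
        \<longlongrightarrow> 0) at_top"

text \<open>Determined up to a null set for \<open>f\<close> in \<open>L\<^sup>2\<close>.\<close>

definition fourier_L2 :: "(real \<Rightarrow> complex) \<Rightarrow> (real \<Rightarrow> complex)" where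
  "fourier_L2 f = (SOME F. has_fourier_L2 f F)"

definition L2_plus :: "(real \<Rightarrow> complex) set" where
  "L2_plus = {f \<in> Lp 2. AE \<xi> in lborel. \<xi> < 0 \<longrightarrow> fourier_L2 f \<xi> = 0}"

text \<open>The element of \<open>L\<^sup>2\<close> with Fourier transform \<open>\<bar>\<xi>\<bar>\<^sup>s\<close> times that of \<open>f\<close>, if there is one.\<close>

definition abs_D :: "real \<Rightarrow> (real \<Rightarrow> complex) \<Rightarrow> (real \<Rightarrow> complex)" where
  "abs_D s f = (SOME g. g \<in> Lp 2 \<and>
     (AE \<xi> in lborel. fourier_L2 g \<xi> = complex_of_real (\<bar>\<xi>\<bar> powr s) * fourier_L2 f \<xi>))"

definition test_function :: "(real \<Rightarrow> real) \<Rightarrow> bool" where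
  "test_function \<phi> \<longleftrightarrow> (\<forall>k x. ((deriv ^^ k) \<phi>) field_differentiable at x) \<and>
     compact (closure {x. \<phi> x \<noteq> 0})"

definition has_weak_deriv :: "(real \<Rightarrow> complex) \<Rightarrow> (real \<Rightarrow> complex) \<Rightarrow> bool" where
  "has_weak_deriv f g \<longleftrightarrow> (\<forall>\<phi>. test_function \<phi> \<longrightarrow>
     (LINT x|lborel. f x * complex_of_real (deriv \<phi> x)) =
     - (LINT x|lborel. g x * complex_of_real (\<phi> x)))"

definition H1 :: "(real \<Rightarrow> complex) set" where
  "H1 = {f \<in> Lp 2. \<exists>g \<in> Lp 2. has_weak_deriv f g}"

text \<open>Determined up to a null set for \<open>f\<close> in \<open>H\<^sup>1\<close>.\<close>

definition weak_deriv :: "(real \<Rightarrow> complex) \<Rightarrow> (real \<Rightarrow> complex)" where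
  "weak_deriv f = (SOME g. g \<in> Lp 2 \<and> has_weak_deriv f g)"

definition H1_norm :: "(real \<Rightarrow> complex) \<Rightarrow> real" where
  "H1_norm f = sqrt ((Lp_norm 2 f)\<^sup>2 + (Lp_norm 2 (weak_deriv f))\<^sup>2)"

definition H1_plus :: "(real \<Rightarrow> complex) set" where
  "H1_plus = H1 \<inter> L2_plus"

definition H1_plus_nz :: "(real \<Rightarrow> complex) set" where
  "H1_plus_nz = {f \<in> H1_plus. \<not> (AE x in lborel. f x = 0)}"

definition I_fun :: "real \<Rightarrow> real \<Rightarrow> (real \<Rightarrow> complex) \<Rightarrow> real" where
  "I_fun m \<gamma> f =
     (Lp_norm 2 (weak_deriv f) powr m * Lp_norm 2 f powr (m + 2)
        + \<gamma> * Lp_norm 2 (abs_D (1/2) f) powr (2 * m) * (Lp_norm 2 f)\<^sup>2)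
     / Lp_norm (2 * m + 2) f powr (2 * m + 2)"

definition J_inf :: "real \<Rightarrow> real \<Rightarrow> real" where
  "J_inf m \<gamma> = (INF f\<in>H1_plus_nz. I_fun m \<gamma> f)"

definition G_set :: "real \<Rightarrow> real \<Rightarrow> (real \<Rightarrow> complex) set" where
  "G_set m \<gamma> = {f \<in> H1_plus_nz. I_fun m \<gamma> f = J_inf m \<gamma>}"

definition G_normalized :: "real \<Rightarrow> real \<Rightarrow> real \<Rightarrow> real \<Rightarrow> (real \<Rightarrow> complex) set" where
  "G_normalized m \<gamma> a b = {f \<in> G_set m \<gamma>. Lp_norm 2 f = a \<and> Lp_norm (2 * m + 2) f = b}"

end

theory Submission
  imports Defs "HOL-Complex_Analysis.Great_Picard" "HOL-Probability.Probability"
begin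

text \<open>
  The \<open>L\<^sup>2\<close> Fourier transform turns the three quadratic quantities \<open>\<parallel>f\<parallel>\<^sup>2\<close>, \<open>\<parallel>f'\<parallel>\<^sup>2\<close> and \<open>\<parallel>|D|\<^sup>1\<^sup>/\<^sup>2 f\<parallel>\<^sup>2\<close> into
  weighted norms of the transform of \<open>f\<close>; on \<open>H\<^sup>1\<^sub>+\<close> the last one is \<open>\<langle>D f, f\<rangle>\<close>. Since
  \<open>1 = \<integral>|f\<^sub>n|\<^bsup>2m+2\<^esup> \<le> sup |f\<^sub>n|\<^bsup>2m\<^esup> \<integral>|f\<^sub>n|\<^sup>2\<close>, each \<open>f\<^sub>n\<close> is at least 1/2 somewhere, and after translating these
  points to the origin the sequence, being bounded in \<open>H\<^sup>1\<close>, has a subsequence converging pointwise to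
  some \<open>U \<noteq> 0\<close> in \<open>H\<^sup>1\<^sub>+\<close>. The remainders \<open>r\<^sub>n\<close> tend weakly to 0, so each quadratic quantity of \<open>f\<^sub>n\<close>
  splits asymptotically into those of \<open>U\<close> and \<open>r\<^sub>n\<close>, and so does the \<open>L\<^bsup>2m+2\<^esup>\<close> mass by the
  Brezis-Lieb lemma. The numerator of the functional is superadditive in the quadratic quantities, with
  the nonnegative cross terms \<open>\<parallel>U'\<parallel>\<^sup>m \<parallel>r\<^sub>n\<parallel>\<^bsup>m+2\<^esup> + \<parallel>r\<^sub>n'\<parallel>\<^sup>m \<parallel>U\<parallel>\<^bsup>m+2\<^esup>\<close>. Minimality
  forces these to vanish in the limit, that is, \<open>r\<^sub>n \<rightarrow> 0\<close> in \<open>H\<^sup>1\<close>.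
\<close>

section \<open>Square integrable functions\<close>

text \<open>The Fourier transform, the weak derivative and \<open>abs_D\<close> pick representatives
  by choice, so nothing can be computed from them directly. The development works with the relation
  \<open>has_fourier_L2 f F\<close> for arbitrary \<open>F\<close>, shows that it is total, onto,
  injective up to null sets and isometric up to \<open>sqrt (2 * pi)\<close>, and then reads the
  chosen objects off on the frequency side. The kernel is not normalized, which is the origin of
  every \<open>2 * pi\<close>. Boundedness in H1 alone gives no compactness on the line: mass may
  escape, spread out or split. The lower bound at one point handles the first two, the cross terms
  the third. Local compactness enters through continuous representatives with a common modulus of
  continuity: convergence at every point together with a uniform bound already yields weak
  convergence, so no compact embedding is invoked. A second extraction makes the norms of the
  derivatives converge separately, so that the decisive comparison is made once, between limits,
  where the quadratic quantities add exactly.\<close>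

lemma borel_measurable_cnj[measurable]: "cnj \<in> borel_measurable borel"
  by (intro borel_measurable_continuous_onI continuous_intros)

text \<open>A Bochner integral is 0 when the integrand is not integrable, so the value carries
  information only on \<open>Lp 2\<close>; this is why membership in \<open>Lp 2\<close> accompanies
  almost every statement.\<close>

definition l2norm :: "(real \<Rightarrow> complex) \<Rightarrow> real" where
  "l2norm f = sqrt (LINT x|lborel. (cmod (f x))\<^sup>2)"

definition l2inner :: "(real \<Rightarrow> complex) \<Rightarrow> (real \<Rightarrow> complex) \<Rightarrow> complex" where
  "l2inner f g = (LINT x|lborel. f x * cnj (g x))"

lemma Lp_2_iff: "f \<in> Lp 2 \<longleftrightarrow> f \<in> borel_measurable lborel \<and> integrable lborel (\<lambda>x. (cmod (f x))\<^sup>2)"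
  by (simp add: Lp_def powr_numeral)

lemma Lp_norm_2: "Lp_norm 2 f = l2norm f"
proof -
  have "0 \<le> (LINT x|lborel. (cmod (f x))\<^sup>2)" by (intro integral_nonneg_AE) auto
  then show ?thesis
    unfolding Lp_norm_def l2norm_def by (simp add: powr_numeral powr_half_sqrt)
qed

lemma L2_measurable[measurable_dest]: "f \<in> Lp 2 \<Longrightarrow> f \<in> borel_measurable lborel"
  by (simp add: Lp_2_iff)

lemma L2_integrable_sq: "f \<in> Lp 2 \<Longrightarrow> integrable lborel (\<lambda>x. (cmod (f x))\<^sup>2)"
  by (simp add: Lp_2_iff)

lemma L2_norm_mult_integrable:
  assumes f: "f \<in> Lp 2" and g: "g \<in> Lp 2"
  shows "integrable lborel (\<lambda>x. cmod (f x) * cmod (g x))"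
proof (rule Bochner_Integration.integrable_bound)
  show "integrable lborel (\<lambda>x. (cmod (f x))\<^sup>2 + (cmod (g x))\<^sup>2)"
    using assms L2_integrable_sq by auto
  show "(\<lambda>x. cmod (f x) * cmod (g x)) \<in> borel_measurable lborel"
    using L2_measurable[OF f] L2_measurable[OF g] by measurable
  have "a * b \<le> a\<^sup>2 + b\<^sup>2" if "a \<ge> 0" "b \<ge> 0" for a b :: real
    using sum_squares_bound[of a b] mult_nonneg_nonneg[OF that] by linarith
  then show "AE x in lborel. norm (cmod (f x) * cmod (g x)) \<le> norm ((cmod (f x))\<^sup>2 + (cmod (g x))\<^sup>2)"
    by auto
qed

lemma L2_mult_integrable:
  assumes f: "f \<in> Lp 2" and g: "g \<in> Lp 2"
  shows "integrable lborel (\<lambda>x. f x * g x)"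
  by (rule Bochner_Integration.integrable_bound[OF L2_norm_mult_integrable[OF f g]])
     (use L2_measurable[OF f] L2_measurable[OF g] in \<open>auto simp: norm_mult\<close>)

lemma L2_bound:
  assumes f: "f \<in> Lp 2" and g: "g \<in> borel_measurable lborel"
    and le: "AE x in lborel. cmod (g x) \<le> cmod (f x)"
  shows "g \<in> Lp 2"
  unfolding Lp_2_iff
proof (intro conjI g)
  show "integrable lborel (\<lambda>x. (cmod (g x))\<^sup>2)"
    by (rule Bochner_Integration.integrable_bound[OF L2_integrable_sq[OF f]])
       (use g le in \<open>auto intro!: power_mono\<close>)
qed

lemma L2_add[intro]: assumes f: "f \<in> Lp 2" and g: "g \<in> Lp 2" shows "(\<lambda>x. f x + g x) \<in> Lp 2"
  unfolding Lp_2_iff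
proof
  show m: "(\<lambda>x. f x + g x) \<in> borel_measurable lborel"
    using L2_measurable[OF f] L2_measurable[OF g] by measurable
  show "integrable lborel (\<lambda>x. (cmod (f x + g x))\<^sup>2)"
  proof (rule Bochner_Integration.integrable_bound)
    show "integrable lborel (\<lambda>x. 2 * (cmod (f x))\<^sup>2 + 2 * (cmod (g x))\<^sup>2)"
      using assms L2_integrable_sq by auto
    show "(\<lambda>x. (cmod (f x + g x))\<^sup>2) \<in> borel_measurable lborel" using m by measurable
    have "(cmod (a + b))\<^sup>2 \<le> 2 * (cmod a)\<^sup>2 + 2 * (cmod b)\<^sup>2" for a b
    proof -
      have "(cmod (a + b))\<^sup>2 \<le> (cmod a + cmod b)\<^sup>2" by (intro power_mono norm_triangle_ineq) auto
      also have "\<dots> \<le> 2 * (cmod a)\<^sup>2 + 2 * (cmod b)\<^sup>2"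
        using sum_squares_bound[of "cmod a" "cmod b"] by (simp add: power2_sum)
      finally show ?thesis .
    qed
    then show "AE x in lborel. norm ((cmod (f x + g x))\<^sup>2) \<le> norm (2 * (cmod (f x))\<^sup>2 + 2 * (cmod (g x))\<^sup>2)"
      by auto
  qed
qed

lemma L2_bounded_mult:
  assumes f: "f \<in> Lp 2" and [measurable]: "h \<in> borel_measurable lborel" and b: "\<And>x. cmod (h x) \<le> B"
  shows "(\<lambda>x. h x * f x) \<in> Lp 2"
  unfolding Lp_2_iff
proof
  have [measurable]: "f \<in> borel_measurable lborel" using f by (rule L2_measurable)
  show m: "(\<lambda>x. h x * f x) \<in> borel_measurable lborel" by measurable
  show "integrable lborel (\<lambda>x. (cmod (h x * f x))\<^sup>2)"
  proof (rule Bochner_Integration.integrable_bound)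
    show "integrable lborel (\<lambda>x. B\<^sup>2 * (cmod (f x))\<^sup>2)"
      using f L2_integrable_sq by auto
    have "(cmod (h x * f x))\<^sup>2 \<le> B\<^sup>2 * (cmod (f x))\<^sup>2" for x
      unfolding norm_mult power_mult_distrib by (intro mult_right_mono power_mono b) auto
    then show "AE x in lborel. norm ((cmod (h x * f x))\<^sup>2) \<le> norm (B\<^sup>2 * (cmod (f x))\<^sup>2)"
      by auto
  qed measurable
qed

lemma L2_cmult[intro]: "f \<in> Lp 2 \<Longrightarrow> (\<lambda>x. c * f x) \<in> Lp 2"
  by (rule L2_bounded_mult[where B="cmod c"]) auto

lemma L2_uminus[intro]: "f \<in> Lp 2 \<Longrightarrow> (\<lambda>x. - f x) \<in> Lp 2"
  using L2_cmult[of f "-1"] by simp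

lemma L2_diff[intro]: "f \<in> Lp 2 \<Longrightarrow> g \<in> Lp 2 \<Longrightarrow> (\<lambda>x. f x - g x) \<in> Lp 2"
  using L2_add[OF _ L2_uminus, of f g] by simp

lemma L2_cnj[intro]: assumes f: "f \<in> Lp 2" shows "(\<lambda>x. cnj (f x)) \<in> Lp 2"
  by (rule L2_bound[OF f]) (use L2_measurable[OF f] in auto)

lemma L2_zero[simp, intro]: "(\<lambda>x. 0) \<in> Lp 2"
  by (simp add: Lp_2_iff)

lemma L2_indicator: assumes f: "f \<in> Lp 2" and A: "A \<in> sets borel"
  shows "(\<lambda>x. indicator A x * f x) \<in> Lp 2"
  by (rule L2_bounded_mult[OF f, where B=1]) (use A in \<open>auto simp: indicator_def\<close>)

lemma L2_shift: assumes f: "f \<in> Lp 2" shows "(\<lambda>x. f (x + h)) \<in> Lp 2"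
proof -
  have "integrable lborel (\<lambda>x. (cmod (f (h + 1 * x)))\<^sup>2)"
    by (rule lborel_integrable_real_affine[OF L2_integrable_sq[OF f], of 1 h]) simp
  moreover have "(\<lambda>x. f (x + h)) \<in> borel_measurable lborel"
    using L2_measurable[OF f] by measurable
  ultimately show ?thesis by (simp add: Lp_2_iff add.commute)
qed

lemma l2norm_nonneg[simp]: "0 \<le> l2norm f"
  unfolding l2norm_def by (intro real_sqrt_ge_zero integral_nonneg_AE) auto

lemma l2norm_sq: "(l2norm f)\<^sup>2 = (LINT x|lborel. (cmod (f x))\<^sup>2)"
  unfolding l2norm_def by (intro real_sqrt_pow2 integral_nonneg_AE) auto

lemma l2norm_cong_AE:
  assumes "f \<in> borel_measurable lborel" "g \<in> borel_measurable lborel" "AE x in lborel. f x = g x"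
  shows "l2norm f = l2norm g"
  unfolding l2norm_def using assms by (intro arg_cong[where f=sqrt] integral_cong_AE) auto

lemma l2norm_eq_0: assumes f: "f \<in> Lp 2" shows "l2norm f = 0 \<longleftrightarrow> (AE x in lborel. f x = 0)"
  unfolding l2norm_def using integral_nonneg_eq_0_iff_AE[OF L2_integrable_sq[OF f]] by simp

lemma l2norm_scale: "l2norm (\<lambda>x. c * f x) = cmod c * l2norm f"
  unfolding l2norm_def by (simp add: norm_mult power_mult_distrib real_sqrt_mult)

lemma l2norm_uminus[simp]: "l2norm (\<lambda>x. - f x) = l2norm f"
  unfolding l2norm_def by simp

lemma l2norm_cnj[simp]: "l2norm (\<lambda>x. cnj (f x)) = l2norm f"
  unfolding l2norm_def by simp

lemma l2norm_commute: "l2norm (\<lambda>x. f x - g x) = l2norm (\<lambda>x. g x - f x)"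
  unfolding l2norm_def by (simp add: norm_minus_commute)

lemma l2norm_zero[simp]: "l2norm (\<lambda>x. 0) = 0"
  unfolding l2norm_def by simp

lemma l2norm_shift: "l2norm (\<lambda>x. f (x + h)) = l2norm f"
proof -
  have "(LINT x|lborel. (cmod (f x))\<^sup>2) = (LINT x|lborel. (cmod (f (x + h)))\<^sup>2)"
    using lborel_integral_real_affine[of 1 "\<lambda>x. (cmod (f x))\<^sup>2" h] by (simp add: add.commute)
  then show ?thesis by (simp add: l2norm_def)
qed

lemma L2_Cauchy_Schwarz:
  assumes f: "f \<in> Lp 2" and g: "g \<in> Lp 2"
  shows "(LINT x|lborel. cmod (f x) * cmod (g x)) \<le> l2norm f * l2norm g"
proof -
  have [measurable]: "f \<in> borel_measurable lborel" "g \<in> borel_measurable lborel"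
    using assms L2_measurable by auto
  let ?I = "LINT x|lborel. cmod (f x) * cmod (g x)"
  have "(\<integral>\<^sup>+x. ennreal (cmod (f x)) * ennreal (cmod (g x)) \<partial>lborel)\<^sup>2 \<le>
     (\<integral>\<^sup>+x. ennreal (cmod (f x)) ^ 2 \<partial>lborel) * (\<integral>\<^sup>+x. ennreal (cmod (g x)) ^ 2 \<partial>lborel)"
    by (rule Cauchy_Schwarz_nn_integral) auto
  also have "(\<integral>\<^sup>+x. ennreal (cmod (f x)) ^ 2 \<partial>lborel) = ennreal ((l2norm f)\<^sup>2)"
    unfolding l2norm_sq using L2_integrable_sq[OF f] by (simp add: ennreal_power nn_integral_eq_integral)
  also have "(\<integral>\<^sup>+x. ennreal (cmod (g x)) ^ 2 \<partial>lborel) = ennreal ((l2norm g)\<^sup>2)"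
    unfolding l2norm_sq using L2_integrable_sq[OF g] by (simp add: ennreal_power nn_integral_eq_integral)
  also have "(\<integral>\<^sup>+x. ennreal (cmod (f x)) * ennreal (cmod (g x)) \<partial>lborel) = ennreal ?I"
    using L2_norm_mult_integrable[OF f g] by (simp add: ennreal_mult[symmetric] nn_integral_eq_integral)
  finally have "?I\<^sup>2 \<le> (l2norm f * l2norm g)\<^sup>2"
    by (simp add: ennreal_power ennreal_mult[symmetric] power_mult_distrib integral_nonneg_AE)
  then show ?thesis
    by (rule power2_le_imp_le) simp
qed

lemma l2inner_le: assumes f: "f \<in> Lp 2" and g: "g \<in> Lp 2"
  shows "cmod (l2inner f g) \<le> l2norm f * l2norm g"
proof -
  have "cmod (l2inner f g) \<le> (LINT x|lborel. cmod (f x * cnj (g x)))"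
    unfolding l2inner_def by (rule integral_norm_bound)
  also have "\<dots> = (LINT x|lborel. cmod (f x) * cmod (g x))" by (simp add: norm_mult)
  finally show ?thesis using L2_Cauchy_Schwarz[OF f g] by linarith
qed

lemma l2inner_self: "l2inner f f = complex_of_real ((l2norm f)\<^sup>2)"
  unfolding l2inner_def l2norm_sq complex_norm_square[symmetric] by (rule integral_complex_of_real)

lemma l2inner_commute: "l2inner g f = cnj (l2inner f g)"
  unfolding l2inner_def by (subst Bochner_Integration.integral_cnj[symmetric]) (simp add: mult.commute)

lemma L2_inner_integrable: "f \<in> Lp 2 \<Longrightarrow> g \<in> Lp 2 \<Longrightarrow> integrable lborel (\<lambda>x. f x * cnj (g x))"
  by (intro L2_mult_integrable L2_cnj)

lemma l2inner_add_left: "f \<in> Lp 2 \<Longrightarrow> g \<in> Lp 2 \<Longrightarrow> h \<in> Lp 2 \<Longrightarrow>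
  l2inner (\<lambda>x. f x + g x) h = l2inner f h + l2inner g h"
  unfolding l2inner_def distrib_right by (intro Bochner_Integration.integral_add L2_inner_integrable)

lemma l2inner_diff_left: "f \<in> Lp 2 \<Longrightarrow> g \<in> Lp 2 \<Longrightarrow> h \<in> Lp 2 \<Longrightarrow>
  l2inner (\<lambda>x. f x - g x) h = l2inner f h - l2inner g h"
  unfolding l2inner_def left_diff_distrib by (intro Bochner_Integration.integral_diff L2_inner_integrable)

lemma l2inner_scale_left: "l2inner (\<lambda>x. c * f x) h = c * l2inner f h"
  unfolding l2inner_def by (simp add: mult.assoc)

lemma l2inner_diff_right: "f \<in> Lp 2 \<Longrightarrow> g \<in> Lp 2 \<Longrightarrow> h \<in> Lp 2 \<Longrightarrow>
  l2inner h (\<lambda>x. f x - g x) = l2inner h f - l2inner h g"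
  unfolding l2inner_def complex_cnj_diff right_diff_distrib by (intro Bochner_Integration.integral_diff L2_inner_integrable)

lemma l2norm_add_sq: assumes f: "f \<in> Lp 2" and g: "g \<in> Lp 2"
  shows "(l2norm (\<lambda>x. f x + g x))\<^sup>2 = (l2norm f)\<^sup>2 + (l2norm g)\<^sup>2 + 2 * Re (l2inner f g)"
proof -
  have eq: "(cmod (a + b))\<^sup>2 = (cmod a)\<^sup>2 + (cmod b)\<^sup>2 + 2 * Re (a * cnj b)" for a b
    unfolding cmod_power2 by (simp add: power2_eq_square algebra_simps)
  have i: "integrable lborel (\<lambda>x. Re (f x * cnj (g x)))"
    by (rule integrable_Re[OF L2_inner_integrable[OF f g]])
  define R where "R x = Re (f x * cnj (g x))" for x
  have R: "integrable lborel R" using i by (simp add: R_def[abs_def])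
  have "(l2norm (\<lambda>x. f x + g x))\<^sup>2 = (LINT x|lborel. (cmod (f x))\<^sup>2 + (cmod (g x))\<^sup>2 + 2 * R x)"
    unfolding l2norm_sq eq R_def ..
  also have "\<dots> = (l2norm f)\<^sup>2 + (l2norm g)\<^sup>2 + 2 * (LINT x|lborel. R x)"
    unfolding l2norm_sq using L2_integrable_sq[OF f] L2_integrable_sq[OF g] R by simp
  also have "(LINT x|lborel. R x) = (LINT x|lborel. Re (f x * cnj (g x)))" by (simp only: R_def)
  also have "(LINT x|lborel. Re (f x * cnj (g x))) = Re (l2inner f g)"
    unfolding l2inner_def by (rule integral_Re[OF L2_inner_integrable[OF f g]])
  finally show ?thesis .
qed

lemma l2norm_triangle: assumes f: "f \<in> Lp 2" and g: "g \<in> Lp 2"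
  shows "l2norm (\<lambda>x. f x + g x) \<le> l2norm f + l2norm g"
proof (rule power2_le_imp_le)
  have "Re (l2inner f g) \<le> l2norm f * l2norm g"
    using l2inner_le[OF f g] complex_Re_le_cmod[of "l2inner f g"] by linarith
  then show "(l2norm (\<lambda>x. f x + g x))\<^sup>2 \<le> (l2norm f + l2norm g)\<^sup>2"
    by (simp add: l2norm_add_sq[OF f g] power2_sum)
qed simp

lemma l2norm_diff_sq: assumes f: "f \<in> Lp 2" and g: "g \<in> Lp 2"
  shows "(l2norm (\<lambda>x. f x - g x))\<^sup>2 = (l2norm f)\<^sup>2 + (l2norm g)\<^sup>2 - 2 * Re (l2inner f g)"
  using l2norm_add_sq[OF f L2_uminus[OF g]] by (simp add: l2inner_def)

lemma l2norm_triangle_diff: assumes f: "f \<in> Lp 2" and g: "g \<in> Lp 2" and h: "h \<in> Lp 2"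
  shows "l2norm (\<lambda>x. f x - h x) \<le> l2norm (\<lambda>x. f x - g x) + l2norm (\<lambda>x. g x - h x)"
  using l2norm_triangle[OF L2_diff[OF f g] L2_diff[OF g h]] by simp

lemma l2norm_reverse_triangle: assumes f: "f \<in> Lp 2" and g: "g \<in> Lp 2"
  shows "\<bar>l2norm f - l2norm g\<bar> \<le> l2norm (\<lambda>x. f x - g x)"
  using l2norm_triangle[OF L2_diff[OF f g] g] l2norm_triangle[OF L2_diff[OF g f] f]
    l2norm_commute[of f g] by simp

lemma l2norm_nn_integral: assumes f: "f \<in> Lp 2"
  shows "(\<integral>\<^sup>+x. ennreal ((cmod (f x))\<^sup>2) \<partial>lborel) = ennreal ((l2norm f)\<^sup>2)"
  unfolding l2norm_sq using L2_integrable_sq[OF f] by (simp add: nn_integral_eq_integral)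

section \<open>Limits, completeness and approximation in L2\<close>

lemma L2_nn_integralI:
  assumes [measurable]: "f \<in> borel_measurable lborel"
    and le: "(\<integral>\<^sup>+x. ennreal ((cmod (f x))\<^sup>2) \<partial>lborel) \<le> ennreal (C\<^sup>2)" and "C \<ge> 0"
  shows "f \<in> Lp 2" "l2norm f \<le> C"
proof -
  show f: "f \<in> Lp 2"
    unfolding Lp_2_iff
    using order_le_less_trans[OF le ennreal_less_top] by (auto intro!: integrableI_bounded)
  show "l2norm f \<le> C"
    using le \<open>C \<ge> 0\<close> unfolding l2norm_nn_integral[OF f]
    by (auto intro: power2_le_imp_le simp: ennreal_le_iff)
qed

text \<open>The way to put a pointwise limit into \<open>Lp 2\<close> when convergence in norm is
  not known: bounded norms suffice. It serves completeness, Plancherel's identity and the limit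
  profile.\<close>

lemma L2_Fatou:
  assumes g: "\<And>n. g n \<in> Lp 2" and b: "\<And>n. l2norm (g n) \<le> C"
    and f[measurable]: "f \<in> borel_measurable lborel"
    and lim: "AE x in lborel. (\<lambda>n::nat. g n x) \<longlonglongrightarrow> f x"
  shows "f \<in> Lp 2" "l2norm f \<le> C"
proof -
  have [measurable]: "g n \<in> borel_measurable lborel" for n using g L2_measurable by auto
  have C: "C \<ge> 0" using b[of 0] l2norm_nonneg[of "g 0"] by linarith
  have "(\<integral>\<^sup>+x. ennreal ((cmod (f x))\<^sup>2) \<partial>lborel) = (\<integral>\<^sup>+x. liminf (\<lambda>n. ennreal ((cmod (g n x))\<^sup>2)) \<partial>lborel)"
  proof (rule nn_integral_cong_AE, use lim in eventually_elim)
    case (elim x)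
    have "(\<lambda>n. ennreal ((cmod (g n x))\<^sup>2)) \<longlonglongrightarrow> ennreal ((cmod (f x))\<^sup>2)"
      by (intro tendsto_intros elim)
    from lim_imp_Liminf[OF _ this] show ?case by simp
  qed
  also have "\<dots> \<le> liminf (\<lambda>n. \<integral>\<^sup>+x. ennreal ((cmod (g n x))\<^sup>2) \<partial>lborel)"
    by (rule nn_integral_liminf) measurable
  also have "\<dots> \<le> liminf (\<lambda>n. ennreal (C\<^sup>2))"
    by (intro Liminf_mono always_eventually allI) (simp add: l2norm_nn_integral[OF g] b power_mono)
  also have "\<dots> = ennreal (C\<^sup>2)" by (simp add: Liminf_const)
  finally have le: "(\<integral>\<^sup>+x. ennreal ((cmod (f x))\<^sup>2) \<partial>lborel) \<le> ennreal (C\<^sup>2)" .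
  show "f \<in> Lp 2" "l2norm f \<le> C" using L2_nn_integralI[OF f le C] by auto
qed

text \<open>Riesz-Fischer: a rapidly Cauchy subsequence converges almost everywhere. Completeness is
  what makes the transform exist on all of \<open>Lp 2\<close>.\<close>

lemma L2_complete:
  assumes f: "\<And>n. f n \<in> Lp 2"
    and C: "\<And>e. e > 0 \<Longrightarrow> \<exists>N. \<forall>m\<ge>N. \<forall>n\<ge>N. l2norm (\<lambda>x. f m x - f n x) < e"
  shows "\<exists>F\<in>Lp 2. (\<lambda>n. l2norm (\<lambda>x. f n x - F x)) \<longlonglongrightarrow> 0"
proof -
  have [measurable]: "f n \<in> borel_measurable lborel" for n using f L2_measurable by auto
  have "\<forall>k. \<exists>N. \<forall>m\<ge>N. \<forall>n\<ge>N. l2norm (\<lambda>x. f m x - f n x) < (1/4)^k"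
    using C by simp
  then obtain N where N: "\<And>k m n. m \<ge> N k \<Longrightarrow> n \<ge> N k \<Longrightarrow> l2norm (\<lambda>x. f m x - f n x) < (1/4)^k"
    by metis
  \<comment> \<open>Partial sums turn the thresholds \<open>N k\<close> into a nondecreasing
    sequence of indices with \<open>N k \<le> r k\<close>.\<close>
  define r where "r k = (\<Sum>i\<le>k. N i)" for k
  have rN: "r k \<ge> N k" for k unfolding r_def by (induction k) auto
  have rmono: "r k \<le> r (Suc k)" for k by (simp add: r_def)
  define d where "d k x = f (r (Suc k)) x - f (r k) x" for k x
  \<comment> \<open>\<open>\<parallel>d k\<parallel>\<^sup>2\<close> is at most \<open>16\<^sup>-\<^sup>k\<close>, so the weights \<open>4\<^sup>k\<close> keep the sum of squares integrable and force
    a geometric pointwise decay.\<close>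
  have [measurable]: "d k \<in> borel_measurable lborel" for k unfolding d_def[abs_def] by measurable
  have dL: "d k \<in> Lp 2" for k unfolding d_def[abs_def] using f by auto
  have dn: "l2norm (d k) < (1/4)^k" for k
    unfolding d_def[abs_def] using rN[of k] rmono[of k] by (intro N) auto
  have bnd: "(\<integral>\<^sup>+x. ennreal (4^k * (cmod (d k x))\<^sup>2) \<partial>lborel) \<le> ennreal ((1/4)^k)" for k
  proof -
    have "(\<integral>\<^sup>+x. ennreal (4^k * (cmod (d k x))\<^sup>2) \<partial>lborel) = ennreal (4^k) * ennreal ((l2norm (d k))\<^sup>2)"
      by (simp add: ennreal_mult nn_integral_cmult l2norm_nn_integral[OF dL])
    also have "\<dots> = ennreal (4^k * (l2norm (d k))\<^sup>2)" by (simp add: ennreal_mult)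
    also have "\<dots> \<le> ennreal (4^k * ((1/4)^k)\<^sup>2)"
      using dn[of k] by (intro ennreal_leI mult_left_mono power_mono) auto
    also have "4^k * ((1/4::real)^k)\<^sup>2 = (1/4)^k"
      by (simp add: power2_eq_square power_mult_distrib[symmetric])
    finally show ?thesis .
  qed
  have "(\<integral>\<^sup>+x. (\<Sum>k. ennreal (4^k * (cmod (d k x))\<^sup>2)) \<partial>lborel) = (\<Sum>k. \<integral>\<^sup>+x. ennreal (4^k * (cmod (d k x))\<^sup>2) \<partial>lborel)"
    by (rule nn_integral_suminf) measurable
  also have "\<dots> \<le> (\<Sum>k. ennreal ((1/4)^k))" by (intro suminf_le bnd) auto
  also have "\<dots> = ennreal (\<Sum>k. (1/4)^k)" by (rule suminf_ennreal2) auto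
  also have "\<dots> < \<infinity>" by simp
  finally have fin: "(\<integral>\<^sup>+x. (\<Sum>k. ennreal (4^k * (cmod (d k x))\<^sup>2)) \<partial>lborel) \<noteq> \<infinity>" by simp
  have "AE x in lborel. (\<Sum>k. ennreal (4^k * (cmod (d k x))\<^sup>2)) \<noteq> \<infinity>"
    by (rule nn_integral_PInf_AE[OF _ fin]) measurable
  then have conv: "AE x in lborel. convergent (\<lambda>k. f (r k) x)"
  proof eventually_elim
    case (elim x)
    define B where "B = enn2real (\<Sum>k. ennreal (4^k * (cmod (d k x))\<^sup>2))"
    have B: "(\<Sum>k. ennreal (4^k * (cmod (d k x))\<^sup>2)) = ennreal B" "B \<ge> 0"
      using elim by (auto simp: B_def less_top)
    have le: "4^k * (cmod (d k x))\<^sup>2 \<le> B" for k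
    proof -
      have "sum (\<lambda>k. ennreal (4^k * (cmod (d k x))\<^sup>2)) {k} \<le> (\<Sum>k. ennreal (4^k * (cmod (d k x))\<^sup>2))"
        by (rule sum_le_suminf) auto
      then show ?thesis using B by (simp add: ennreal_le_iff)
    qed
    have "cmod (d k x) \<le> sqrt B * (1/2)^k" for k
    proof (rule power2_le_imp_le)
      have "((1/2::real)^k)\<^sup>2 = ((1/2)\<^sup>2)^k" by (simp only: power_mult[symmetric] mult.commute)
      then have h: "((1/2::real)^k)\<^sup>2 = 1 / 4^k" by (simp add: power2_eq_square power_one_over)
      have "(sqrt B * (1/2)^k)\<^sup>2 = B * (1 / 4^k)"
        unfolding power_mult_distrib h using B by simp
      also have "\<dots> \<ge> (cmod (d k x))\<^sup>2"
        using le[of k] by (simp add: field_simps)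
      finally show "(cmod (d k x))\<^sup>2 \<le> (sqrt B * (1/2)^k)\<^sup>2" .
    qed (use B in simp)
    moreover have "summable (\<lambda>k. sqrt B * (1/2)^k)" by (intro summable_mult summable_geometric) simp
    ultimately have "summable (\<lambda>k. d k x)" by (metis summable_comparison_test')
    moreover have "(\<Sum>k<n. d k x) = f (r n) x - f (r 0) x" for n
      unfolding d_def by (rule sum_lessThan_telescope)
    ultimately have "convergent (\<lambda>n. f (r n) x - f (r 0) x)" by (simp only: summable_iff_convergent)
    then have "convergent (\<lambda>n. (f (r n) x - f (r 0) x) + f (r 0) x)" by (intro convergent_add convergent_const)
    then show ?case by simp
  qed
  define F where "F x = lim (\<lambda>k. f (r k) x)" for x
  have [measurable]: "F \<in> borel_measurable lborel" unfolding F_def[abs_def] by measurable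
  have lim: "AE x in lborel. (\<lambda>k. f (r k) x) \<longlonglongrightarrow> F x"
    using conv by eventually_elim (simp add: F_def convergent_LIMSEQ_iff)
  \<comment> \<open>Fatou is applied along the subsequence with \<open>m\<close> fixed. The bound
    thus holds for every \<open>m \<ge> N k\<close>, so the whole sequence converges and not only
    the subsequence.\<close>
  have key: "(\<lambda>x. f m x - F x) \<in> Lp 2" "l2norm (\<lambda>x. f m x - F x) \<le> (1/4)^k" if "m \<ge> N k" for m k
  proof -
    have le: "r k \<le> r (i + k)" for i by (rule lift_Suc_mono_le[of r, OF rmono]) simp
    have a: "l2norm (\<lambda>x. f m x - f (r (i + k)) x) \<le> (1/4)^k" for i
      using N[of k m "r (i + k)"] that le[of i] rN[of k] by auto
    have b: "AE x in lborel. (\<lambda>i. f m x - f (r (i + k)) x) \<longlonglongrightarrow> f m x - F x"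
      using lim by eventually_elim (intro tendsto_intros LIMSEQ_ignore_initial_segment)
    show "(\<lambda>x. f m x - F x) \<in> Lp 2" "l2norm (\<lambda>x. f m x - F x) \<le> (1/4)^k"
      using L2_Fatou[OF _ a _ b] f by auto
  qed
  have "F \<in> Lp 2" using L2_diff[OF f[of "N 0"] key(1)[of 0 "N 0"]] by simp
  moreover have "(\<lambda>n. l2norm (\<lambda>x. f n x - F x)) \<longlonglongrightarrow> 0"
  proof (rule LIMSEQ_I)
    fix e :: real assume "e > 0"
    then obtain k where k: "(1/4::real)^k < e" using real_arch_pow_inv[of e "1/4"] by auto
    have "norm (l2norm (\<lambda>x. f n x - F x) - 0) < e" if "n \<ge> N k" for n
      using key(2)[OF that] k by simp
    then show "\<exists>no. \<forall>n\<ge>no. norm (l2norm (\<lambda>x. f n x - F x) - 0) < e" by blast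
  qed
  ultimately show ?thesis by blast
qed

lemma l2norm_lim:
  assumes f: "\<And>n. f n \<in> Lp 2" and F: "F \<in> Lp 2" and l: "((\<lambda>n. l2norm (\<lambda>x. f n x - F x)) \<longlongrightarrow> 0) A"
  shows "((\<lambda>n. l2norm (f n)) \<longlongrightarrow> l2norm F) A"
proof -
  have "((\<lambda>n. l2norm (f n) - l2norm F) \<longlongrightarrow> 0) A"
    by (rule Lim_null_comparison[OF _ l]) (simp add: l2norm_reverse_triangle f F)
  then show ?thesis by (simp add: LIM_zero_iff)
qed

lemma l2inner_lim_left:
  assumes f: "\<And>n. f n \<in> Lp 2" and F: "F \<in> Lp 2" and G: "G \<in> Lp 2"
    and l: "((\<lambda>n. l2norm (\<lambda>x. f n x - F x)) \<longlongrightarrow> 0) A"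
  shows "((\<lambda>n. l2inner (f n) G) \<longlongrightarrow> l2inner F G) A"
proof -
  have "((\<lambda>n. l2inner (f n) G - l2inner F G) \<longlongrightarrow> 0) A"
  proof (rule Lim_null_comparison)
    show "\<forall>\<^sub>F n in A. cmod (l2inner (f n) G - l2inner F G) \<le> l2norm (\<lambda>x. f n x - F x) * l2norm G"
      using l2inner_le[OF L2_diff[OF f F] G] by (simp add: l2inner_diff_left f F G)
    show "((\<lambda>n. l2norm (\<lambda>x. f n x - F x) * l2norm G) \<longlongrightarrow> 0) A"
      using tendsto_mult_right[OF l, of "l2norm G"] by simp
  qed
  then show ?thesis by (simp add: LIM_zero_iff)
qed

lemma l2norm_dominated:
  assumes h: "h \<in> Lp 2" and [measurable]: "\<And>n. f n \<in> borel_measurable lborel"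
    and lim: "AE x in lborel. (\<lambda>n::nat. f n x) \<longlonglongrightarrow> 0"
    and b: "\<And>n. AE x in lborel. cmod (f n x) \<le> cmod (h x)"
  shows "(\<lambda>n. l2norm (f n)) \<longlonglongrightarrow> 0"
proof -
  have "(\<lambda>n. LINT x|lborel. (cmod (f n x))\<^sup>2) \<longlonglongrightarrow> (LINT x::real|lborel. 0)"
  proof (rule integral_dominated_convergence[where w="\<lambda>x. (cmod (h x))\<^sup>2"])
    show "AE x in lborel. (\<lambda>i. (cmod (f i x))\<^sup>2) \<longlonglongrightarrow> 0"
      using lim
    proof eventually_elim
      case (elim x)
      from tendsto_power[OF tendsto_norm[OF elim], of 2] show ?case by simp
    qed
    show "AE x in lborel. norm ((cmod (f n x))\<^sup>2) \<le> (cmod (h x))\<^sup>2" for n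
      using b[of n] by eventually_elim (simp add: power_mono)
  qed (use L2_integrable_sq[OF h] in auto)
  then have "(\<lambda>n. sqrt (LINT x|lborel. (cmod (f n x))\<^sup>2)) \<longlonglongrightarrow> sqrt 0"
    by (intro tendsto_real_sqrt) simp
  then show ?thesis by (simp add: l2norm_def)
qed

lemma L2_const_indicator: "(\<lambda>x. c * indicator {a..b} x) \<in> Lp 2"
proof -
  have "integrable lborel (\<lambda>x. (cmod c)\<^sup>2 * indicat_real {a..b} x)"
    by (intro integrable_mult_right integrable_real_indicator) (auto simp: emeasure_lborel_Icc_eq)
  also have "(\<lambda>x. (cmod c)\<^sup>2 * indicat_real {a..b} x) = (\<lambda>x. (cmod (c * indicator {a..b} x))\<^sup>2)"
    by (auto simp: indicator_def norm_mult)
  finally show ?thesis by (simp add: Lp_2_iff)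
qed

text \<open>Cutting \<open>u\<close> in height and in range costs little by dominated convergence;
  the cut function is an almost everywhere limit of continuous functions, and forcing the same cuts
  on these makes dominated convergence available a second time.\<close>

lemma L2_approx_continuous:
  assumes u: "u \<in> Lp 2" and e: "e > 0"
  obtains v B R where "v \<in> Lp 2" "continuous_on UNIV v" "\<And>x. cmod (v x) \<le> B"
    "\<And>x. \<bar>x\<bar> > R \<Longrightarrow> v x = 0" "l2norm (\<lambda>x. u x - v x) < e"
proof -
  have [measurable]: "u \<in> borel_measurable lborel" using u by (rule L2_measurable)
  define A where "A k = {x. \<bar>x\<bar> \<le> real k \<and> cmod (u x) \<le> real k}" for k :: nat
  have [measurable]: "A k \<in> sets borel" for k unfolding A_def by measurable
  define w where "w k x = indicator (A k) x * u x" for k x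
  have wL: "w k \<in> Lp 2" for k unfolding w_def[abs_def] by (rule L2_indicator[OF u]) measurable
  have [measurable]: "w k \<in> borel_measurable lborel" for k by (rule L2_measurable[OF wL])
  have "(\<lambda>k. l2norm (\<lambda>x. u x - w k x)) \<longlonglongrightarrow> 0"
  proof (rule l2norm_dominated[OF u])
    show "AE x in lborel. (\<lambda>k. u x - w k x) \<longlonglongrightarrow> 0"
    proof (rule AE_I2)
      fix x
      obtain K :: nat where K: "max \<bar>x\<bar> (cmod (u x)) \<le> real K" using real_arch_simple by blast
      have "\<forall>\<^sub>F k in sequentially. u x - w k x = 0"
        using eventually_ge_at_top[of K] by eventually_elim (use K in \<open>auto simp: w_def A_def indicator_def\<close>)
      then show "(\<lambda>k. u x - w k x) \<longlonglongrightarrow> 0" by (rule tendsto_eventually)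
    qed
    show "AE x in lborel. cmod (u x - w k x) \<le> cmod (u x)" for k
      by (auto simp: w_def indicator_def)
  qed measurable
  from order_tendstoD(2)[OF this, of "e/2"] e
  have "\<forall>\<^sub>F k in sequentially. l2norm (\<lambda>x. u x - w k x) < e / 2" by simp
  with eventually_gt_at_top[of 0]
  have "\<forall>\<^sub>F k in sequentially. 0 < k \<and> l2norm (\<lambda>x. u x - w k x) < e / 2" by eventually_elim simp
  from eventually_happens'[OF sequentially_bot this]
  obtain k where k: "0 < k" "l2norm (\<lambda>x. u x - w k x) < e / 2" by blast
  \<comment> \<open>Over the completed measure, measurability is equivalent to being a limit of
    continuous functions off a negligible set; this supplies the continuous approximants
    \<open>g n\<close>.\<close>
  have "w k \<in> borel_measurable lebesgue" by (rule measurable_completion) measurable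
  then have "w k measurable_on UNIV" by (simp add: lebesgue_measurable_imp_measurable_on)
  then obtain N g where N: "negligible N" and g: "\<And>n. continuous_on UNIV (g n)"
    and lim: "\<And>x. x \<notin> N \<Longrightarrow> (\<lambda>n. g n x) \<longlonglongrightarrow> w k x"
    unfolding measurable_on_def by auto
  have N': "AE x in lborel. x \<notin> N"
    using N AE_not_in[of N lebesgue] AE_completion_iff[of "\<lambda>x. x \<notin> N" lborel]
    unfolding negligible_iff_null_sets by blast
  \<comment> \<open>\<open>c\<close> is the radial retraction of the plane onto the disc of radius
    \<open>k\<close>; \<open>0 < k\<close> keeps its denominator positive at the origin. Together
    \<open>c\<close> and \<open>cut\<close> give the approximants a common bound and a common
    support, while both leave \<open>w k\<close> unchanged.\<close>
  define c where "c z = complex_of_real (real k / max (real k) (cmod z)) * z" for z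
  have c_cont: "continuous_on UNIV c"
    unfolding c_def using k by (intro continuous_intros) (auto simp: max_def)
  have c_le: "cmod (c z) \<le> real k" for z
  proof -
    have m: "max (real k) (cmod z) > 0" using k by auto
    have "cmod (c z) = real k * cmod z / max (real k) (cmod z)"
      unfolding c_def norm_mult norm_of_real using m by simp
    also have "\<dots> \<le> real k" using m by (simp add: pos_divide_le_eq mult_left_mono)
    finally show ?thesis .
  qed
  have c_id: "c z = z" if "cmod z \<le> real k" for z using k that by (simp add: c_def max_def)
  define cut where "cut x = complex_of_real (max 0 (min 1 (real k + 1 - \<bar>x\<bar>)))" for x :: real
  have cut_cont: "continuous_on UNIV cut" unfolding cut_def by (intro continuous_intros)
  have cut_le: "cmod (cut x) \<le> 1" and cut_0: "\<bar>x\<bar> > real k + 1 \<Longrightarrow> cut x = 0"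
    and cut_1: "\<bar>x\<bar> \<le> real k \<Longrightarrow> cut x = 1" for x
    by (auto simp: cut_def)
  define v where "v n x = cut x * c (g n x)" for n x
  have v_cont: "continuous_on UNIV (v n)" for n
    unfolding v_def[abs_def] by (intro continuous_intros cut_cont continuous_on_compose2[OF c_cont g]) auto
  then have [measurable]: "v n \<in> borel_measurable borel" for n by (rule borel_measurable_continuous_onI)
  have v_le: "cmod (v n x) \<le> real k" for n x
    unfolding v_def norm_mult using mult_mono[OF cut_le[of x] c_le[of "g n x"]] by simp
  define h where "h x = complex_of_real (2 * real k) * indicator {- (real k + 1)..real k + 1} x" for x
  have hL: "h \<in> Lp 2" unfolding h_def[abs_def] by (rule L2_const_indicator)
  have v_h: "cmod (v n x) \<le> cmod (h x)" for n x
    using v_le[of n x] cut_0[of x] by (auto simp: h_def indicator_def v_def norm_mult)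
  have w_le: "cmod (w k x) \<le> real k" "\<bar>x\<bar> > real k \<Longrightarrow> w k x = 0" for x
    by (auto simp: w_def A_def indicator_def)
  have vL: "v n \<in> Lp 2" for n by (rule L2_bound[OF hL]) (use v_h in auto)
  have "(\<lambda>n. l2norm (\<lambda>x. w k x - v n x)) \<longlonglongrightarrow> 0"
  proof (rule l2norm_dominated[OF hL])
    show "AE x in lborel. (\<lambda>n. w k x - v n x) \<longlonglongrightarrow> 0"
      using N'
    proof eventually_elim
      case (elim x)
      have "(\<lambda>n. c (g n x)) \<longlonglongrightarrow> c (w k x)"
        using continuous_on_tendsto_compose[OF c_cont lim[OF elim]] by simp
      then have "(\<lambda>n. w k x - cut x * c (g n x)) \<longlonglongrightarrow> w k x - cut x * c (w k x)" by (intro tendsto_intros)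
      moreover have "cut x * c (w k x) = w k x"
        using w_le[of x] cut_1[of x] c_id[of "w k x"] by (cases "\<bar>x\<bar> \<le> real k") auto
      ultimately show ?case by (simp add: v_def)
    qed
    show "AE x in lborel. cmod (w k x - v n x) \<le> cmod (h x)" for n
    proof (rule AE_I2)
      fix x
      show "cmod (w k x - v n x) \<le> cmod (h x)"
      proof (cases "\<bar>x\<bar> \<le> real k + 1")
        case True
        then have "cmod (h x) = 2 * real k" by (auto simp: h_def indicator_def norm_mult)
        then show ?thesis using norm_triangle_ineq4[of "w k x" "v n x"] v_le[of n x] w_le(1)[of x] by linarith
      next
        case False
        then show ?thesis using w_le(2)[of x] cut_0[of x] by (simp add: v_def)
      qed
    qed
  qed measurable
  from order_tendstoD(2)[OF this, of "e/2"] e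
  have "\<forall>\<^sub>F n in sequentially. l2norm (\<lambda>x. w k x - v n x) < e / 2" by simp
  from eventually_happens'[OF sequentially_bot this]
  obtain n where n: "l2norm (\<lambda>x. w k x - v n x) < e / 2" by blast
  have "l2norm (\<lambda>x. u x - v n x) < e"
    using l2norm_triangle_diff[OF u wL[of k] vL[of n]] n k by simp
  moreover have "\<And>x. \<bar>x\<bar> > real k + 1 \<Longrightarrow> v n x = 0" by (simp add: v_def cut_0)
  ultimately show ?thesis using that[OF vL v_cont v_le] by blast
qed

text \<open>A three-epsilon argument: translations are isometric, and for the continuous approximant
  \<open>v\<close> the bounded shifts stay within \<open>H\<close>, so all differences live on
  \<open>[-(R + H), R + H]\<close>, are at most \<open>2 * B\<close> and tend to 0
  pointwise.\<close>

lemma L2_translation_continuous: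
  assumes u: "u \<in> Lp 2" and h: "h \<longlonglongrightarrow> 0"
  shows "(\<lambda>n. l2norm (\<lambda>x. u (x + h n) - u x)) \<longlonglongrightarrow> 0"
proof (rule LIMSEQ_I)
  fix e :: real assume e: "e > 0"
  then have "e / 3 > 0" by simp
  from L2_approx_continuous[OF u this] obtain v B R where vL: "v \<in> Lp 2" and vc: "continuous_on UNIV v"
    and B: "\<And>x. cmod (v x) \<le> B" and R: "\<And>x. \<bar>x\<bar> > R \<Longrightarrow> v x = 0" and uv: "l2norm (\<lambda>x. u x - v x) < e / 3"
    by metis
  have [measurable]: "v \<in> borel_measurable borel" using L2_measurable[OF vL] by simp
  have "Bseq h" using h by (intro convergent_imp_Bseq convergentI)
  then obtain H where H: "\<And>n. \<bar>h n\<bar> \<le> H" by (auto simp: Bseq_def)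
  have H0: "H \<ge> 0" using H[of 0] by linarith
  define w where "w x = complex_of_real (2 * B) * indicator {- (R + H)..R + H} x" for x
  have wL: "w \<in> Lp 2" unfolding w_def[abs_def] by (rule L2_const_indicator)
  have B0: "B \<ge> 0" using B[of 0] norm_ge_zero[of "v 0"] by linarith
  have "(\<lambda>n. l2norm (\<lambda>x. v (x + h n) - v x)) \<longlonglongrightarrow> 0"
  proof (rule l2norm_dominated[OF wL])
    show "AE x in lborel. (\<lambda>n. v (x + h n) - v x) \<longlonglongrightarrow> 0"
    proof (rule AE_I2)
      fix x
      have "(\<lambda>n. x + h n) \<longlonglongrightarrow> x + 0" by (intro tendsto_intros h)
      then have "(\<lambda>n. v (x + h n)) \<longlonglongrightarrow> v (x + 0)"
        using continuous_on_tendsto_compose[OF vc, of _ "x + 0"] by simp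
      then show "(\<lambda>n. v (x + h n) - v x) \<longlonglongrightarrow> 0" by (simp add: LIM_zero)
    qed
    show "AE x in lborel. cmod (v (x + h n) - v x) \<le> cmod (w x)" for n
    proof (rule AE_I2)
      fix x
      show "cmod (v (x + h n) - v x) \<le> cmod (w x)"
      proof (cases "\<bar>x\<bar> \<le> R + H")
        case True
        then have "cmod (w x) = 2 * B" using B0 by (auto simp: w_def indicator_def norm_mult)
        then show ?thesis using norm_triangle_ineq4[of "v (x + h n)" "v x"] B[of x] B[of "x + h n"] by linarith
      next
        case False
        then have "\<bar>x\<bar> > R" "\<bar>x + h n\<bar> > R" using H[of n] H0 by auto
        then show ?thesis using R[of x] R[of "x + h n"] by simp
      qed
    qed
  qed measurable
  then obtain N where N: "\<And>n. n \<ge> N \<Longrightarrow> l2norm (\<lambda>x. v (x + h n) - v x) < e / 3"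
    using LIMSEQ_D[of _ 0 "e/3"] e by fastforce
  have "norm (l2norm (\<lambda>x. u (x + h n) - u x) - 0) < e" if "n \<ge> N" for n
  proof -
    have "l2norm (\<lambda>x. u (x + h n) - v (x + h n)) = l2norm (\<lambda>x. u x - v x)"
      using l2norm_shift[of "\<lambda>x. u x - v x" "h n"] by simp
    then show ?thesis
      using l2norm_triangle_diff[OF L2_shift[OF u] L2_shift[OF vL] u, of "h n" "h n"]
        l2norm_triangle_diff[OF L2_shift[OF vL] vL u, of "h n"] N[OF that] uv l2norm_commute[of u v]
      by simp
  qed
  then show "\<exists>no. \<forall>n\<ge>no. norm (l2norm (\<lambda>x. u (x + h n) - u x) - 0) < e" by blast
qed

section \<open>Plancherel's theorem\<close>

definition ft :: "(real \<Rightarrow> complex) \<Rightarrow> real \<Rightarrow> complex" where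
  "ft u \<xi> = (LINT x|lborel. exp (- \<i> * complex_of_real (x * \<xi>)) * u x)"

lemma norm_kernel[simp]: "cmod (exp (- (\<i> * complex_of_real t))) = 1" "cmod (iexp t) = 1"
  by (simp_all add: norm_exp_eq_Re)

lemma kernel_measurable[measurable]:
  "f \<in> borel_measurable M \<Longrightarrow> (\<lambda>x. exp (- \<i> * complex_of_real (f x))) \<in> borel_measurable M"
  "f \<in> borel_measurable M \<Longrightarrow> (\<lambda>x. iexp (f x)) \<in> borel_measurable M"
proof -
  have m: "(\<lambda>t::real. exp (- \<i> * complex_of_real t)) \<in> borel_measurable borel"
    "(\<lambda>t::real. iexp t) \<in> borel_measurable borel"
    by (intro borel_measurable_continuous_onI continuous_intros)+
  show "f \<in> borel_measurable M \<Longrightarrow> (\<lambda>x. exp (- \<i> * complex_of_real (f x))) \<in> borel_measurable M"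
    "f \<in> borel_measurable M \<Longrightarrow> (\<lambda>x. iexp (f x)) \<in> borel_measurable M"
    using measurable_compose[OF _ m(1)] measurable_compose[OF _ m(2)] by blast+
qed

lemma kernel_integrable:
  assumes "integrable lborel u"
  shows "integrable lborel (\<lambda>x. exp (- \<i> * complex_of_real (x * \<xi>)) * u x)"
  by (rule Bochner_Integration.integrable_bound[OF assms]) (use assms in \<open>auto simp: norm_mult\<close>)

lemma ft_bound: "cmod (ft u \<xi>) \<le> (LINT x|lborel. cmod (u x))"
proof -
  have "cmod (ft u \<xi>) \<le> (LINT x|lborel. cmod (exp (- \<i> * complex_of_real (x * \<xi>)) * u x))"
    unfolding ft_def by (rule integral_norm_bound)
  then show ?thesis by (simp add: norm_mult)
qed

lemma ft_measurable[measurable]: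
  assumes [measurable]: "u \<in> borel_measurable borel" shows "ft u \<in> borel_measurable borel"
  unfolding ft_def[abs_def] by measurable

text \<open>Fubini with a kernel symmetric in the two variables. This self-adjointness for the
  bilinear pairing takes the place of an inversion formula, both in Plancherel's identity and in the
  proof that the transform is onto.\<close>

lemma ft_mult_formula:
  assumes u: "integrable lborel u" and v: "integrable lborel v"
  shows "(LINT \<xi>|lborel. ft u \<xi> * v \<xi>) = (LINT x|lborel. u x * ft v x)"
proof -
  have [measurable]: "u \<in> borel_measurable borel" "v \<in> borel_measurable borel" using u v by auto
  define k where "k x \<xi> = exp (- \<i> * complex_of_real (x * \<xi>)) * u x * v \<xi>" for x \<xi>
  have int: "integrable (lborel \<Otimes>\<^sub>M lborel) (case_prod k)"
  proof (rule lborel_pair.Fubini_integrable)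
    show "case_prod k \<in> borel_measurable (lborel \<Otimes>\<^sub>M lborel)" unfolding k_def[abs_def] by measurable
    have "(\<lambda>x. LINT y|lborel. norm (case_prod k (x, y))) = (\<lambda>x. cmod (u x) * (LINT y|lborel. cmod (v y)))"
      by (simp add: k_def norm_mult)
    then show "integrable lborel (\<lambda>x. LINT y|lborel. norm (case_prod k (x, y)))" using u by simp
    have "integrable lborel (\<lambda>y. exp (- \<i> * complex_of_real (x * y)) * v y * u x)" for x
      using kernel_integrable[OF v, of x] by (intro integrable_mult_left) (simp add: mult.commute)
    then show "AE x in lborel. integrable lborel (\<lambda>y. case_prod k (x, y))"
      by (simp add: k_def mult_ac)
  qed
  have "(LINT \<xi>|lborel. ft u \<xi> * v \<xi>) = (LINT \<xi>|lborel. LINT x|lborel. k x \<xi>)"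
    unfolding ft_def k_def by simp
  also have "\<dots> = (LINT x|lborel. LINT \<xi>|lborel. k x \<xi>)"
    by (rule lborel_pair.Fubini_integral[OF int])
  also have "\<dots> = (LINT x|lborel. u x * ft v x)"
  proof (rule Bochner_Integration.integral_cong[OF refl])
    fix x
    have "(LINT \<xi>|lborel. k x \<xi>) = (LINT \<xi>|lborel. u x * (exp (- \<i> * complex_of_real (\<xi> * x)) * v \<xi>))"
      unfolding k_def by (simp add: mult_ac)
    then show "(LINT \<xi>|lborel. k x \<xi>) = u x * ft v x" unfolding ft_def by simp
  qed
  finally show ?thesis .
qed

section \<open>Gaussian regularization and Plancherel's identity for integrable functions\<close>

definition gauss :: "real \<Rightarrow> real \<Rightarrow> real" where "gauss s \<xi> = exp (- (s * \<xi>)\<^sup>2 / 2)"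

lemma gauss_measurable[measurable]: "gauss s \<in> borel_measurable borel"
  unfolding gauss_def[abs_def] by measurable

lemma gauss_std_normal: "gauss s \<xi> = sqrt (2 * pi) * std_normal_density (s * \<xi>)"
  by (simp add: gauss_def std_normal_density_def)

lemma gauss_integrable: assumes "s > 0" shows "integrable lborel (gauss s)"
proof -
  have "integrable lborel (\<lambda>x. std_normal_density (0 + s * x))"
    using assms by (intro lborel_integrable_real_affine) auto
  then show ?thesis unfolding gauss_std_normal[abs_def] by simp
qed

text \<open>This is the characteristic function of the standard normal distribution, evaluated at
  \<open>- t\<close> because of the sign in the kernel.\<close>

lemma std_normal_ft: "(LINT z|lborel. exp (- \<i> * complex_of_real (z * t)) * complex_of_real (std_normal_density z)) = complex_of_real (gauss 1 t)"
proof -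
  have "char std_normal_distribution (- t) = complex_of_real (gauss 1 t)"
    by (simp add: char_std_normal_distribution gauss_def)
  moreover have "char std_normal_distribution (- t) =
      (LINT z|lborel. std_normal_density z *\<^sub>R iexp (- t * z))"
    unfolding char_def by (rule integral_density) auto
  ultimately show ?thesis by (simp add: scaleR_conv_of_real mult_ac)
qed

text \<open>The result is \<open>2 * pi\<close> times the normal density of standard deviation
  \<open>s\<close>: an approximate identity as \<open>s\<close> tends to 0. It follows from the
  standard case by the substitution \<open>z \<rightarrow> s * z\<close>.\<close>

lemma ft_gauss: assumes s: "s > 0"
  shows "ft (\<lambda>\<xi>. complex_of_real (gauss s \<xi>)) x = complex_of_real (2 * pi / s * std_normal_density (x / s))"
proof -
  have "complex_of_real (gauss 1 (x / s)) = (LINT z|lborel. exp (- \<i> * complex_of_real (z * (x / s))) * complex_of_real (std_normal_density z))"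
    by (rule std_normal_ft[symmetric])
  also have "\<dots> = \<bar>s\<bar> *\<^sub>R (LINT z|lborel. exp (- \<i> * complex_of_real ((0 + s * z) * (x / s))) * complex_of_real (std_normal_density (0 + s * z)))"
    by (rule lborel_integral_real_affine) (use s in auto)
  also have "\<dots> = \<bar>s\<bar> *\<^sub>R (LINT z|lborel. (exp (- \<i> * complex_of_real (z * x)) * complex_of_real (gauss s z)) / complex_of_real (sqrt (2 * pi)))"
    using s by (simp add: gauss_std_normal)
  also have "\<dots> = complex_of_real (s / sqrt (2 * pi)) * ft (\<lambda>\<xi>. complex_of_real (gauss s \<xi>)) x"
    unfolding ft_def using s by (simp add: scaleR_conv_of_real)
  finally have eq: "complex_of_real (gauss 1 (x / s)) = complex_of_real (s / sqrt (2 * pi)) * ft (\<lambda>\<xi>. complex_of_real (gauss s \<xi>)) x" .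
  have "ft (\<lambda>\<xi>. complex_of_real (gauss s \<xi>)) x = complex_of_real (sqrt (2 * pi) / s) * complex_of_real (gauss 1 (x / s))"
    unfolding eq using s by (simp add: field_simps)
  also have "\<dots> = complex_of_real (sqrt (2 * pi) / s * (sqrt (2 * pi) * std_normal_density (x / s)))"
    by (simp add: gauss_std_normal)
  also have "sqrt (2 * pi) / s * (sqrt (2 * pi) * std_normal_density (x / s)) = 2 * pi / s * std_normal_density (x / s)"
    by simp
  finally show ?thesis .
qed

text \<open>
  Regularizing \<open>\<integral> |ft u|\<^sup>2\<close> by a wide Gaussian turns it into an average of the autocorrelation of \<open>u\<close>
  against a narrow one; Plancherel's identity is the limit \<open>s \<rightarrow> 0\<close>.
\<close>

lemma autocorrelation_gauss:
  assumes u: "integrable lborel u" and u2: "u \<in> Lp 2" and s: "s > 0"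
  shows "(LINT \<xi>|lborel. ft u \<xi> * (complex_of_real (gauss s \<xi>) * cnj (ft u \<xi>))) =
    (LINT z|lborel. complex_of_real (2 * pi * std_normal_density z) * l2inner u (\<lambda>x. u (x + s * z)))"
proof -
  have [measurable]: "u \<in> borel_measurable borel" using u by auto
  \<comment> \<open>The Gaussian makes \<open>v\<close> integrable because \<open>ft u\<close> is
    bounded. The multiplication formula then applies although \<open>ft u\<close> is not yet known
    to be square integrable.\<close>
  define v where "v \<xi> = complex_of_real (gauss s \<xi>) * cnj (ft u \<xi>)" for \<xi>
  have v: "integrable lborel v"
  proof (rule Bochner_Integration.integrable_bound)
    show "integrable lborel (\<lambda>\<xi>. (LINT x|lborel. cmod (u x)) * gauss s \<xi>)"
      using gauss_integrable[OF s] by simp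
    show "AE \<xi> in lborel. cmod (v \<xi>) \<le> norm ((LINT x|lborel. cmod (u x)) * gauss s \<xi>)"
    proof (rule AE_I2)
      fix \<xi>
      have "cmod (v \<xi>) = gauss s \<xi> * cmod (ft u \<xi>)" by (simp add: v_def norm_mult gauss_def)
      also have "\<dots> \<le> gauss s \<xi> * (LINT x|lborel. cmod (u x))"
        by (intro mult_left_mono ft_bound) (simp add: gauss_def)
      finally show "cmod (v \<xi>) \<le> norm ((LINT x|lborel. cmod (u x)) * gauss s \<xi>)"
        by (simp add: mult.commute)
    qed
  qed (simp add: v_def[abs_def])
  \<comment> \<open>Used in a second application of the multiplication formula: modulation by
    \<open>x\<close> moves the transformed Gaussian to the centre \<open>x\<close>, so that
    \<open>u\<close> is averaged around \<open>x\<close> at scale \<open>s\<close>.\<close>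
  define w where "w x \<xi> = iexp (x * \<xi>) * complex_of_real (gauss s \<xi>)" for x \<xi>
  have w: "integrable lborel (w x)" for x
    by (rule Bochner_Integration.integrable_bound[OF gauss_integrable[OF s]])
       (auto simp: w_def[abs_def] norm_mult)
  have ftw: "ft (w x) y = complex_of_real (2 * pi / s * std_normal_density ((y - x) / s))" for x y
  proof -
    have "exp (- \<i> * complex_of_real (\<xi> * y)) * w x \<xi> = exp (- \<i> * complex_of_real (\<xi> * (y - x))) * complex_of_real (gauss s \<xi>)" for \<xi>
      unfolding w_def mult.assoc[symmetric] exp_add[symmetric] by (simp add: algebra_simps)
    then have "ft (w x) y = ft (\<lambda>\<xi>. complex_of_real (gauss s \<xi>)) (y - x)"
      unfolding ft_def by simp
    then show ?thesis by (simp add: ft_gauss[OF s])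
  qed
  \<comment> \<open>The integrand after substituting \<open>y = x + s * z\<close>. For fixed
    \<open>z\<close>, Cauchy-Schwarz in \<open>x\<close> bounds the integral of its modulus by
    \<open>(l2norm u)\<^sup>2\<close> times a multiple of the normal density, which justifies
    Fubini.\<close>
  define k where "k z x = u x * (cnj (u (x + s * z)) * complex_of_real (2 * pi * std_normal_density z))" for z x
  have ftv: "u x * ft v x = (LINT z|lborel. k z x)" for x
  proof -
    have "cnj (ft v x) = (LINT \<xi>|lborel. ft u \<xi> * w x \<xi>)"
      unfolding ft_def[of v] Bochner_Integration.integral_cnj[symmetric]
      by (intro Bochner_Integration.integral_cong refl) (simp add: v_def w_def exp_cnj mult_ac)
    also have "\<dots> = (LINT y|lborel. u y * complex_of_real (2 * pi / s * std_normal_density ((y - x) / s)))"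
      unfolding ft_mult_formula[OF u w] ftw ..
    also have "\<dots> = \<bar>s\<bar> *\<^sub>R (LINT z|lborel. u (x + s * z) * complex_of_real (2 * pi / s * std_normal_density ((x + s * z - x) / s)))"
      by (rule lborel_integral_real_affine) (use s in auto)
    also have "\<dots> = (LINT z|lborel. \<bar>s\<bar> *\<^sub>R (u (x + s * z) * complex_of_real (2 * pi / s * std_normal_density z)))"
      using s by simp
    also have "\<dots> = (LINT z|lborel. u (x + s * z) * complex_of_real (2 * pi * std_normal_density z))"
      using s by (intro Bochner_Integration.integral_cong refl) (simp add: scaleR_conv_of_real)
    finally have "ft v x = cnj (LINT z|lborel. u (x + s * z) * complex_of_real (2 * pi * std_normal_density z))"
      by (metis complex_cnj_cnj)
    then show ?thesis
      unfolding k_def Bochner_Integration.integral_cnj[symmetric] by simp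
  qed
  have kn: "cmod (k z x) = cmod (u x) * cmod (u (x + s * z)) * (2 * pi * std_normal_density z)" for z x
    by (simp add: k_def norm_mult)
  have uu: "integrable lborel (\<lambda>x. cmod (u x) * cmod (u (x + s * z)))" for z
    by (rule L2_norm_mult_integrable[OF u2 L2_shift[OF u2]])
  have int: "integrable (lborel \<Otimes>\<^sub>M lborel) (case_prod k)"
  proof (rule lborel_pair.Fubini_integrable)
    show m: "case_prod k \<in> borel_measurable (lborel \<Otimes>\<^sub>M lborel)" unfolding k_def[abs_def] by measurable
    show "integrable lborel (\<lambda>z. LINT x|lborel. norm (case_prod k (z, x)))"
    proof (rule Bochner_Integration.integrable_bound)
      show "integrable lborel (\<lambda>z. (l2norm u)\<^sup>2 * (2 * pi * std_normal_density z))" by simp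
      show "(\<lambda>z. LINT x|lborel. norm (case_prod k (z, x))) \<in> borel_measurable lborel"
        using m by measurable
      show "AE z in lborel. norm (LINT x|lborel. norm (case_prod k (z, x))) \<le> norm ((l2norm u)\<^sup>2 * (2 * pi * std_normal_density z))"
      proof (rule AE_I2)
        fix z
        have "(LINT x|lborel. cmod (u x) * cmod (u (x + s * z))) \<le> (l2norm u)\<^sup>2"
          using L2_Cauchy_Schwarz[OF u2 L2_shift[OF u2, of "s * z"]] by (simp add: l2norm_shift power2_eq_square)
        then have "(LINT x|lborel. cmod (k z x)) \<le> (l2norm u)\<^sup>2 * (2 * pi * std_normal_density z)"
          unfolding kn by (simp add: mult_right_mono)
        moreover have "(LINT x|lborel. cmod (k z x)) \<ge> 0" by simp
        ultimately show "norm (LINT x|lborel. norm (case_prod k (z, x))) \<le> norm ((l2norm u)\<^sup>2 * (2 * pi * std_normal_density z))"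
          by simp
      qed
    qed
    show "AE z in lborel. integrable lborel (\<lambda>x. case_prod k (z, x))"
    proof (rule AE_I2)
      fix z
      have "integrable lborel (\<lambda>x. cmod (k z x))" unfolding kn using uu[of z] by simp
      then show "integrable lborel (\<lambda>x. case_prod k (z, x))"
        by (subst integrable_norm_iff[symmetric]) (auto simp: k_def[abs_def])
    qed
  qed
  have "(LINT \<xi>|lborel. ft u \<xi> * v \<xi>) = (LINT x|lborel. u x * ft v x)"
    by (rule ft_mult_formula[OF u v])
  also have "\<dots> = (LINT x|lborel. LINT z|lborel. k z x)" unfolding ftv ..
  also have "\<dots> = (LINT z|lborel. LINT x|lborel. k z x)" by (rule lborel_pair.Fubini_integral[OF int])
  also have "\<dots> = (LINT z|lborel. complex_of_real (2 * pi * std_normal_density z) * l2inner u (\<lambda>x. u (x + s * z)))"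
  proof (rule Bochner_Integration.integral_cong[OF refl])
    fix z
    have "(LINT x|lborel. k z x) = (LINT x|lborel. complex_of_real (2 * pi * std_normal_density z) * (u x * cnj (u (x + s * z))))"
      unfolding k_def by (simp only: mult_ac)
    then show "(LINT x|lborel. k z x) = complex_of_real (2 * pi * std_normal_density z) * l2inner u (\<lambda>x. u (x + s * z))"
      unfolding l2inner_def by simp
  qed
  finally show ?thesis unfolding v_def .
qed

lemma autocorrelation_continuous:
  assumes u: "u \<in> Lp 2" and h: "h \<longlonglongrightarrow> 0"
  shows "(\<lambda>n. l2inner u (\<lambda>x. u (x + h n))) \<longlonglongrightarrow> complex_of_real ((l2norm u)\<^sup>2)"
proof -
  have "(\<lambda>n. l2inner (\<lambda>x. u (x + h n)) u) \<longlonglongrightarrow> l2inner u u"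
    by (rule l2inner_lim_left[OF L2_shift[OF u] u u L2_translation_continuous[OF u h]])
  then have "(\<lambda>n. cnj (l2inner (\<lambda>x. u (x + h n)) u)) \<longlonglongrightarrow> cnj (l2inner u u)" by (rule tendsto_cnj)
  then show ?thesis by (simp add: l2inner_commute[symmetric] l2inner_self)
qed

lemma Plancherel_L1_L2:
  assumes u: "integrable lborel u" and u2: "u \<in> Lp 2"
  shows "ft u \<in> Lp 2" "l2norm (ft u) = sqrt (2 * pi) * l2norm u"
proof -
  have [measurable]: "u \<in> borel_measurable borel" using u by auto
  define s where "s k = 1 / (real k + 1)" for k :: nat
  have s: "s k > 0" for k by (simp add: s_def)
  have s0: "s \<longlonglongrightarrow> 0" unfolding s_def[abs_def] using LIMSEQ_inverse_real_of_nat by (simp add: inverse_eq_divide add.commute)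
  \<comment> \<open>With the square root of the Gaussian, the squared modulus of \<open>g k\<close>
    carries exactly the weight \<open>gauss (s k)\<close>.\<close>
  define g where "g k \<xi> = complex_of_real (sqrt (gauss (s k) \<xi>)) * ft u \<xi>" for k \<xi>
  define A where "A k = (LINT z|lborel. complex_of_real (2 * pi * std_normal_density z) * l2inner u (\<lambda>x. u (x + s k * z)))" for k
  have [measurable]: "g k \<in> borel_measurable borel" for k unfolding g_def[abs_def] by measurable
  have gsq: "complex_of_real ((cmod (g k \<xi>))\<^sup>2) = ft u \<xi> * (complex_of_real (gauss (s k) \<xi>) * cnj (ft u \<xi>))" for k \<xi>
  proof -
    have "(cmod (g k \<xi>))\<^sup>2 = gauss (s k) \<xi> * (cmod (ft u \<xi>))\<^sup>2"
      by (simp add: g_def norm_mult power_mult_distrib gauss_def)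
    then show ?thesis using complex_norm_square[of "ft u \<xi>"] by simp
  qed
  have g_le1: "sqrt (gauss (s k) \<xi>) \<le> 1" for k \<xi> by (simp add: gauss_def)
  have gL: "g k \<in> Lp 2" for k
    unfolding Lp_2_iff
  proof
    show "integrable lborel (\<lambda>\<xi>. (cmod (g k \<xi>))\<^sup>2)"
    proof (rule Bochner_Integration.integrable_bound)
      show "integrable lborel (\<lambda>\<xi>. (LINT x|lborel. cmod (u x))\<^sup>2 * gauss (s k) \<xi>)"
        using gauss_integrable[OF s] by simp
      show "AE \<xi> in lborel. norm ((cmod (g k \<xi>))\<^sup>2) \<le> norm ((LINT x|lborel. cmod (u x))\<^sup>2 * gauss (s k) \<xi>)"
      proof (rule AE_I2)
        fix \<xi>
        have "(cmod (g k \<xi>))\<^sup>2 = (cmod (ft u \<xi>))\<^sup>2 * gauss (s k) \<xi>"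
          by (simp add: g_def norm_mult power_mult_distrib gauss_def)
        also have "\<dots> \<le> (LINT x|lborel. cmod (u x))\<^sup>2 * gauss (s k) \<xi>"
          by (intro mult_right_mono power_mono ft_bound) (simp_all add: gauss_def)
        finally show "norm ((cmod (g k \<xi>))\<^sup>2) \<le> norm ((LINT x|lborel. cmod (u x))\<^sup>2 * gauss (s k) \<xi>)"
          by (simp add: gauss_def)
      qed
    qed measurable
  qed simp
  have gA: "complex_of_real ((l2norm (g k))\<^sup>2) = A k" for k
    unfolding l2norm_sq A_def autocorrelation_gauss[OF u u2 s, symmetric] gsq[symmetric]
    by (rule integral_complex_of_real[symmetric])
  have ipb: "cmod (l2inner u (\<lambda>x. u (x + h))) \<le> (l2norm u)\<^sup>2" for h
    using l2inner_le[OF u2 L2_shift[OF u2, of h]] by (simp add: l2norm_shift power2_eq_square)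
  have Alim: "A \<longlonglongrightarrow> complex_of_real (2 * pi * (l2norm u)\<^sup>2)"
  proof -
    have "A \<longlonglongrightarrow> (LINT z|lborel. complex_of_real (2 * pi * std_normal_density z) * complex_of_real ((l2norm u)\<^sup>2))"
      unfolding A_def[abs_def]
    proof (rule integral_dominated_convergence[where w="\<lambda>z. 2 * pi * std_normal_density z * (l2norm u)\<^sup>2"])
      show "AE z in lborel. (\<lambda>k. complex_of_real (2 * pi * std_normal_density z) * l2inner u (\<lambda>x. u (x + s k * z)))
          \<longlonglongrightarrow> complex_of_real (2 * pi * std_normal_density z) * complex_of_real ((l2norm u)\<^sup>2)"
        by (intro AE_I2 tendsto_mult tendsto_const autocorrelation_continuous[OF u2] tendsto_mult_left_zero s0)
      show "AE z in lborel. cmod (complex_of_real (2 * pi * std_normal_density z) * l2inner u (\<lambda>x. u (x + s k * z)))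
          \<le> 2 * pi * std_normal_density z * (l2norm u)\<^sup>2" for k
        by (rule AE_I2) (simp add: norm_mult mult_left_mono ipb)
      show "(\<lambda>z. complex_of_real (2 * pi * std_normal_density z) * l2inner u (\<lambda>x. u (x + s k * z))) \<in> borel_measurable lborel" for k
        unfolding l2inner_def by measurable
    qed auto
    also have "(LINT z|lborel. complex_of_real (2 * pi * std_normal_density z) * complex_of_real ((l2norm u)\<^sup>2))
       = complex_of_real (LINT z|lborel. 2 * pi * std_normal_density z * (l2norm u)\<^sup>2)"
      by (subst integral_complex_of_real[symmetric]) simp
    also have "(LINT z|lborel. 2 * pi * std_normal_density z * (l2norm u)\<^sup>2) = 2 * pi * (l2norm u)\<^sup>2"
      by simp
    finally show ?thesis .
  qed
  have "(\<lambda>k. complex_of_real ((l2norm (g k))\<^sup>2)) \<longlonglongrightarrow> complex_of_real (2 * pi * (l2norm u)\<^sup>2)"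
    unfolding gA by (rule Alim)
  then have "(\<lambda>k. (l2norm (g k))\<^sup>2) \<longlonglongrightarrow> 2 * pi * (l2norm u)\<^sup>2"
    unfolding tendsto_of_real_iff .
  then have "(\<lambda>k. sqrt ((l2norm (g k))\<^sup>2)) \<longlonglongrightarrow> sqrt (2 * pi * (l2norm u)\<^sup>2)"
    by (rule tendsto_real_sqrt)
  then have nlim: "(\<lambda>k. l2norm (g k)) \<longlonglongrightarrow> sqrt (2 * pi) * l2norm u"
    by (simp add: real_sqrt_mult)
  then have "Bseq (\<lambda>k. l2norm (g k))" by (intro convergent_imp_Bseq convergentI)
  then obtain C where C: "\<And>k. l2norm (g k) \<le> C" by (auto simp: Bseq_def)
  have glim: "(\<lambda>k. g k \<xi>) \<longlonglongrightarrow> ft u \<xi>" for \<xi>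
  proof -
    have "(\<lambda>k. complex_of_real (sqrt (exp (- (s k * \<xi>)\<^sup>2 / 2))) * ft u \<xi>) \<longlonglongrightarrow> complex_of_real (sqrt (exp (- (0 * \<xi>)\<^sup>2 / 2))) * ft u \<xi>"
      by (intro tendsto_intros s0) auto
    then show ?thesis by (simp add: g_def gauss_def)
  qed
  \<comment> \<open>The convergent norms of \<open>g k\<close> are bounded, so Fatou applies. Only
    after this can \<open>ft u\<close> itself serve as the dominating function that identifies its
    norm with the limit.\<close>
  show L: "ft u \<in> Lp 2"
    by (rule L2_Fatou[where g=g, OF gL C]) (use glim in auto)
  have "(\<lambda>k. l2norm (\<lambda>\<xi>. g k \<xi> - ft u \<xi>)) \<longlonglongrightarrow> 0"
  proof (rule l2norm_dominated[OF L])
    show "AE \<xi> in lborel. (\<lambda>k. g k \<xi> - ft u \<xi>) \<longlonglongrightarrow> 0" using glim by (simp add: LIM_zero)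
    show "AE \<xi> in lborel. cmod (g k \<xi> - ft u \<xi>) \<le> cmod (ft u \<xi>)" for k
    proof (rule AE_I2)
      fix \<xi>
      have "g k \<xi> - ft u \<xi> = complex_of_real (sqrt (gauss (s k) \<xi>) - 1) * ft u \<xi>" by (simp add: g_def algebra_simps)
      then have "cmod (g k \<xi> - ft u \<xi>) = \<bar>sqrt (gauss (s k) \<xi>) - 1\<bar> * cmod (ft u \<xi>)"
        by (simp only: norm_mult norm_of_real)
      also have "\<dots> \<le> 1 * cmod (ft u \<xi>)"
        using g_le1[of k \<xi>] by (intro mult_right_mono) (auto simp: gauss_def)
      finally show "cmod (g k \<xi> - ft u \<xi>) \<le> cmod (ft u \<xi>)" by simp
    qed
  qed measurable
  from l2norm_lim[OF gL L this] show "l2norm (ft u) = sqrt (2 * pi) * l2norm u"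
    using nlim by (rule LIMSEQ_unique)
qed

lemma ft_lin:
  assumes "integrable lborel u" "integrable lborel v"
  shows "ft (\<lambda>x. a * u x + b * v x) \<xi> = a * ft u \<xi> + b * ft v \<xi>"
proof -
  have "(\<lambda>x. exp (- \<i> * complex_of_real (x * \<xi>)) * (a * u x + b * v x)) =
     (\<lambda>x. a * (exp (- \<i> * complex_of_real (x * \<xi>)) * u x) + b * (exp (- \<i> * complex_of_real (x * \<xi>)) * v x))"
    by (simp add: algebra_simps)
  then show ?thesis unfolding ft_def
    using kernel_integrable[OF assms(1), of \<xi>] kernel_integrable[OF assms(2), of \<xi>] by simp
qed

lemma ft_diff:
  assumes "integrable lborel u" "integrable lborel v"
  shows "ft (\<lambda>x. u x - v x) \<xi> = ft u \<xi> - ft v \<xi>"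
  using ft_lin[OF assms, of 1 "-1" \<xi>] by simp

section \<open>Extension from truncations to all of L2\<close>

definition trunc :: "real \<Rightarrow> (real \<Rightarrow> complex) \<Rightarrow> real \<Rightarrow> complex" where
  "trunc R f x = indicator {-R..R} x * f x"

lemma trunc_L2: "f \<in> Lp 2 \<Longrightarrow> trunc R f \<in> Lp 2"
  unfolding trunc_def[abs_def] by (rule L2_indicator) auto

lemma trunc_integrable: assumes "f \<in> Lp 2" shows "integrable lborel (trunc R f)"
  using L2_mult_integrable[OF L2_const_indicator[of 1] assms] by (simp add: trunc_def[abs_def])

lemma trunc_lim: assumes f: "f \<in> Lp 2" shows "((\<lambda>R. l2norm (\<lambda>x. f x - trunc R f x)) \<longlongrightarrow> 0) at_top"
proof (rule tendsto_at_topI_sequentially)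
  fix X :: "nat \<Rightarrow> real" assume X: "filterlim X at_top sequentially"
  note L2_measurable[OF trunc_L2[OF f], measurable] L2_measurable[OF f, measurable]
  show "(\<lambda>n. l2norm (\<lambda>x. f x - trunc (X n) f x)) \<longlonglongrightarrow> 0"
  proof (rule l2norm_dominated[OF f])
    show "AE x in lborel. (\<lambda>n. f x - trunc (X n) f x) \<longlonglongrightarrow> 0"
    proof (rule AE_I2)
      fix x
      have "\<forall>\<^sub>F n in sequentially. X n \<ge> \<bar>x\<bar>" using X by (auto simp: filterlim_at_top)
      then have "\<forall>\<^sub>F n in sequentially. f x - trunc (X n) f x = 0"
        by eventually_elim (auto simp: trunc_def indicator_def)
      then show "(\<lambda>n. f x - trunc (X n) f x) \<longlonglongrightarrow> 0" by (rule tendsto_eventually)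
    qed
    show "AE x in lborel. cmod (f x - trunc (X n) f x) \<le> cmod (f x)" for n
      by (auto simp: trunc_def indicator_def)
  qed measurable
qed

lemma trunc_lim_seq: assumes f: "f \<in> Lp 2" shows "(\<lambda>n. l2norm (\<lambda>x. trunc (real n) f x - f x)) \<longlonglongrightarrow> 0"
  using filterlim_compose[OF trunc_lim[OF f] filterlim_real_sequentially]
  by (simp add: l2norm_commute[of f])

lemma ft_trunc: "(LINT x:{-R..R}|lborel. exp (- \<i> * complex_of_real (x * \<xi>)) * f x) = ft (trunc R f) \<xi>"
  unfolding set_lebesgue_integral_def ft_def trunc_def
  by (intro Bochner_Integration.integral_cong refl) (simp add: indicator_def)

lemma has_fourier_L2_iff:
  assumes f: "f \<in> Lp 2"
  shows "has_fourier_L2 f F \<longleftrightarrow> F \<in> Lp 2 \<and> ((\<lambda>R. l2norm (\<lambda>\<xi>. F \<xi> - ft (trunc R f) \<xi>)) \<longlongrightarrow> 0) at_top"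
proof (cases "F \<in> Lp 2")
  case True
  have L: "(\<lambda>\<xi>. F \<xi> - ft (trunc R f) \<xi>) \<in> Lp 2" for R
    by (intro L2_diff True Plancherel_L1_L2 trunc_L2 trunc_integrable f)
  have "((\<lambda>R. ennreal ((l2norm (\<lambda>\<xi>. F \<xi> - ft (trunc R f) \<xi>))\<^sup>2)) \<longlongrightarrow> 0) at_top \<longleftrightarrow>
     ((\<lambda>R. (l2norm (\<lambda>\<xi>. F \<xi> - ft (trunc R f) \<xi>))\<^sup>2) \<longlongrightarrow> 0) at_top"
    using tendsto_ennreal_iff[of "\<lambda>R. (l2norm (\<lambda>\<xi>. F \<xi> - ft (trunc R f) \<xi>))\<^sup>2" at_top 0] by simp
  moreover have "((\<lambda>R. (l2norm (\<lambda>\<xi>. F \<xi> - ft (trunc R f) \<xi>))\<^sup>2) \<longlongrightarrow> 0) at_top \<longleftrightarrow>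
     ((\<lambda>R. l2norm (\<lambda>\<xi>. F \<xi> - ft (trunc R f) \<xi>)) \<longlongrightarrow> 0) at_top" (is "?l \<longleftrightarrow> ?r")
  proof
    assume ?l then have "((\<lambda>R. sqrt ((l2norm (\<lambda>\<xi>. F \<xi> - ft (trunc R f) \<xi>))\<^sup>2)) \<longlongrightarrow> sqrt 0) at_top"
      by (rule tendsto_real_sqrt)
    then show ?r by simp
  next
    assume ?r then show ?l using tendsto_power[of _ 0 at_top 2] by fastforce
  qed
  ultimately show ?thesis
    unfolding has_fourier_L2_def ft_trunc l2norm_nn_integral[OF L] using True by simp
qed (simp add: has_fourier_L2_def)

lemma l2inner_lim:
  assumes f: "\<And>n. f n \<in> Lp 2" and F: "F \<in> Lp 2" and g: "\<And>n. g n \<in> Lp 2" and G: "G \<in> Lp 2"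
    and l: "((\<lambda>n. l2norm (\<lambda>x. f n x - F x)) \<longlongrightarrow> 0) A" and l': "((\<lambda>n. l2norm (\<lambda>x. g n x - G x)) \<longlongrightarrow> 0) A"
  shows "((\<lambda>n. l2inner (f n) (g n)) \<longlongrightarrow> l2inner F G) A"
proof -
  have "((\<lambda>n. l2norm (f n) * l2norm (\<lambda>x. g n x - G x)) \<longlongrightarrow> l2norm F * 0) A"
    by (intro tendsto_mult l' l2norm_lim[OF f F l])
  then have "((\<lambda>n. l2norm (f n) * l2norm (\<lambda>x. g n x - G x)) \<longlongrightarrow> 0) A" by simp
  then have "((\<lambda>n. l2inner (f n) (g n) - l2inner (f n) G) \<longlongrightarrow> 0) A"
    by (rule Lim_null_comparison[rotated])
       (intro always_eventually allI, simp add: l2inner_diff_right[symmetric] f g G l2inner_le L2_diff)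
  from tendsto_add[OF this l2inner_lim_left[OF f F G l]] show ?thesis by simp
qed

text \<open>Any approximation by integrable L2 functions may replace the truncations of the
  definition: Plancherel applied to \<open>u n - trunc R f\<close> compares the two transforms, and
  letting \<open>n\<close> tend to infinity bounds the error of the truncation at \<open>R\<close>
  by \<open>sqrt (2 * pi)\<close> times the L2 tail of \<open>f\<close>.\<close>

lemma has_fourier_limit:
  assumes f: "f \<in> Lp 2" and F: "F \<in> Lp 2"
    and u: "\<And>n. u n \<in> Lp 2" "\<And>n. integrable lborel (u n)"
    and uf: "(\<lambda>n::nat. l2norm (\<lambda>x. u n x - f x)) \<longlonglongrightarrow> 0"
    and uF: "(\<lambda>n. l2norm (\<lambda>\<xi>. ft (u n) \<xi> - F \<xi>)) \<longlonglongrightarrow> 0"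
  shows "has_fourier_L2 f F"
proof -
  have ftu: "ft (u n) \<in> Lp 2" for n using Plancherel_L1_L2 u by blast
  have ftt: "ft (trunc R f) \<in> Lp 2" for R using Plancherel_L1_L2 trunc_L2[OF f] trunc_integrable[OF f] by blast
  have "l2norm (\<lambda>\<xi>. F \<xi> - ft (trunc R f) \<xi>) \<le> sqrt (2 * pi) * l2norm (\<lambda>x. f x - trunc R f x)" for R
  proof (rule LIMSEQ_le_const)
    show "(\<lambda>n. l2norm (\<lambda>\<xi>. ft (u n) \<xi> - F \<xi>) + sqrt (2 * pi) * (l2norm (\<lambda>x. u n x - f x) + l2norm (\<lambda>x. f x - trunc R f x)))
       \<longlonglongrightarrow> sqrt (2 * pi) * l2norm (\<lambda>x. f x - trunc R f x)"
      using tendsto_add[OF uF tendsto_mult[OF tendsto_const[of "sqrt (2 * pi)"] tendsto_add[OF uf tendsto_const[of "l2norm (\<lambda>x. f x - trunc R f x)"]]]] by simp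
    have "l2norm (\<lambda>\<xi>. F \<xi> - ft (trunc R f) \<xi>) \<le> l2norm (\<lambda>\<xi>. ft (u n) \<xi> - F \<xi>) + sqrt (2 * pi) * (l2norm (\<lambda>x. u n x - f x) + l2norm (\<lambda>x. f x - trunc R f x))" for n
    proof -
      have "l2norm (\<lambda>\<xi>. F \<xi> - ft (trunc R f) \<xi>) \<le> l2norm (\<lambda>\<xi>. F \<xi> - ft (u n) \<xi>) + l2norm (\<lambda>\<xi>. ft (u n) \<xi> - ft (trunc R f) \<xi>)"
        by (rule l2norm_triangle_diff[OF F ftu ftt])
      also have "(\<lambda>\<xi>. ft (u n) \<xi> - ft (trunc R f) \<xi>) = ft (\<lambda>x. u n x - trunc R f x)"
        using ft_diff[OF u(2) trunc_integrable[OF f]] by auto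
      also have "l2norm \<dots> = sqrt (2 * pi) * l2norm (\<lambda>x. u n x - trunc R f x)"
        by (rule Plancherel_L1_L2) (use u trunc_L2[OF f] trunc_integrable[OF f] in auto)
      also have "l2norm (\<lambda>x. u n x - trunc R f x) \<le> l2norm (\<lambda>x. u n x - f x) + l2norm (\<lambda>x. f x - trunc R f x)"
        by (rule l2norm_triangle_diff[OF u(1) f trunc_L2[OF f]])
      finally show ?thesis by (simp add: l2norm_commute[of F])
    qed
    then show "\<exists>N. \<forall>n\<ge>N. l2norm (\<lambda>\<xi>. F \<xi> - ft (trunc R f) \<xi>) \<le> l2norm (\<lambda>\<xi>. ft (u n) \<xi> - F \<xi>) + sqrt (2 * pi) * (l2norm (\<lambda>x. u n x - f x) + l2norm (\<lambda>x. f x - trunc R f x))"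
      by blast
  qed
  then have "((\<lambda>R. l2norm (\<lambda>\<xi>. F \<xi> - ft (trunc R f) \<xi>)) \<longlongrightarrow> 0) at_top"
    by (intro Lim_null_comparison[OF _ tendsto_mult_right_zero[OF trunc_lim[OF f], of "sqrt (2 * pi)"]]) simp
  then show ?thesis using has_fourier_L2_iff[OF f] F by blast
qed

lemma has_fourier_L2_L2: "has_fourier_L2 f F \<Longrightarrow> F \<in> Lp 2"
  by (simp add: has_fourier_L2_def)

lemma has_fourier_approx:
  assumes f: "f \<in> Lp 2" and F: "has_fourier_L2 f F"
  shows "(\<lambda>n. l2norm (\<lambda>\<xi>. ft (trunc (real n) f) \<xi> - F \<xi>)) \<longlonglongrightarrow> 0"
proof -
  have "((\<lambda>R. l2norm (\<lambda>\<xi>. F \<xi> - ft (trunc R f) \<xi>)) \<longlongrightarrow> 0) at_top"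
    using has_fourier_L2_iff[OF f] F by blast
  from filterlim_compose[OF this filterlim_real_sequentially] show ?thesis
    by (simp add: l2norm_commute[of F])
qed

text \<open>By Plancherel the transforms of the truncations are as Cauchy as the truncations
  themselves, up to the factor \<open>sqrt (2 * pi)\<close>.\<close>

lemma has_fourier_exists:
  assumes f: "f \<in> Lp 2" shows "\<exists>F. has_fourier_L2 f F"
proof -
  have L: "ft (trunc (real n) f) \<in> Lp 2" for n
    using Plancherel_L1_L2 trunc_L2[OF f] trunc_integrable[OF f] by blast
  have d: "l2norm (\<lambda>\<xi>. ft (trunc (real m) f) \<xi> - ft (trunc (real n) f) \<xi>) =
      sqrt (2 * pi) * l2norm (\<lambda>x. trunc (real m) f x - trunc (real n) f x)" for m n
    using Plancherel_L1_L2(2)[OF Bochner_Integration.integrable_diff[OF trunc_integrable[OF f, of m] trunc_integrable[OF f, of n]]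
        L2_diff[OF trunc_L2[OF f] trunc_L2[OF f]]]
    by (simp add: ft_diff[OF trunc_integrable[OF f] trunc_integrable[OF f], symmetric])
  have "\<exists>N. \<forall>m\<ge>N. \<forall>n\<ge>N. l2norm (\<lambda>\<xi>. ft (trunc (real m) f) \<xi> - ft (trunc (real n) f) \<xi>) < e" if e: "e > 0" for e
  proof -
    define c where "c = sqrt (2 * pi)"
    have c: "c > 0" by (simp add: c_def)
    have "e / (2 * c) > 0" using e c by simp
    from LIMSEQ_D[OF trunc_lim_seq[OF f] this]
    obtain N where N: "\<And>n. n \<ge> N \<Longrightarrow> l2norm (\<lambda>x. trunc (real n) f x - f x) < e / (2 * c)"
      by auto
    have "l2norm (\<lambda>\<xi>. ft (trunc (real m) f) \<xi> - ft (trunc (real n) f) \<xi>) < e" if "m \<ge> N" "n \<ge> N" for m n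
    proof -
      have "l2norm (\<lambda>x. trunc (real m) f x - trunc (real n) f x) < e / (2 * c) + e / (2 * c)"
        using l2norm_triangle_diff[OF trunc_L2[OF f, of m] f trunc_L2[OF f, of n]] N[OF that(1)] N[OF that(2)]
          l2norm_commute[of f "trunc (real n) f"] by linarith
      then have "c * l2norm (\<lambda>x. trunc (real m) f x - trunc (real n) f x) < c * (e / (2 * c) + e / (2 * c))"
        using c by (rule mult_strict_left_mono)
      then show ?thesis unfolding d c_def[symmetric] using c by simp
    qed
    then show ?thesis by blast
  qed
  from L2_complete[of "\<lambda>n. ft (trunc (real n) f)", OF L this] obtain F where "F \<in> Lp 2"
    "(\<lambda>n. l2norm (\<lambda>x. ft (trunc (real n) f) x - F x)) \<longlonglongrightarrow> 0" by blast
  then have "has_fourier_L2 f F"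
    by (intro has_fourier_limit[OF f, of F "\<lambda>n. trunc (real n) f"] trunc_L2 trunc_integrable f trunc_lim_seq)
  then show ?thesis by blast
qed

lemma has_fourier_norm:
  assumes f: "f \<in> Lp 2" and F: "has_fourier_L2 f F"
  shows "l2norm F = sqrt (2 * pi) * l2norm f"
proof -
  have L: "ft (trunc (real n) f) \<in> Lp 2" for n
    using Plancherel_L1_L2 trunc_L2[OF f] trunc_integrable[OF f] by blast
  have "(\<lambda>n. l2norm (ft (trunc (real n) f))) \<longlonglongrightarrow> l2norm F"
    by (rule l2norm_lim[OF L has_fourier_L2_L2[OF F] has_fourier_approx[OF f F]])
  moreover have "(\<lambda>n. sqrt (2 * pi) * l2norm (trunc (real n) f)) \<longlonglongrightarrow> sqrt (2 * pi) * l2norm f"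
    by (intro tendsto_mult tendsto_const l2norm_lim[OF trunc_L2[OF f] f trunc_lim_seq[OF f]])
  ultimately show ?thesis
    unfolding Plancherel_L1_L2(2)[OF trunc_integrable[OF f] trunc_L2[OF f]] by (rule LIMSEQ_unique)
qed

section \<open>The Fourier transform on square integrable functions\<close>

lemma has_fourier_L1:
  assumes "integrable lborel u" "u \<in> Lp 2" shows "has_fourier_L2 u (ft u)"
  by (rule has_fourier_limit[where u="\<lambda>_. u"]) (use assms Plancherel_L1_L2 in auto)

lemma has_fourier_cong:
  assumes f: "f \<in> Lp 2" and F: "has_fourier_L2 f F"
    and f': "f' \<in> borel_measurable lborel" "AE x in lborel. f' x = f x"
    and F': "F' \<in> borel_measurable lborel" "AE x in lborel. F' x = F x"
  shows "has_fourier_L2 f' F'"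
proof (rule has_fourier_limit[where u="\<lambda>n. trunc (real n) f"])
  have fL: "f' \<in> Lp 2" by (rule L2_bound[OF f f'(1)]) (use f'(2) in eventually_elim, simp)
  have FL: "F' \<in> Lp 2" by (rule L2_bound[OF has_fourier_L2_L2[OF F] F'(1)]) (use F'(2) in eventually_elim, simp)
  note L2_measurable[OF f, measurable] f'(1)[measurable] F'(1)[measurable] L2_measurable[OF has_fourier_L2_L2[OF F], measurable]
  show "f' \<in> Lp 2" "F' \<in> Lp 2" by fact+
  show "trunc (real n) f \<in> Lp 2" "integrable lborel (trunc (real n) f)" for n
    by (intro trunc_L2 trunc_integrable f)+
  have [measurable]: "trunc (real n) f \<in> borel_measurable lborel" for n by (intro L2_measurable trunc_L2 f)
  have "l2norm (\<lambda>x. trunc (real n) f x - f' x) = l2norm (\<lambda>x. trunc (real n) f x - f x)" for n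
    by (rule l2norm_cong_AE) (measurable, use f'(2) in eventually_elim, simp)
  then show "(\<lambda>n. l2norm (\<lambda>x. trunc (real n) f x - f' x)) \<longlonglongrightarrow> 0" using trunc_lim_seq[OF f] by simp
  have "l2norm (\<lambda>x. ft (trunc (real n) f) x - F' x) = l2norm (\<lambda>x. ft (trunc (real n) f) x - F x)" for n
    by (rule l2norm_cong_AE) (measurable, use F'(2) in eventually_elim, simp)
  then show "(\<lambda>n. l2norm (\<lambda>x. ft (trunc (real n) f) x - F' x)) \<longlonglongrightarrow> 0" using has_fourier_approx[OF f F] by simp
qed

lemma L2_lin_lim:
  assumes f: "f \<in> Lp 2" "\<And>n. u n \<in> Lp 2" "(\<lambda>n. l2norm (\<lambda>x. u n x - f x)) \<longlonglongrightarrow> 0"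
    and g: "g \<in> Lp 2" "\<And>n. v n \<in> Lp 2" "(\<lambda>n. l2norm (\<lambda>x. v n x - g x)) \<longlonglongrightarrow> 0"
  shows "(\<lambda>n. l2norm (\<lambda>x. (a * u n x + b * v n x) - (a * f x + b * g x))) \<longlonglongrightarrow> 0"
proof (rule Lim_null_comparison)
  have "l2norm (\<lambda>x. (a * u n x + b * v n x) - (a * f x + b * g x)) \<le> cmod a * l2norm (\<lambda>x. u n x - f x) + cmod b * l2norm (\<lambda>x. v n x - g x)" for n
  proof -
    have "(\<lambda>x. (a * u n x + b * v n x) - (a * f x + b * g x)) = (\<lambda>x. a * (u n x - f x) + b * (v n x - g x))"
      by (simp add: algebra_simps)
    then show ?thesis
      using l2norm_triangle[of "\<lambda>x. a * (u n x - f x)" "\<lambda>x. b * (v n x - g x)"] f g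
      by (simp add: l2norm_scale L2_cmult L2_diff)
  qed
  then show "\<forall>\<^sub>F n in sequentially. norm (l2norm (\<lambda>x. (a * u n x + b * v n x) - (a * f x + b * g x))) \<le> cmod a * l2norm (\<lambda>x. u n x - f x) + cmod b * l2norm (\<lambda>x. v n x - g x)"
    by simp
  show "(\<lambda>n. cmod a * l2norm (\<lambda>x. u n x - f x) + cmod b * l2norm (\<lambda>x. v n x - g x)) \<longlonglongrightarrow> 0"
    using tendsto_add[OF tendsto_mult_right_zero[OF f(3), of "cmod a"] tendsto_mult_right_zero[OF g(3), of "cmod b"]] by simp
qed

lemma has_fourier_lin:
  assumes f: "f \<in> Lp 2" and g: "g \<in> Lp 2" and F: "has_fourier_L2 f F" and G: "has_fourier_L2 g G"
  shows "has_fourier_L2 (\<lambda>x. a * f x + b * g x) (\<lambda>\<xi>. a * F \<xi> + b * G \<xi>)"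
proof (rule has_fourier_limit[where u="\<lambda>n x. a * trunc (real n) f x + b * trunc (real n) g x"])
  note FL = has_fourier_L2_L2[OF F] and GL = has_fourier_L2_L2[OF G]
  have ftL: "ft (trunc (real n) h) \<in> Lp 2" if "h \<in> Lp 2" for n h
    using Plancherel_L1_L2 trunc_L2[OF that] trunc_integrable[OF that] by blast
  show "(\<lambda>x. a * f x + b * g x) \<in> Lp 2" "(\<lambda>\<xi>. a * F \<xi> + b * G \<xi>) \<in> Lp 2"
    using f g FL GL by auto
  show "(\<lambda>x. a * trunc (real n) f x + b * trunc (real n) g x) \<in> Lp 2" for n
    by (intro L2_add L2_cmult trunc_L2 f g)
  show "integrable lborel (\<lambda>x. a * trunc (real n) f x + b * trunc (real n) g x)" for n
    using trunc_integrable f g by auto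
  show "(\<lambda>n. l2norm (\<lambda>x. (a * trunc (real n) f x + b * trunc (real n) g x) - (a * f x + b * g x))) \<longlonglongrightarrow> 0"
    by (intro L2_lin_lim f g trunc_L2 trunc_lim_seq)
  show "(\<lambda>n. l2norm (\<lambda>\<xi>. ft (\<lambda>x. a * trunc (real n) f x + b * trunc (real n) g x) \<xi> - (a * F \<xi> + b * G \<xi>))) \<longlonglongrightarrow> 0"
    unfolding ft_lin[OF trunc_integrable[OF f] trunc_integrable[OF g]]
    by (intro L2_lin_lim FL GL ftL f g has_fourier_approx F G)
qed

lemma has_fourier_cmult:
  assumes "f \<in> Lp 2" "has_fourier_L2 f F"
  shows "has_fourier_L2 (\<lambda>x. a * f x) (\<lambda>\<xi>. a * F \<xi>)"
  using has_fourier_lin[OF assms(1) assms(1) assms(2) assms(2), of a 0] by simp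

lemma has_fourier_add:
  assumes "f \<in> Lp 2" "g \<in> Lp 2" "has_fourier_L2 f F" "has_fourier_L2 g G"
  shows "has_fourier_L2 (\<lambda>x. f x + g x) (\<lambda>\<xi>. F \<xi> + G \<xi>)"
  using has_fourier_lin[OF assms, of 1 1] by simp

lemma has_fourier_diff:
  assumes "f \<in> Lp 2" "g \<in> Lp 2" "has_fourier_L2 f F" "has_fourier_L2 g G"
  shows "has_fourier_L2 (\<lambda>x. f x - g x) (\<lambda>\<xi>. F \<xi> - G \<xi>)"
  using has_fourier_lin[OF assms, of 1 "-1"] by simp

lemma has_fourier_unique:
  assumes f: "f \<in> Lp 2" and F: "has_fourier_L2 f F" and G: "has_fourier_L2 f G"
  shows "AE \<xi> in lborel. F \<xi> = G \<xi>"
proof -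
  have h: "has_fourier_L2 (\<lambda>x. f x - f x) (\<lambda>\<xi>. F \<xi> - G \<xi>)" by (rule has_fourier_diff[OF f f F G])
  have "l2norm (\<lambda>\<xi>. F \<xi> - G \<xi>) = 0" using has_fourier_norm[OF _ h] by simp
  then show ?thesis
    using l2norm_eq_0[OF L2_diff[OF has_fourier_L2_L2[OF F] has_fourier_L2_L2[OF G]]] by simp
qed

lemma fourier_L2_has: "f \<in> Lp 2 \<Longrightarrow> has_fourier_L2 f (fourier_L2 f)"
  unfolding fourier_L2_def by (rule someI_ex[OF has_fourier_exists])

lemma fourier_L2_eq: "f \<in> Lp 2 \<Longrightarrow> has_fourier_L2 f F \<Longrightarrow> AE \<xi> in lborel. fourier_L2 f \<xi> = F \<xi>"
  using fourier_L2_has has_fourier_unique by blast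

text \<open>Polarization: the norm of a sum determines the real part of the inner product, and
  replacing \<open>f\<close> by \<open>\<i> * f\<close> turns the imaginary part into a real
  one.\<close>

lemma has_fourier_inner:
  assumes f: "f \<in> Lp 2" and g: "g \<in> Lp 2" and F: "has_fourier_L2 f F" and G: "has_fourier_L2 g G"
  shows "l2inner F G = 2 * pi * l2inner f g"
proof -
  have sq: "(sqrt (2 * pi))\<^sup>2 = 2 * pi" by simp
  have re: "Re (l2inner H G) = 2 * pi * Re (l2inner h g)" if h: "h \<in> Lp 2" and H: "has_fourier_L2 h H" for h H
  proof -
    have "(l2norm (\<lambda>\<xi>. H \<xi> + G \<xi>))\<^sup>2 = 2 * pi * (l2norm (\<lambda>x. h x + g x))\<^sup>2"
      unfolding has_fourier_norm[OF L2_add[OF h g] has_fourier_add[OF h g H G]] power_mult_distrib sq ..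
    then show ?thesis
      unfolding l2norm_add_sq[OF h g] l2norm_add_sq[OF has_fourier_L2_L2[OF H] has_fourier_L2_L2[OF G]]
        has_fourier_norm[OF h H] has_fourier_norm[OF g G] power_mult_distrib sq
      by (simp add: algebra_simps)
  qed
  have "Re (l2inner (\<lambda>\<xi>. \<i> * F \<xi>) G) = 2 * pi * Re (l2inner (\<lambda>x. \<i> * f x) g)"
    by (rule re[OF L2_cmult[OF f] has_fourier_cmult[OF f F]])
  then have "Im (l2inner F G) = 2 * pi * Im (l2inner f g)"
    unfolding l2inner_scale_left by simp
  with re[OF f F] show ?thesis by (simp add: complex_eq_iff)
qed

lemma l2inner_cnj_right: "l2inner f (\<lambda>x. cnj (g x)) = (LINT x|lborel. f x * g x)"
  by (simp add: l2inner_def)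

text \<open>Both sides are limits of the formula for truncations. The bilinear pairing is written as
  \<open>l2inner\<close> with a conjugated second factor, so that the continuity of the inner
  product covers it.\<close>

lemma has_fourier_mult_formula:
  assumes u: "u \<in> Lp 2" and v: "v \<in> Lp 2" and U: "has_fourier_L2 u U" and V: "has_fourier_L2 v V"
  shows "(LINT \<xi>|lborel. U \<xi> * v \<xi>) = (LINT x|lborel. u x * V x)"
proof (rule LIMSEQ_unique)
  note UL = has_fourier_L2_L2[OF U] and VL = has_fourier_L2_L2[OF V]
  have ftL: "ft (trunc (real n) h) \<in> Lp 2" if "h \<in> Lp 2" for n h
    using Plancherel_L1_L2 trunc_L2[OF that] trunc_integrable[OF that] by blast
  have cl: "(\<lambda>n. l2norm (\<lambda>x. cnj (p n x) - cnj (q x))) \<longlonglongrightarrow> 0" if "(\<lambda>n. l2norm (\<lambda>x. p n x - q x)) \<longlonglongrightarrow> 0" for p :: "nat \<Rightarrow> real \<Rightarrow> complex" and q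
    using that unfolding complex_cnj_diff[symmetric] l2norm_cnj .
  show "(\<lambda>n. l2inner (ft (trunc (real n) u)) (\<lambda>x. cnj (trunc (real n) v x))) \<longlonglongrightarrow> (LINT \<xi>|lborel. U \<xi> * v \<xi>)"
    unfolding l2inner_cnj_right[symmetric, of U]
    by (intro l2inner_lim ftL UL VL u v L2_cnj trunc_L2 cl has_fourier_approx U V trunc_lim_seq)
  have "(\<lambda>n. l2inner (trunc (real n) u) (\<lambda>x. cnj (ft (trunc (real n) v) x))) \<longlonglongrightarrow> (LINT x|lborel. u x * V x)"
    unfolding l2inner_cnj_right[symmetric, of u]
    by (intro l2inner_lim ftL UL VL u v L2_cnj trunc_L2 cl has_fourier_approx U V trunc_lim_seq)
  then show "(\<lambda>n. l2inner (ft (trunc (real n) u)) (\<lambda>x. cnj (trunc (real n) v x))) \<longlonglongrightarrow> (LINT x|lborel. u x * V x)"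
    unfolding l2inner_cnj_right ft_mult_formula[OF trunc_integrable[OF u] trunc_integrable[OF v]] .
qed

text \<open>
  Let \<open>T\<close> be the transform and \<open>S F = cnj (T (cnj F))\<close>. The multiplication formula makes \<open>S\<close> the adjoint of
  \<open>T\<close>, and \<open>\<parallel>S F\<parallel>\<^sup>2 = 2 \<pi> \<parallel>F\<parallel>\<^sup>2\<close> as for \<open>T\<close>. Expanding \<open>\<parallel>T (S F) - 2 \<pi> F\<parallel>\<^sup>2\<close> then gives 0, so \<open>T\<close> is
  onto; no density argument is needed.
\<close>

lemma has_fourier_inverse:
  assumes F: "F \<in> Lp 2" and W: "has_fourier_L2 (\<lambda>\<xi>. cnj (F \<xi>)) W"
  shows "has_fourier_L2 (\<lambda>x. complex_of_real (1 / (2 * pi)) * cnj (W x)) F"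
proof -
  note WL = has_fourier_L2_L2[OF W]
  define f where "f x = complex_of_real (1 / (2 * pi)) * cnj (W x)" for x
  have f_eq: "f = (\<lambda>x. complex_of_real (1 / (2 * pi)) * cnj (W x))" by (rule ext) (rule f_def)
  have fL: "f \<in> Lp 2" unfolding f_eq using WL by (intro L2_cmult L2_cnj)
  obtain T where T: "has_fourier_L2 f T" using has_fourier_exists[OF fL] by blast
  note TL = has_fourier_L2_L2[OF T]
  have nW: "(l2norm W)\<^sup>2 = 2 * pi * (l2norm F)\<^sup>2"
    using has_fourier_norm[OF L2_cnj[OF F] W] by (simp add: power_mult_distrib)
  have nf: "(l2norm f)\<^sup>2 = (l2norm W)\<^sup>2 / (2 * pi)\<^sup>2"
    unfolding f_eq l2norm_scale l2norm_cnj by (simp add: power_mult_distrib power_divide norm_divide)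
  have nT: "(l2norm T)\<^sup>2 = (l2norm F)\<^sup>2"
  proof -
    have "(l2norm T)\<^sup>2 = 2 * pi * (l2norm f)\<^sup>2"
      unfolding has_fourier_norm[OF fL T] by (simp add: power_mult_distrib)
    also have "\<dots> = (2 * pi) * ((2 * pi) * (l2norm F)\<^sup>2) / (2 * pi)\<^sup>2" unfolding nf nW by simp
    also have "\<dots> = (l2norm F)\<^sup>2" by (simp add: power2_eq_square)
    finally show ?thesis .
  qed
  have "l2inner T F = (LINT x|lborel. f x * W x)"
    unfolding l2inner_def by (rule has_fourier_mult_formula[OF fL L2_cnj[OF F] T W])
  also have "\<dots> = complex_of_real (1 / (2 * pi)) * l2inner W W"
    unfolding f_eq l2inner_def by (simp add: mult_ac)
  also have "\<dots> = complex_of_real ((l2norm F)\<^sup>2)"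
    unfolding l2inner_self nW by simp
  finally have "(l2norm (\<lambda>\<xi>. T \<xi> - F \<xi>))\<^sup>2 = 0"
    using l2norm_diff_sq[OF TL F] nT by simp
  then have "AE \<xi> in lborel. T \<xi> - F \<xi> = 0"
    using l2norm_eq_0[OF L2_diff[OF TL F]] by simp
  then have "AE \<xi> in lborel. F \<xi> = T \<xi>" by eventually_elim simp
  then have "has_fourier_L2 f F"
    by (intro has_fourier_cong[OF fL T L2_measurable[OF fL] _ L2_measurable[OF F]]) auto
  then show ?thesis unfolding f_def .
qed

lemma has_fourier_surj:
  assumes F: "F \<in> Lp 2" obtains f where "f \<in> Lp 2" "has_fourier_L2 f F"
proof -
  obtain W where W: "has_fourier_L2 (\<lambda>\<xi>. cnj (F \<xi>)) W" using has_fourier_exists[OF L2_cnj[OF F]] by blast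
  have "(\<lambda>x. complex_of_real (1 / (2 * pi)) * cnj (W x)) \<in> Lp 2"
    using has_fourier_L2_L2[OF W] by (intro L2_cmult L2_cnj)
  then show ?thesis using has_fourier_inverse[OF F W] that by blast
qed

lemma has_fourier_inj:
  assumes f: "f \<in> Lp 2" and g: "g \<in> Lp 2" and F: "has_fourier_L2 f F" and G: "has_fourier_L2 g F"
  shows "AE x in lborel. f x = g x"
proof -
  have "sqrt (2 * pi) * l2norm (\<lambda>x. f x - g x) = 0"
    using has_fourier_norm[OF L2_diff[OF f g] has_fourier_diff[OF f g F G]] by simp
  then show ?thesis using l2norm_eq_0[OF L2_diff[OF f g]] by simp
qed

lemma ft_shift: "ft (\<lambda>x. u (x + h)) \<xi> = iexp (h * \<xi>) * ft u \<xi>"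
proof -
  have "ft u \<xi> = (LINT x|lborel. exp (- \<i> * complex_of_real ((h + 1 * x) * \<xi>)) * u (h + 1 * x))"
    unfolding ft_def by (subst lborel_integral_real_affine[of 1 _ h]) auto
  also have "\<dots> = (LINT x|lborel. exp (- \<i> * complex_of_real (h * \<xi>)) * (exp (- \<i> * complex_of_real (x * \<xi>)) * u (x + h)))"
    unfolding mult.assoc[symmetric] exp_add[symmetric] by (simp add: algebra_simps)
  also have "\<dots> = exp (- \<i> * complex_of_real (h * \<xi>)) * ft (\<lambda>x. u (x + h)) \<xi>"
    unfolding ft_def by simp
  finally have "iexp (h * \<xi>) * ft u \<xi> = iexp (h * \<xi>) * exp (- \<i> * complex_of_real (h * \<xi>)) * ft (\<lambda>x. u (x + h)) \<xi>"
    by simp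
  also have "iexp (h * \<xi>) * exp (- \<i> * complex_of_real (h * \<xi>)) = 1"
    unfolding exp_add[symmetric] by simp
  finally show ?thesis by simp
qed

lemma has_fourier_shift:
  assumes f: "f \<in> Lp 2" and F: "has_fourier_L2 f F"
  shows "has_fourier_L2 (\<lambda>x. f (x + h)) (\<lambda>\<xi>. iexp (h * \<xi>) * F \<xi>)"
proof (rule has_fourier_limit[where u="\<lambda>n x. trunc (real n) f (x + h)"])
  note FL = has_fourier_L2_L2[OF F]
  note FL[THEN L2_measurable, measurable]
  show "(\<lambda>x. f (x + h)) \<in> Lp 2" by (rule L2_shift[OF f])
  show "(\<lambda>\<xi>. iexp (h * \<xi>) * F \<xi>) \<in> Lp 2"
    by (rule L2_bounded_mult[OF FL, where B=1]) auto
  show "(\<lambda>x. trunc (real n) f (x + h)) \<in> Lp 2" for n by (intro L2_shift trunc_L2 f)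
  show "integrable lborel (\<lambda>x. trunc (real n) f (x + h))" for n
    using lborel_integrable_real_affine[OF trunc_integrable[OF f], of 1 "real n" h] by (simp add: add.commute)
  show "(\<lambda>n. l2norm (\<lambda>x. trunc (real n) f (x + h) - f (x + h))) \<longlonglongrightarrow> 0"
    using trunc_lim_seq[OF f] l2norm_shift[of "\<lambda>x. trunc (real _) f x - f x" h] by simp
  have "l2norm (\<lambda>\<xi>. ft (\<lambda>x. trunc (real n) f (x + h)) \<xi> - iexp (h * \<xi>) * F \<xi>) = l2norm (\<lambda>\<xi>. ft (trunc (real n) f) \<xi> - F \<xi>)" for n
    unfolding ft_shift right_diff_distrib[symmetric] l2norm_def norm_mult norm_kernel by simp
  then show "(\<lambda>n. l2norm (\<lambda>\<xi>. ft (\<lambda>x. trunc (real n) f (x + h)) \<xi> - iexp (h * \<xi>) * F \<xi>)) \<longlonglongrightarrow> 0"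
    using has_fourier_approx[OF f F] by simp
qed

section \<open>Test functions\<close>

text \<open>A set of functions in which every member has a derivative that is again a member
  consists of smooth functions; no formula for the higher derivatives is needed.\<close>

lemma smooth_coinduct:
  fixes \<phi> :: "real \<Rightarrow> real"
  assumes \<phi>: "\<phi> \<in> S" and S: "\<And>f. f \<in> S \<Longrightarrow> \<exists>f'\<in>S. \<forall>x. (f has_field_derivative f' x) (at x)"
  shows "((deriv ^^ k) \<phi>) field_differentiable at x"
proof -
  have d: "deriv f \<in> S" "f field_differentiable at x" if "f \<in> S" for f x
  proof -
    from S[OF \<open>f \<in> S\<close>] obtain f' where f': "f' \<in> S" "\<And>x. (f has_field_derivative f' x) (at x)" by blast
    have "deriv f = f'" by (intro ext DERIV_imp_deriv f')
    then show "deriv f \<in> S" using f'(1) by simp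
    show "f field_differentiable at x" using f'(2) field_differentiable_def by blast
  qed
  have "(deriv ^^ k) \<phi> \<in> S" by (induction k) (use \<phi> d in auto)
  then show ?thesis by (rule d(2))
qed

text \<open>
  The functions \<open>p (1/t) exp (-1/t)\<close> for \<open>t > 0\<close>, extended by 0, are closed under differentiation.
\<close>

definition bump_poly :: "real poly \<Rightarrow> real \<Rightarrow> real \<Rightarrow> real \<Rightarrow> real" where
  "bump_poly p c d x = (if c * x + d > 0 then poly p (1 / (c * x + d)) * exp (- (1 / (c * x + d))) else 0)"

text \<open>A single term of the exponential series gives
  \<open>y ^ n * exp (- y) \<le> fact n\<close>, and the bound \<open>K\<close> collects these with
  the coefficients of \<open>p\<close>.\<close>

lemma poly_times_exp_bounded:
  fixes p :: "real poly"
  shows "\<exists>K. \<forall>y\<ge>0. \<bar>poly p y\<bar> * exp (- y) \<le> K"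
proof (intro exI allI impI)
  fix y :: real assume y: "y \<ge> 0"
  have t: "y ^ n * exp (- y) \<le> fact n" for n
  proof -
    have "y ^ n / fact n \<le> exp y"
    proof -
      have s: "summable (\<lambda>n. y ^ n /\<^sub>R fact n)" by (rule summable_exp_generic)
      have "sum (\<lambda>n. y ^ n /\<^sub>R fact n) {n} \<le> (\<Sum>n. y ^ n /\<^sub>R fact n)"
        by (rule sum_le_suminf[OF s]) (use y in auto)
      then show ?thesis by (simp add: exp_def divide_inverse mult.commute)
    qed
    then have "y ^ n \<le> exp y * fact n" by (simp add: divide_le_eq)
    then have "y ^ n * exp (- y) \<le> exp y * fact n * exp (- y)" by (intro mult_right_mono) auto
    also have "\<dots> = fact n" by (simp add: exp_minus)
    finally show ?thesis .
  qed
  have "\<bar>poly p y\<bar> * exp (- y) \<le> (\<Sum>i\<le>degree p. \<bar>coeff p i\<bar> * y ^ i) * exp (- y)"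
    unfolding poly_altdef using y
    by (intro mult_right_mono order_trans[OF sum_abs] sum_mono) (auto simp: abs_mult)
  also have "\<dots> = (\<Sum>i\<le>degree p. \<bar>coeff p i\<bar> * (y ^ i * exp (- y)))" by (simp add: sum_distrib_right mult.assoc)
  also have "\<dots> \<le> (\<Sum>i\<le>degree p. \<bar>coeff p i\<bar> * fact i)" by (intro sum_mono mult_left_mono t) auto
  finally show "\<bar>poly p y\<bar> * exp (- y) \<le> (\<Sum>i\<le>degree p. \<bar>coeff p i\<bar> * fact i)" .
qed

text \<open>With \<open>Y = 1 / (c * x + d)\<close> one has \<open>Y' = - c * Y\<^sup>2\<close>, so
  the product rule replaces \<open>p\<close> by \<open>c * Y\<^sup>2 * (p - p')\<close>. Only the
  point where \<open>c * x + d = 0\<close> needs an argument: there the function is bounded by a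
  multiple of the squared distance, hence has derivative 0.\<close>

lemma bump_poly_deriv:
  assumes c: "c \<noteq> 0"
  shows "(bump_poly p c d has_field_derivative bump_poly (smult c ([:0, 0, 1:] * (p - pderiv p))) c d x) (at x)"
proof -
  have cont: "open {x. c * x + d > 0}" "open {x. c * x + d < 0}"
    by (intro open_Collect_less continuous_intros)+
  consider "c * x + d > 0" | "c * x + d < 0" | "c * x + d = 0" by linarith
  then show ?thesis
  proof cases
    case 1
    have "((\<lambda>x. poly p (1 / (c * x + d)) * exp (- (1 / (c * x + d)))) has_field_derivative
        bump_poly (smult c ([:0, 0, 1:] * (p - pderiv p))) c d x) (at x)"
    proof -
      have Y: "((\<lambda>x. 1 / (c * x + d)) has_field_derivative - c * (1 / (c * x + d))\<^sup>2) (at x)"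
        using 1 by (auto intro!: derivative_eq_intros simp: power2_eq_square)
      have "((\<lambda>x. poly p (1 / (c * x + d))) has_field_derivative poly (pderiv p) (1 / (c * x + d)) * (- c * (1 / (c * x + d))\<^sup>2)) (at x)"
        by (rule DERIV_chain2[OF poly_DERIV Y])
      moreover have "((\<lambda>x. exp (- (1 / (c * x + d)))) has_field_derivative exp (- (1 / (c * x + d))) * - (- c * (1 / (c * x + d))\<^sup>2)) (at x)"
        by (rule DERIV_chain2[OF DERIV_exp DERIV_minus[OF Y]])
      ultimately have "((\<lambda>x. poly p (1 / (c * x + d)) * exp (- (1 / (c * x + d)))) has_field_derivative
        poly (pderiv p) (1 / (c * x + d)) * (- c * (1 / (c * x + d))\<^sup>2) * exp (- (1 / (c * x + d)))
        + exp (- (1 / (c * x + d))) * - (- c * (1 / (c * x + d))\<^sup>2) * poly p (1 / (c * x + d))) (at x)"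
        by (rule DERIV_mult)
      moreover have "bump_poly (smult c ([:0, 0, 1:] * (p - pderiv p))) c d x =
        poly (pderiv p) (1 / (c * x + d)) * (- c * (1 / (c * x + d))\<^sup>2) * exp (- (1 / (c * x + d)))
        + exp (- (1 / (c * x + d))) * - (- c * (1 / (c * x + d))\<^sup>2) * poly p (1 / (c * x + d))"
        using 1 by (simp add: bump_poly_def power2_eq_square right_diff_distrib left_diff_distrib mult_ac)
      ultimately show ?thesis by simp
    qed
    then show ?thesis
    proof (rule DERIV_cong_ev[OF refl _ refl, THEN iffD1, rotated])
      show "\<forall>\<^sub>F y in nhds x. (poly p (1 / (c * y + d)) * exp (- (1 / (c * y + d)))) = bump_poly p c d y"
      by (rule eventually_mono[OF eventually_nhds_in_open[OF cont(1), of x]]) (use 1 in \<open>simp_all add: bump_poly_def\<close>)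
    qed
  next
    case 2
    have "((\<lambda>x. 0) has_field_derivative bump_poly (smult c ([:0, 0, 1:] * (p - pderiv p))) c d x) (at x)"
      using 2 by (simp add: bump_poly_def)
    then show ?thesis
    proof (rule DERIV_cong_ev[OF refl _ refl, THEN iffD1, rotated])
      show "\<forall>\<^sub>F y in nhds x. 0 = bump_poly p c d y"
      by (rule eventually_mono[OF eventually_nhds_in_open[OF cont(2), of x]]) (use 2 in \<open>simp_all add: bump_poly_def\<close>)
    qed
  next
    case 3
    then have d: "d = - c * x" by simp
    \<comment> \<open>Bounding \<open>y\<^sup>2 * p y * exp (- y)\<close> instead of
      \<open>p y * exp (- y)\<close> buys the factor \<open>t\<^sup>2\<close> at
      \<open>y = 1 / t\<close>, which makes the difference quotient vanish in the limit.\<close>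
    obtain K where K: "\<And>y. y \<ge> 0 \<Longrightarrow> \<bar>poly ([:0, 0, 1:] * p) y\<bar> * exp (- y) \<le> K"
      using poly_times_exp_bounded by blast
    have K0: "K \<ge> 0" using K[of 0] by simp
    have le: "\<bar>bump_poly p c d y\<bar> \<le> K * (c * (y - x))\<^sup>2" for y
    proof (cases "c * y + d > 0")
      case True
      define t where "t = c * y + d"
      have t: "t > 0" "t = c * (y - x)" using True d by (auto simp: t_def algebra_simps)
      have "\<bar>poly p (1 / t)\<bar> * (1 / t)\<^sup>2 * exp (- (1 / t)) \<le> K"
        using K[of "1 / t"] t(1) by (simp add: abs_mult power2_eq_square mult_ac)
      then have "\<bar>poly p (1 / t)\<bar> * (1 / t)\<^sup>2 * exp (- (1 / t)) * t\<^sup>2 \<le> K * t\<^sup>2" by (intro mult_right_mono) auto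
      also have "\<bar>poly p (1 / t)\<bar> * (1 / t)\<^sup>2 * exp (- (1 / t)) * t\<^sup>2 = \<bar>poly p (1 / t)\<bar> * exp (- (1 / t))"
        using t(1) by (simp add: power_divide)
      also have "\<dots> = \<bar>bump_poly p c d y\<bar>" using True by (simp add: bump_poly_def abs_mult t_def)
      finally show ?thesis unfolding t(2) .
    qed (use K0 in \<open>simp add: bump_poly_def\<close>)
    have z: "bump_poly q c d x = 0" for q using 3 by (simp add: bump_poly_def)
    have "((\<lambda>y. (bump_poly p c d y - bump_poly p c d x) / (y - x)) \<longlongrightarrow> 0) (at x)"
    proof (rule Lim_null_comparison)
      have "norm ((bump_poly p c d y - bump_poly p c d x) / (y - x)) \<le> K * c\<^sup>2 * \<bar>y - x\<bar>" for y
      proof (cases "y = x")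
        case False
        have "\<bar>bump_poly p c d y\<bar> \<le> K * c\<^sup>2 * \<bar>y - x\<bar> * \<bar>y - x\<bar>"
          using le[of y] by (simp add: power_mult_distrib power2_eq_square[of "y - x"] mult_ac abs_mult_self_eq)
        then show ?thesis using False by (simp add: z divide_le_eq)
      qed (use K0 in simp)
      then show "\<forall>\<^sub>F y in at x. norm ((bump_poly p c d y - bump_poly p c d x) / (y - x)) \<le> K * c\<^sup>2 * \<bar>y - x\<bar>"
        by simp
      have "((\<lambda>y. K * c\<^sup>2 * \<bar>y - x\<bar>) \<longlongrightarrow> K * c\<^sup>2 * \<bar>x - x\<bar>) (at x)" by (intro tendsto_intros)
      then show "((\<lambda>y. K * c\<^sup>2 * \<bar>y - x\<bar>) \<longlongrightarrow> 0) (at x)" by simp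
    qed
    then show ?thesis unfolding has_field_derivative_iff z .
  qed
qed

text \<open>Each generator lives on a half-line, and compact support requires the product of a left
  and a right one. The product rule then forces closure under sums and products.\<close>

inductive_set bump_algebra :: "(real \<Rightarrow> real) set" where
  base: "c \<noteq> 0 \<Longrightarrow> bump_poly p c d \<in> bump_algebra"
| add: "f \<in> bump_algebra \<Longrightarrow> g \<in> bump_algebra \<Longrightarrow> (\<lambda>x. f x + g x) \<in> bump_algebra"
| mult: "f \<in> bump_algebra \<Longrightarrow> g \<in> bump_algebra \<Longrightarrow> (\<lambda>x. f x * g x) \<in> bump_algebra"

lemma bump_algebra_deriv:
  "f \<in> bump_algebra \<Longrightarrow> \<exists>f'\<in>bump_algebra. \<forall>x. (f has_field_derivative f' x) (at x)"
proof (induction rule: bump_algebra.induct)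
  case (base c p d)
  then show ?case using bump_poly_deriv[OF base] bump_algebra.base[OF base] by blast
next
  case (add f g)
  then obtain f' g' where "f' \<in> bump_algebra" "g' \<in> bump_algebra"
    "\<And>x. (f has_field_derivative f' x) (at x)" "\<And>x. (g has_field_derivative g' x) (at x)" by blast
  then show ?case by (intro bexI[of _ "\<lambda>x. f' x + g' x"]) (auto intro: DERIV_add bump_algebra.add)
next
  case (mult f g)
  then obtain f' g' where "f' \<in> bump_algebra" "g' \<in> bump_algebra"
    "\<And>x. (f has_field_derivative f' x) (at x)" "\<And>x. (g has_field_derivative g' x) (at x)" by blast
  then show ?case using mult
    by (intro bexI[of _ "\<lambda>x. f' x * g x + g' x * f x"]) (auto intro: DERIV_mult bump_algebra.add bump_algebra.mult)
qed

lemma compact_closure_support: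
  fixes \<phi> :: "real \<Rightarrow> 'a::zero"
  shows "compact (closure {x. \<phi> x \<noteq> 0}) \<longleftrightarrow> (\<exists>R. \<forall>x. \<bar>x\<bar> > R \<longrightarrow> \<phi> x = 0)"
  unfolding compact_closure bounded_iff by (auto simp: not_le[symmetric] real_norm_def)

lemma test_functionI:
  assumes "\<phi> \<in> S" "\<And>f. f \<in> S \<Longrightarrow> \<exists>f'\<in>S. \<forall>x. (f has_field_derivative f' x) (at x)"
    and "\<And>x. \<bar>x\<bar> > R \<Longrightarrow> \<phi> x = 0"
  shows "test_function \<phi>"
  unfolding test_function_def compact_closure_support using smooth_coinduct[of \<phi> S] assms by blast

text \<open>On \<open>(a, b)\<close> this is
  \<open>exp (- 1 / (n * (x - a))) * exp (- 1 / (n * (b - x)))\<close>. Raising \<open>n\<close>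
  steepens the flanks without moving the support, so the indicator of the interval is approached
  from below.\<close>

definition bump :: "real \<Rightarrow> real \<Rightarrow> real \<Rightarrow> real \<Rightarrow> real" where
  "bump n a b x = bump_poly 1 n (- n * a) x * bump_poly 1 (- n) (n * b) x"

lemma bump_test: assumes "n > 0" shows "test_function (bump n a b)"
proof (rule test_functionI[where S=bump_algebra and R="max \<bar>a\<bar> \<bar>b\<bar>"])
  show "bump n a b \<in> bump_algebra" unfolding bump_def[abs_def]
    using assms by (intro bump_algebra.mult bump_algebra.base) auto
  show "bump n a b x = 0" if "\<bar>x\<bar> > max \<bar>a\<bar> \<bar>b\<bar>" for x
  proof -
    have "x < a \<or> b < x" using that by auto
    then have "n * x + - n * a \<le> 0 \<or> - n * x + n * b \<le> 0"
      using assms mult_left_mono[of x a n] mult_left_mono[of b x n] by auto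
    then show ?thesis by (auto simp: bump_def bump_poly_def)
  qed
qed (rule bump_algebra_deriv)

lemma bump_eq: assumes "n > 0"
  shows "bump n a b x = (if a < x \<and> x < b then exp (- (1 / (n * (x - a)))) * exp (- (1 / (n * (b - x)))) else 0)"
proof -
  have "n * x + - n * a > 0 \<longleftrightarrow> a < x" "- n * x + n * b > 0 \<longleftrightarrow> x < b"
    using assms by (auto simp: mult_less_cancel_left)
  moreover have "n * x + - n * a = n * (x - a)" "- n * x + n * b = n * (b - x)" by (auto simp: algebra_simps)
  ultimately show ?thesis by (auto simp: bump_def bump_poly_def)
qed

lemma bump_bounds: assumes "n > 0" shows "0 \<le> bump n a b x" "bump n a b x \<le> 1"
proof -
  show "0 \<le> bump n a b x" by (simp add: bump_eq[OF assms])
  show "bump n a b x \<le> 1"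
  proof (cases "a < x \<and> x < b")
    case True
    then have "exp (- (1 / (n * (x - a)))) * exp (- (1 / (n * (b - x)))) \<le> 1 * 1"
      using assms by (intro mult_mono) auto
    then show ?thesis using True by (simp add: bump_eq[OF assms])
  qed (auto simp: bump_eq[OF assms])
qed

lemma bump_lim: "(\<lambda>n. bump (real (Suc n)) a b x) \<longlonglongrightarrow> indicator {a<..<b} x"
proof (cases "a < x \<and> x < b")
  case True
  have "(\<lambda>n. exp (- (1 / (real (Suc n) * (x - a)))) * exp (- (1 / (real (Suc n) * (b - x))))) \<longlonglongrightarrow> exp (- (0 * (1 / (x - a)))) * exp (- (0 * (1 / (b - x))))"
  proof -
    have l: "(\<lambda>n. 1 / real (Suc n)) \<longlonglongrightarrow> 0" using LIMSEQ_inverse_real_of_nat by (simp add: inverse_eq_divide)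
    have "(\<lambda>n. exp (- ((1 / real (Suc n)) * (1 / (x - a)))) * exp (- ((1 / real (Suc n)) * (1 / (b - x))))) \<longlonglongrightarrow> exp (- (0 * (1 / (x - a)))) * exp (- (0 * (1 / (b - x))))"
      by (intro tendsto_intros l)
    then show ?thesis by simp
  qed
  then show ?thesis using True by (simp add: bump_eq)
qed (auto simp: bump_eq)

section \<open>Derivatives, transforms and moving averages of test functions\<close>

lemma test_function_deriv: assumes "test_function \<phi>" shows "test_function (deriv \<phi>)"
proof -
  have "(deriv ^^ k) (deriv \<phi>) field_differentiable at x" for k x
    using assms unfolding test_function_def by (metis funpow_Suc_right o_apply)
  moreover obtain R where R: "\<And>x. \<bar>x\<bar> > R \<Longrightarrow> \<phi> x = 0"
    using assms unfolding test_function_def compact_closure_support by blast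
  have "deriv \<phi> x = 0" if "\<bar>x\<bar> > R" for x
  proof -
    have "open {x. \<bar>x\<bar> > R}" by (intro open_Collect_less continuous_intros)
    then have "\<forall>\<^sub>F y in nhds x. \<phi> y = 0"
      using eventually_nhds_in_open[of "{x. \<bar>x\<bar> > R}" x] that R by (auto elim!: eventually_mono)
    then have "deriv \<phi> x = deriv (\<lambda>_. 0) x" by (intro deriv_cong_ev) auto
    then show ?thesis by simp
  qed
  ultimately show ?thesis unfolding test_function_def compact_closure_support by blast
qed

lemma test_function_DERIV: assumes "test_function \<phi>" shows "(\<phi> has_field_derivative deriv \<phi> x) (at x)"
  using assms unfolding test_function_def by (metis DERIV_deriv_iff_field_differentiable funpow_0)

lemma test_function_support: assumes "test_function \<phi>" obtains R where "\<And>x. \<bar>x\<bar> > R \<Longrightarrow> \<phi> x = 0"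
  using assms unfolding test_function_def compact_closure_support by blast

lemma test_function_isCont: "test_function \<phi> \<Longrightarrow> isCont \<phi> x"
  using test_function_DERIV DERIV_isCont by blast

lemma test_function_measurable: assumes "test_function \<phi>" shows "\<phi> \<in> borel_measurable borel"
  using test_function_isCont[OF assms]
  by (intro borel_measurable_continuous_onI) (simp add: continuous_on_eq_continuous_within continuous_at_imp_continuous_within)

lemma test_function_bounded: assumes "test_function \<phi>"
  obtains B R where "\<And>x. cmod (complex_of_real (\<phi> x)) \<le> cmod (complex_of_real B * indicator {-R..R} x)" "\<And>x. \<bar>x\<bar> > R \<Longrightarrow> \<phi> x = 0"
proof -
  obtain R where R: "\<And>x. \<bar>x\<bar> > R \<Longrightarrow> \<phi> x = 0" using test_function_support[OF assms] by blast
  have "continuous_on {-R..R} \<phi>"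
    using test_function_isCont[OF assms] by (simp add: continuous_at_imp_continuous_on)
  then have "bounded (\<phi> ` {-R..R})" by (intro compact_imp_bounded compact_continuous_image) auto
  then obtain B where B: "\<And>x. x \<in> {-R..R} \<Longrightarrow> \<bar>\<phi> x\<bar> \<le> B" unfolding bounded_iff by (metis imageI real_norm_def)
  have "cmod (complex_of_real (\<phi> x)) \<le> cmod (complex_of_real B * indicator {-R..R} x)" for x
    using B[of x] R[of x] by (cases "x \<in> {-R..R}") (auto simp: norm_mult)
  then show ?thesis using that R by blast
qed

lemma test_function_L2: assumes "test_function \<phi>" shows "(\<lambda>x. complex_of_real (\<phi> x)) \<in> Lp 2"
proof -
  obtain B R where b: "\<And>x. cmod (complex_of_real (\<phi> x)) \<le> cmod (complex_of_real B * indicator {-R..R} x)"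
    using test_function_bounded[OF assms] by metis
  note test_function_measurable[OF assms, measurable]
  show ?thesis by (rule L2_bound[OF L2_const_indicator]) (use b in auto)
qed

lemma test_function_integrable: assumes "test_function \<phi>" shows "integrable lborel (\<lambda>x. complex_of_real (\<phi> x))"
proof -
  obtain B R where b: "\<And>x. cmod (complex_of_real (\<phi> x)) \<le> cmod (complex_of_real B * indicator {-R..R} x)"
    using test_function_bounded[OF assms] by metis
  note test_function_measurable[OF assms, measurable]
  have "integrable lborel (\<lambda>x. B * indicat_real {-R..R} x)"
    by (intro integrable_mult_right integrable_real_indicator) (auto simp: emeasure_lborel_Icc_eq)
  then show ?thesis
  proof (rule Bochner_Integration.integrable_bound)
    have "cmod (complex_of_real B * indicator {-R..R} x) = norm (B * indicat_real {-R..R} x)" for x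
      by (simp add: norm_mult indicator_def)
    then show "AE x in lborel. cmod (complex_of_real (\<phi> x)) \<le> norm (B * indicat_real {-R..R} x)"
      using b by simp
  qed measurable
qed

lemma test_function_fourier:
  "test_function \<phi> \<Longrightarrow> has_fourier_L2 (\<lambda>x. complex_of_real (\<phi> x)) (ft (\<lambda>x. complex_of_real (\<phi> x)))"
  by (intro has_fourier_L1 test_function_integrable test_function_L2)

text \<open>Integration by parts in the form that \<open>exp (- \<i> * x * \<xi>) * \<phi> x\<close>
  has a derivative of integral zero over an interval beyond the support.\<close>

lemma ft_deriv:
  assumes \<phi>: "test_function \<phi>"
  shows "ft (\<lambda>x. complex_of_real (deriv \<phi> x)) \<xi> = \<i> * complex_of_real \<xi> * ft (\<lambda>x. complex_of_real (\<phi> x)) \<xi>"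
proof -
  note \<phi>' = test_function_deriv[OF \<phi>]
  obtain R1 R2 where R1: "\<And>x. \<bar>x\<bar> > R1 \<Longrightarrow> \<phi> x = 0" and R2: "\<And>x. \<bar>x\<bar> > R2 \<Longrightarrow> deriv \<phi> x = 0"
    using test_function_support[OF \<phi>] test_function_support[OF \<phi>'] by metis
  \<comment> \<open>The summand 1 makes \<open>\<phi>\<close> and its derivative vanish at the
    endpoints \<open>R\<close> and \<open>- R\<close> too, since \<open>R1\<close> and
    \<open>R2\<close> only control points strictly beyond them.\<close>
  define R where "R = max 0 (max R1 R2) + 1"
  have R: "R > 0" "\<And>x. \<bar>x\<bar> \<ge> R \<Longrightarrow> \<phi> x = 0" "\<And>x. \<bar>x\<bar> \<ge> R \<Longrightarrow> deriv \<phi> x = 0"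
    using R1 R2 by (auto simp: R_def)
  define e where "e x = exp (- \<i> * complex_of_real (x * \<xi>))" for x
  define g where "g x = e x * complex_of_real (deriv \<phi> x) - \<i> * complex_of_real \<xi> * (e x * complex_of_real (\<phi> x))" for x
  have e': "(e has_vector_derivative - \<i> * complex_of_real \<xi> * e x) (at x)" for x
  proof -
    have "((\<lambda>z. exp (- \<i> * complex_of_real \<xi> * z)) has_field_derivative - \<i> * complex_of_real \<xi> * exp (- \<i> * complex_of_real \<xi> * complex_of_real x)) (at (complex_of_real x))"
      by (auto intro!: derivative_eq_intros)
    from has_vector_derivative_real_field[OF this, of UNIV] show ?thesis
      by (simp add: e_def[abs_def] mult_ac)
  qed
  have p': "((\<lambda>x. complex_of_real (\<phi> x)) has_vector_derivative complex_of_real (deriv \<phi> x)) (at x)" for x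
    using test_function_DERIV[OF \<phi>, of x] by (intro has_vector_derivative_of_real)
      (simp add: has_real_derivative_iff_has_vector_derivative)
  have G: "((\<lambda>x. e x * complex_of_real (\<phi> x)) has_vector_derivative g x) (at x)" for x
    using has_vector_derivative_mult[OF e' p'] by (simp add: g_def algebra_simps)
  have "isCont e x" for x using e' has_vector_derivative_continuous by blast
  then have gc: "isCont g x" for x unfolding g_def
    by (intro continuous_intros isCont_of_real test_function_isCont \<phi> \<phi>')
  have "(LINT x|lborel. indicator {-R..R} x *\<^sub>R g x) = e R * complex_of_real (\<phi> R) - e (- R) * complex_of_real (\<phi> (- R))"
    by (rule integral_FTC_atLeastAtMost)
      (use R(1) has_vector_derivative_at_within[OF G] continuous_at_imp_continuous_on[of _ g] gc in simp_all)
  also have "\<dots> = 0" using R by simp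
  also have "(\<lambda>x. indicator {-R..R} x *\<^sub>R g x) = g"
  proof
    fix x show "indicator {-R..R} x *\<^sub>R g x = g x"
    proof (cases "x \<in> {-R..R}")
      case False
      then have "\<bar>x\<bar> \<ge> R" by auto
      then show ?thesis using R(2,3) by (simp add: g_def)
    qed simp
  qed
  finally have "(LINT x|lborel. g x) = 0" .
  moreover have "(LINT x|lborel. g x) = ft (\<lambda>x. complex_of_real (deriv \<phi> x)) \<xi> - \<i> * complex_of_real \<xi> * ft (\<lambda>x. complex_of_real (\<phi> x)) \<xi>"
    unfolding g_def ft_def e_def
    using kernel_integrable[OF test_function_integrable[OF \<phi>], of \<xi>] kernel_integrable[OF test_function_integrable[OF \<phi>'], of \<xi>]
    by (subst Bochner_Integration.integral_diff) auto
  ultimately show ?thesis by simp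
qed

text \<open>\<open>\<Psi> x\<close> is the integral of \<open>\<phi>\<close> over
  \<open>[x - 1, x]\<close>. A plain primitive of \<open>\<phi>\<close> is in general not compactly
  supported; the difference of two translates of one is.\<close>

lemma moving_average:
  assumes \<phi>: "test_function \<phi>"
  obtains \<Psi> where "test_function \<Psi>" "\<And>x. deriv \<Psi> x = \<phi> x - \<phi> (x - 1)"
proof -
  obtain R where R: "\<And>x. \<bar>x\<bar> > R \<Longrightarrow> \<phi> x = 0" using test_function_support[OF \<phi>] by blast
  obtain F where "\<And>x::real. -\<infinity> < ereal x \<Longrightarrow> ereal x < \<infinity> \<Longrightarrow> (F has_vector_derivative \<phi> x) (at x)"
    using einterval_antiderivative[of "-\<infinity>" "\<infinity>" \<phi>] test_function_isCont[OF \<phi>] by auto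
  then have F: "(F has_field_derivative \<phi> x) (at x)" for x
    by (simp add: has_real_derivative_iff_has_vector_derivative)
  define \<Psi> where "\<Psi> x = F x - F (x - 1)" for x
  have shift: "((\<lambda>x. h (x - 1)) has_field_derivative h' (x - 1)) (at x)"
    if "\<And>x. (h has_field_derivative h' x) (at x)" for h h' :: "real \<Rightarrow> real" and x
  proof -
    have "((\<lambda>x. x - 1) has_field_derivative 1) (at x)" by (auto intro!: derivative_eq_intros)
    from DERIV_chain2[OF that this] show ?thesis by simp
  qed
  have \<Psi>': "(\<Psi> has_field_derivative \<phi> x - \<phi> (x - 1)) (at x)" for x
    unfolding \<Psi>_def by (intro DERIV_diff F shift)
  define D where "D k = (\<lambda>x. (deriv ^^ k) \<phi> x - (deriv ^^ k) \<phi> (x - 1))" for k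
  have D': "(D k has_field_derivative D (Suc k) x) (at x)" for k x
  proof -
    have "((deriv ^^ k) \<phi> has_field_derivative (deriv ^^ Suc k) \<phi> x) (at x)" for x
      using \<phi> unfolding test_function_def by (simp add: DERIV_deriv_iff_field_differentiable)
    then show ?thesis unfolding D_def by (intro DERIV_diff shift)
  qed
  have "test_function \<Psi>"
  proof (rule test_functionI[where S="insert \<Psi> (range D)" and R="\<bar>R\<bar> + 1"])
    fix f assume "f \<in> insert \<Psi> (range D)"
    then consider "f = \<Psi>" | k where "f = D k" by blast
    then show "\<exists>f'\<in>insert \<Psi> (range D). \<forall>x. (f has_field_derivative f' x) (at x)"
    proof cases
      case 1
      then have "\<forall>x. (f has_field_derivative D 0 x) (at x)" using \<Psi>' by (simp add: D_def)
      then show ?thesis by blast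
    qed (use D' in blast)
  next
    fix x :: real assume x: "\<bar>x\<bar> > \<bar>R\<bar> + 1"
    \<comment> \<open>The mean value theorem expresses \<open>\<Psi> x\<close> as a value of
      \<open>\<phi>\<close> within distance 1 of \<open>x\<close>; hence the support radius grows by
      1.\<close>
    obtain z where z: "x - 1 < z" "z < x" "F x - F (x - 1) = (x - (x - 1)) * \<phi> z"
      using MVT2[of "x - 1" x F \<phi>] F by auto
    then have "\<bar>z\<bar> > R" using x by (auto simp: abs_if split: if_splits)
    then show "\<Psi> x = 0" using z(3) R by (simp add: \<Psi>_def)
  qed simp
  then show ?thesis using that DERIV_imp_deriv[OF \<Psi>'] by blast
qed

section \<open>Weak derivatives\<close>

text \<open>Open intervals are stable under intersection and generate the Borel sets, so induction
  over disjoint unions and complements extends the vanishing to every Borel set. As \<open>g\<close>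
  is integrable only locally, this is done for its restriction to \<open>(- N, N)\<close>, whose
  total integral is itself one of the given integrals.\<close>

lemma AE_zero_if_interval_integrals_zero:
  fixes g :: "real \<Rightarrow> real"
  assumes i: "\<And>a b. set_integrable lborel {a<..<b} g"
    and z: "\<And>a b. (LINT x:{a<..<b}|lborel. g x) = 0"
  shows "AE x in lborel. g x = 0"
proof -
  have "AE x in lborel. indicator {- real N<..<real N} x * g x = 0" for N :: nat
  proof -
    define h where "h x = indicator {- real N<..<real N} x * g x" for x
    have h: "integrable lborel h" using i[of "- real N" "real N"] by (simp add: set_integrable_def h_def[abs_def])
    have hs: "set_integrable lborel A h" if "A \<in> sets lborel" for A
      unfolding set_integrable_def using integrable_mult_indicator[OF that h] .
    have int: "(LINT x:{a<..<b}|lborel. h x) = 0" for a b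
    proof -
      have "(LINT x:{a<..<b}|lborel. h x) = (LINT x:{max a (- real N)<..<min b (real N)}|lborel. g x)"
        unfolding set_lebesgue_integral_def h_def by (intro Bochner_Integration.integral_cong refl) (auto simp: indicator_def)
      then show ?thesis using z by simp
    qed
    have whole: "(LINT x|lborel. h x) = 0"
      using z[of "- real N" "real N"] by (simp add: set_lebesgue_integral_def h_def)
    have "(LINT x:A|lborel. h x) = 0" if "A \<in> sets lborel" for A
    proof -
      define G where "G = range (\<lambda>(a, b). box a b :: real set)"
      have A: "A \<in> sigma_sets UNIV G"
        using that unfolding sets_lborel borel_eq_box G_def by (simp add: sets_measure_of)
      have stable: "Int_stable G"
      proof -
        have G_iff: "A \<in> G \<longleftrightarrow> (\<exists>a b. A = {a<..<b})" for A unfolding G_def image_iff by (auto simp: box_real)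
        have "{a<..<b} \<inter> {c<..<d} \<in> G" for a b c d :: real unfolding G_iff by (intro exI[of _ "max a c"] exI[of _ "min b d"]) auto
        then show ?thesis unfolding Int_stable_def by (auto simp: G_iff)
      qed
      have sub: "sigma_sets UNIV G = sets lborel"
        unfolding sets_lborel borel_eq_box G_def by (simp add: sets_measure_of)
      have "G \<subseteq> Pow UNIV" by simp
      from stable this A show ?thesis
      proof (induction rule: sigma_sets_induct_disjoint)
        case (basic A)
        then show ?case using int by (auto simp: G_def box_real)
      next
        case (compl A)
        then have A: "A \<in> sets lborel" using sub by simp
        have "(LINT x:UNIV - A|lborel. h x) = (LINT x|lborel. h x - indicator A x *\<^sub>R h x)"
          unfolding set_lebesgue_integral_def by (intro Bochner_Integration.integral_cong refl) (auto simp: indicator_def)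
        also have "\<dots> = (LINT x|lborel. h x) - (LINT x:A|lborel. h x)"
          unfolding set_lebesgue_integral_def using hs[OF A] by (intro Bochner_Integration.integral_diff h) (simp add: set_integrable_def)
        finally show ?case using compl whole by simp
      next
        case (union A)
        have "(LINT x:(\<Union>i. A i)|lborel. h x) = (\<Sum>i. (LINT x:(A i)|lborel. h x))"
          by (rule lebesgue_integral_countable_add)
             (use union sub in \<open>auto simp: disjoint_family_on_def intro!: hs\<close>)
        then show ?case using union by simp
      qed (simp add: set_lebesgue_integral_def)
    qed
    then show ?thesis
      using density_unique_real[OF h, of "\<lambda>_. 0"] by (simp add: h_def)
  qed
  then have "AE x in lborel. \<forall>N::nat. indicator {- real N<..<real N} x * g x = 0"
    unfolding AE_all_countable by blast
  then show ?thesis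
  proof eventually_elim
    case (elim x)
    obtain N :: nat where "\<bar>x\<bar> < real N" using reals_Archimedean2 by blast
    then show ?case using elim[rule_format, of N] by (auto simp: indicator_def)
  qed
qed

text \<open>The bumps converge to the indicator of an interval and are dominated by it, so
  \<open>k\<close> has integral zero over every open interval; the real and imaginary parts then
  vanish separately.\<close>

lemma fundamental_lemma_L2:
  assumes k: "k \<in> Lp 2" and z: "\<And>\<phi>. test_function \<phi> \<Longrightarrow> (LINT x|lborel. k x * complex_of_real (\<phi> x)) = 0"
  shows "AE x in lborel. k x = 0"
proof -
  have [measurable]: "k \<in> borel_measurable borel" using L2_measurable[OF k] by simp
  have i: "integrable lborel (\<lambda>x. indicator {a<..<b} x *\<^sub>R k x)" for a b
  proof (rule Bochner_Integration.integrable_bound)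
    show "integrable lborel (\<lambda>x. 1 * indicator {a..b} x * k x)"
      by (rule L2_mult_integrable[OF L2_const_indicator k])
  qed (auto simp: indicator_def)
  have 0: "(LINT x|lborel. indicator {a<..<b} x *\<^sub>R k x) = 0" for a b
  proof -
    have "(\<lambda>n. LINT x|lborel. k x * complex_of_real (bump (real (Suc n)) a b x)) \<longlonglongrightarrow> (LINT x|lborel. indicator {a<..<b} x *\<^sub>R k x)"
    proof (rule integral_dominated_convergence[where w="\<lambda>x. norm (indicator {a<..<b} x *\<^sub>R k x)"])
      have [measurable]: "bump (real (Suc n)) a b \<in> borel_measurable borel" for n
        by (intro test_function_measurable bump_test) simp
      show "(\<lambda>x. k x * complex_of_real (bump (real (Suc n)) a b x)) \<in> borel_measurable lborel" for n by measurable
      show "integrable lborel (\<lambda>x. norm (indicator {a<..<b} x *\<^sub>R k x))" by (rule integrable_norm[OF i])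
      show "AE x in lborel. (\<lambda>n. k x * complex_of_real (bump (real (Suc n)) a b x)) \<longlonglongrightarrow> indicator {a<..<b} x *\<^sub>R k x"
      proof (rule AE_I2)
        fix x
        have "(\<lambda>n. k x * complex_of_real (bump (real (Suc n)) a b x)) \<longlonglongrightarrow> k x * complex_of_real (indicator {a<..<b} x)"
          by (intro tendsto_intros bump_lim)
        then show "(\<lambda>n. k x * complex_of_real (bump (real (Suc n)) a b x)) \<longlonglongrightarrow> indicator {a<..<b} x *\<^sub>R k x"
          by (simp add: scaleR_conv_of_real mult.commute)
      qed
      show "AE x in lborel. norm (k x * complex_of_real (bump (real (Suc n)) a b x)) \<le> norm (indicator {a<..<b} x *\<^sub>R k x)" for n
      proof (rule AE_I2)
        fix x
        have p: "real (Suc n) > 0" by simp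
        have "norm (k x * complex_of_real (bump (real (Suc n)) a b x)) = bump (real (Suc n)) a b x * cmod (k x)"
          using bump_bounds(1)[OF p, of a b x] by (simp add: norm_mult)
        also have "\<dots> \<le> indicator {a<..<b} x * cmod (k x)"
        proof (intro mult_right_mono)
          show "bump (real (Suc n)) a b x \<le> indicator {a<..<b} x"
          proof (cases "x \<in> {a<..<b}")
            case True
            then show ?thesis using bump_bounds(2)[OF p, of a b x] by simp
          next
            case False
            then show ?thesis using bump_eq[OF p, of a b x] by auto
          qed
        qed simp
        finally show "norm (k x * complex_of_real (bump (real (Suc n)) a b x)) \<le> norm (indicator {a<..<b} x *\<^sub>R k x)"
          by simp
      qed
    qed measurable
    moreover have "(\<lambda>n. LINT x|lborel. k x * complex_of_real (bump (real (Suc n)) a b x)) = (\<lambda>n. 0)"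
      by (rule ext, rule z, rule bump_test) simp
    ultimately show ?thesis using LIMSEQ_unique[OF _ tendsto_const] by metis
  qed
  have "AE x in lborel. Re (k x) = 0"
  proof (rule AE_zero_if_interval_integrals_zero)
    show "set_integrable lborel {a<..<b} (\<lambda>x. Re (k x))" for a b
      using integrable_Re[OF i[of a b]] by (simp add: set_integrable_def)
    show "(LINT x:{a<..<b}|lborel. Re (k x)) = 0" for a b
      using integral_Re[OF i[of a b]] 0 by (simp add: set_lebesgue_integral_def)
  qed
  moreover have "AE x in lborel. Im (k x) = 0"
  proof (rule AE_zero_if_interval_integrals_zero)
    show "set_integrable lborel {a<..<b} (\<lambda>x. Im (k x))" for a b
      using integrable_Im[OF i[of a b]] by (simp add: set_integrable_def)
    show "(LINT x:{a<..<b}|lborel. Im (k x)) = 0" for a b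
      using integral_Im[OF i[of a b]] 0 by (simp add: set_lebesgue_integral_def)
  qed
  ultimately show ?thesis by eventually_elim (simp add: complex_eq_iff)
qed

lemma l2inner_of_real_right: "l2inner f (\<lambda>x. complex_of_real (p x)) = (LINT x|lborel. f x * complex_of_real (p x))"
  by (simp add: l2inner_def)

lemma AE_exp_neq_1: "AE \<xi> in lborel. iexp \<xi> \<noteq> 1"
proof -
  have "{\<xi>::real. iexp \<xi> = 1} \<subseteq> range (\<lambda>n::int. of_int (2 * n) * pi)"
    by (auto simp: exp_eq_1)
  then have "countable {\<xi>::real. iexp \<xi> = 1}"
    by (rule countable_subset) simp
  from AE_not_in[OF countable_imp_null_set_lborel[OF this]] show ?thesis by simp
qed

text \<open>
  For the forward direction \<open>\<xi> F\<close> is not yet known to be square integrable, so one tests against moving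
  averages \<open>\<Psi>\<close> of \<open>\<phi>\<close>: this multiplies the claim by the bounded symbol \<open>(exp (\<i> \<xi>) - 1) / (\<i> \<xi>)\<close>, which
  vanishes only on a null set.
\<close>

lemma weak_deriv_iff_fourier:
  assumes f: "f \<in> Lp 2" and g: "g \<in> Lp 2" and F: "has_fourier_L2 f F" and G: "has_fourier_L2 g G"
  shows "has_weak_deriv f g \<longleftrightarrow> (AE \<xi> in lborel. G \<xi> = \<i> * complex_of_real \<xi> * F \<xi>)"
proof
  note FL = has_fourier_L2_L2[OF F] and GL = has_fourier_L2_L2[OF G]
  note FL[THEN L2_measurable, measurable] GL[THEN L2_measurable, measurable]
  assume eq: "AE \<xi> in lborel. G \<xi> = \<i> * complex_of_real \<xi> * F \<xi>"
  show "has_weak_deriv f g"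
    unfolding has_weak_deriv_def
  proof (intro allI impI)
    fix \<phi> assume \<phi>: "test_function \<phi>"
    note \<phi>' = test_function_deriv[OF \<phi>]
    define P where "P = ft (\<lambda>x. complex_of_real (\<phi> x))"
    have [measurable]: "P \<in> borel_measurable borel"
      unfolding P_def using test_function_measurable[OF \<phi>] by measurable
    have "2 * pi * l2inner f (\<lambda>x. complex_of_real (deriv \<phi> x)) = l2inner F (ft (\<lambda>x. complex_of_real (deriv \<phi> x)))"
      by (rule has_fourier_inner[OF f test_function_L2[OF \<phi>'] F test_function_fourier[OF \<phi>'], symmetric])
    also have "\<dots> = (LINT \<xi>|lborel. - (G \<xi> * cnj (P \<xi>)))"
      unfolding l2inner_def ft_deriv[OF \<phi>] P_def[symmetric]
      by (rule integral_cong_AE) (measurable, use eq in eventually_elim, simp)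
    also have "\<dots> = - l2inner G P" by (simp add: l2inner_def)
    also have "l2inner G P = 2 * pi * l2inner g (\<lambda>x. complex_of_real (\<phi> x))"
      unfolding P_def by (rule has_fourier_inner[OF g test_function_L2[OF \<phi>] G test_function_fourier[OF \<phi>]])
    finally have "complex_of_real (2 * pi) * l2inner f (\<lambda>x. complex_of_real (deriv \<phi> x)) = complex_of_real (2 * pi) * - l2inner g (\<lambda>x. complex_of_real (\<phi> x))"
      by simp
    then have "l2inner f (\<lambda>x. complex_of_real (deriv \<phi> x)) = - l2inner g (\<lambda>x. complex_of_real (\<phi> x))"
      by (subst (asm) mult_cancel_left) simp
    then show "(LINT x|lborel. f x * complex_of_real (deriv \<phi> x)) = - (LINT x|lborel. g x * complex_of_real (\<phi> x))"
      by (simp add: l2inner_of_real_right)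
  qed
next
  note FL = has_fourier_L2_L2[OF F] and GL = has_fourier_L2_L2[OF G]
  note FL[THEN L2_measurable, measurable] GL[THEN L2_measurable, measurable]
  assume w: "has_weak_deriv f g"
  define e where "e \<xi> = iexp \<xi> - 1" for \<xi>
  \<comment> \<open>The bounded symbol of averaging over a unit interval. At
    \<open>\<xi> = 0\<close> division by zero gives \<open>m 0 = 0\<close>, which keeps the bound by
    1 and affects a single point only.\<close>
  define m where "m \<xi> = e \<xi> / (\<i> * complex_of_real \<xi>)" for \<xi>
  have [measurable]: "e \<in> borel_measurable borel" "m \<in> borel_measurable borel"
    unfolding m_def[abs_def] e_def[abs_def] by measurable
  have e2: "cmod (e \<xi>) \<le> 2" for \<xi>
    using norm_triangle_ineq4[of "iexp \<xi>" 1] by (simp add: e_def)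
  have e1: "cmod (e \<xi>) \<le> \<bar>\<xi>\<bar>" for \<xi> using iexp_approx1[of \<xi> 0] by (simp add: e_def)
  have m1: "cmod (m \<xi>) \<le> 1" for \<xi>
    using e1[of \<xi>] by (cases "\<xi> = 0") (auto simp: m_def norm_divide norm_mult)
  \<comment> \<open>Away from 0 this is \<open>m \<xi> * (\<i> * \<xi> * F \<xi> - G \<xi>)\<close>,
    written so that each summand is visibly in \<open>Lp 2\<close>. Since the transform is onto,
    \<open>K\<close> comes from some \<open>k\<close>, and \<open>K = 0\<close> can be tested on the
    side of \<open>x\<close>.\<close>
  define K where "K \<xi> = e \<xi> * F \<xi> - m \<xi> * G \<xi>" for \<xi>
  have eF: "(\<lambda>\<xi>. e \<xi> * F \<xi>) \<in> Lp 2" by (rule L2_bounded_mult[OF FL _ e2]) measurable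
  have mG: "(\<lambda>\<xi>. m \<xi> * G \<xi>) \<in> Lp 2" by (rule L2_bounded_mult[OF GL _ m1]) measurable
  have KL: "K \<in> Lp 2" unfolding K_def[abs_def] by (rule L2_diff[OF eF mG])
  obtain k where k: "k \<in> Lp 2" "has_fourier_L2 k K" using has_fourier_surj[OF KL] by blast
  have "(LINT x|lborel. k x * complex_of_real (\<phi> x)) = 0" if \<phi>: "test_function \<phi>" for \<phi>
  proof -
    obtain \<Psi> where \<Psi>: "test_function \<Psi>" "\<And>x. deriv \<Psi> x = \<phi> x - \<phi> (x - 1)" using moving_average[OF \<phi>] by blast
    define P where "P = ft (\<lambda>x. complex_of_real (\<phi> x))"
    define Q where "Q = ft (\<lambda>x. complex_of_real (\<Psi> x))"
    have [measurable]: "P \<in> borel_measurable borel" "Q \<in> borel_measurable borel"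
      unfolding P_def Q_def using test_function_measurable[OF \<phi>] test_function_measurable[OF \<Psi>(1)] by measurable
    have PL: "P \<in> Lp 2" unfolding P_def using test_function_fourier[OF \<phi>] has_fourier_L2_L2 by blast
    have QL: "Q \<in> Lp 2" unfolding Q_def using test_function_fourier[OF \<Psi>(1)] has_fourier_L2_L2 by blast
    have int: "integrable lborel (\<lambda>x. complex_of_real (\<phi> (x - 1)))"
      using lborel_integrable_real_affine[OF test_function_integrable[OF \<phi>], of 1 "-1"] by simp
    \<comment> \<open>Away from 0 this says \<open>Q \<xi> = cnj (m \<xi>) * P \<xi>\<close>:
      testing against \<open>\<Psi>\<close> is testing against \<open>\<phi>\<close> with the symbol
      \<open>m\<close> inserted.\<close>
    have PQ: "\<i> * complex_of_real \<xi> * Q \<xi> = - cnj (e \<xi>) * P \<xi>" for \<xi>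
    proof -
      have "\<i> * complex_of_real \<xi> * Q \<xi> = ft (\<lambda>x. complex_of_real (\<phi> x) - complex_of_real (\<phi> (x - 1))) \<xi>"
        unfolding Q_def ft_deriv[OF \<Psi>(1), symmetric] \<Psi>(2) by simp
      also have "\<dots> = P \<xi> - iexp (- 1 * \<xi>) * P \<xi>"
        unfolding P_def ft_diff[OF test_function_integrable[OF \<phi>] int]
        using ft_shift[of "\<lambda>x. complex_of_real (\<phi> x)" "-1" \<xi>] by simp
      also have "\<dots> = - cnj (e \<xi>) * P \<xi>" by (simp add: e_def exp_cnj algebra_simps)
      finally show ?thesis .
    qed
    have "l2inner (\<lambda>\<xi>. e \<xi> * F \<xi>) P = (LINT \<xi>|lborel. - (F \<xi> * cnj (\<i> * complex_of_real \<xi> * Q \<xi>)))"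
      unfolding l2inner_def PQ by (simp add: mult_ac)
    also have "\<dots> = - l2inner F (ft (\<lambda>x. complex_of_real (deriv \<Psi> x)))"
      unfolding l2inner_def ft_deriv[OF \<Psi>(1)] Q_def by simp
    also have "\<dots> = - (2 * pi * (LINT x|lborel. f x * complex_of_real (deriv \<Psi> x)))"
      using has_fourier_inner[OF f test_function_L2 F test_function_fourier, OF test_function_deriv test_function_deriv, OF \<Psi>(1) \<Psi>(1)]
      by (simp add: l2inner_of_real_right)
    also have "\<dots> = 2 * pi * (LINT x|lborel. g x * complex_of_real (\<Psi> x))"
      using w \<Psi>(1) by (simp add: has_weak_deriv_def)
    also have "\<dots> = l2inner G Q"
      unfolding Q_def using has_fourier_inner[OF g test_function_L2[OF \<Psi>(1)] G test_function_fourier[OF \<Psi>(1)]]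
      by (simp add: l2inner_of_real_right)
    also have "\<dots> = l2inner (\<lambda>\<xi>. m \<xi> * G \<xi>) P"
      unfolding l2inner_def
    proof (rule integral_cong_AE)
      have "AE \<xi> in lborel. \<xi> \<noteq> (0::real)" by (rule AE_lborel_singleton)
      then show "AE \<xi> in lborel. G \<xi> * cnj (Q \<xi>) = m \<xi> * G \<xi> * cnj (P \<xi>)"
      proof eventually_elim
        case (elim \<xi>)
        then have "Q \<xi> = - cnj (e \<xi>) * P \<xi> / (\<i> * complex_of_real \<xi>)" using PQ[of \<xi>] by (simp add: field_simps)
        then show ?case by (simp add: m_def mult_ac)
      qed
    qed measurable
    finally have "l2inner K P = 0"
      unfolding K_def using l2inner_diff_left[OF eF mG PL] by simp
    then have "complex_of_real (2 * pi) * l2inner k (\<lambda>x. complex_of_real (\<phi> x)) = 0"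
      unfolding P_def using has_fourier_inner[OF k(1) test_function_L2[OF \<phi>] k(2) test_function_fourier[OF \<phi>]] by simp
    then have "l2inner k (\<lambda>x. complex_of_real (\<phi> x)) = 0" by (subst (asm) mult_eq_0_iff) simp
    then show ?thesis by (simp add: l2inner_of_real_right)
  qed
  then have "AE x in lborel. k x = 0" by (rule fundamental_lemma_L2[OF k(1)])
  then have "l2norm k = 0" using l2norm_eq_0[OF k(1)] by simp
  then have "l2norm K = 0" using has_fourier_norm[OF k] by simp
  then have "AE \<xi> in lborel. K \<xi> = 0" using l2norm_eq_0[OF KL] by simp
  moreover have "AE \<xi> in lborel. \<xi> \<noteq> (0::real)" by (rule AE_lborel_singleton)
  ultimately show "AE \<xi> in lborel. G \<xi> = \<i> * complex_of_real \<xi> * F \<xi>"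
    using AE_exp_neq_1
  proof eventually_elim
    case (elim \<xi>)
    then have "e \<xi> * F \<xi> = e \<xi> * (G \<xi> / (\<i> * complex_of_real \<xi>))" "e \<xi> \<noteq> 0" by (auto simp: K_def m_def e_def)
    then have "F \<xi> = G \<xi> / (\<i> * complex_of_real \<xi>)" by (subst (asm) mult_cancel_left) simp
    then show ?case using elim by simp
  qed
qed

abbreviation xmult :: "(real \<Rightarrow> complex) \<Rightarrow> real \<Rightarrow> complex" where
  "xmult F \<equiv> (\<lambda>\<xi>. complex_of_real \<xi> * F \<xi>)"

text \<open>In the converse direction the weak derivative has to be produced; it is the function
  whose transform is \<open>\<i> * xmult F\<close>, which exists because the transform is
  onto.\<close>

lemma H1_iff_fourier:
  assumes f: "f \<in> Lp 2" and F: "has_fourier_L2 f F"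
  shows "f \<in> H1 \<longleftrightarrow> xmult F \<in> Lp 2"
proof
  note FL = has_fourier_L2_L2[OF F]
  note FL[THEN L2_measurable, measurable]
  assume "f \<in> H1"
  then obtain g where g: "g \<in> Lp 2" "has_weak_deriv f g" by (auto simp: H1_def)
  obtain G where G: "has_fourier_L2 g G" using has_fourier_exists[OF g(1)] by blast
  have "AE \<xi> in lborel. G \<xi> = \<i> * complex_of_real \<xi> * F \<xi>" using weak_deriv_iff_fourier[OF f g(1) F G] g(2) by blast
  then have "AE \<xi> in lborel. cmod (xmult F \<xi>) \<le> cmod (G \<xi>)" by eventually_elim (simp add: norm_mult)
  then show "xmult F \<in> Lp 2" by (intro L2_bound[OF has_fourier_L2_L2[OF G]]) auto
next
  assume x: "xmult F \<in> Lp 2"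
  from has_fourier_surj[OF L2_cmult[OF x, of \<i>]] obtain g where g: "g \<in> Lp 2" "has_fourier_L2 g (\<lambda>\<xi>. \<i> * xmult F \<xi>)"
    by blast
  have "has_weak_deriv f g" using weak_deriv_iff_fourier[OF f g(1) F g(2)] by (simp add: mult.assoc)
  then show "f \<in> H1" using f g(1) by (auto simp: H1_def)
qed

lemma H1_L2: "f \<in> H1 \<Longrightarrow> f \<in> Lp 2" by (simp add: H1_def)

text \<open>Whichever weak derivative is chosen, its transform is \<open>\<i> * xmult F\<close>
  almost everywhere, so its norm is determined.\<close>

lemma l2norm_weak_deriv:
  assumes f: "f \<in> H1" and F: "has_fourier_L2 f F"
  shows "sqrt (2 * pi) * l2norm (weak_deriv f) = l2norm (xmult F)"
proof -
  note fL = H1_L2[OF f]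
  have "\<exists>g. g \<in> Lp 2 \<and> has_weak_deriv f g" using f by (auto simp: H1_def)
  from someI_ex[OF this] have g: "weak_deriv f \<in> Lp 2" "has_weak_deriv f (weak_deriv f)"
    by (simp_all add: weak_deriv_def)
  obtain G where G: "has_fourier_L2 (weak_deriv f) G" using has_fourier_exists[OF g(1)] by blast
  have eq: "AE \<xi> in lborel. G \<xi> = \<i> * complex_of_real \<xi> * F \<xi>" using weak_deriv_iff_fourier[OF fL g(1) F G] g(2) by blast
  have "l2norm G = l2norm (\<lambda>\<xi>. \<i> * xmult F \<xi>)"
    by (rule l2norm_cong_AE) (use eq G F has_fourier_L2_L2 L2_measurable in \<open>auto simp: mult.assoc\<close>)
  also have "\<dots> = l2norm (xmult F)" by (simp add: l2norm_scale)
  finally show ?thesis using has_fourier_norm[OF g(1) G] by simp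
qed

section \<open>The space of Sobolev functions with nonnegative frequencies\<close>

lemma H1_plus_iff_fourier:
  assumes f: "f \<in> Lp 2" and F: "has_fourier_L2 f F"
  shows "f \<in> H1_plus \<longleftrightarrow> xmult F \<in> Lp 2 \<and> (AE \<xi> in lborel. \<xi> < 0 \<longrightarrow> F \<xi> = 0)"
proof -
  have "(AE \<xi> in lborel. \<xi> < 0 \<longrightarrow> fourier_L2 f \<xi> = 0) \<longleftrightarrow> (AE \<xi> in lborel. \<xi> < 0 \<longrightarrow> F \<xi> = 0)"
  proof
    assume "AE \<xi> in lborel. \<xi> < 0 \<longrightarrow> fourier_L2 f \<xi> = 0"
    then show "AE \<xi> in lborel. \<xi> < 0 \<longrightarrow> F \<xi> = 0" using fourier_L2_eq[OF f F] by eventually_elim simp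
  next
    assume "AE \<xi> in lborel. \<xi> < 0 \<longrightarrow> F \<xi> = 0"
    then show "AE \<xi> in lborel. \<xi> < 0 \<longrightarrow> fourier_L2 f \<xi> = 0" using fourier_L2_eq[OF f F] by eventually_elim simp
  qed
  then show ?thesis
    unfolding H1_plus_def L2_plus_def using H1_iff_fourier[OF f F] f by auto
qed

lemma H1_plus_L2: "f \<in> H1_plus \<Longrightarrow> f \<in> Lp 2" and H1_plus_H1: "f \<in> H1_plus \<Longrightarrow> f \<in> H1"
  by (auto simp: H1_plus_def L2_plus_def)

text \<open>Without negative frequencies \<open>|\<xi>| = \<xi>\<close> on the support of
  \<open>F\<close>, so the squared half-derivative becomes the sesquilinear form
  \<open>l2inner (xmult F) F\<close>, which can be expanded in \<open>F\<close>. Exhibiting one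
  admissible function first shows that the choice in \<open>abs_D\<close> succeeds.\<close>

lemma l2norm_abs_D_half:
  assumes f: "f \<in> H1_plus" and F: "has_fourier_L2 f F"
  shows "2 * pi * (l2norm (abs_D (1/2) f))\<^sup>2 = Re (l2inner (xmult F) F)"
proof -
  note fL = H1_plus_L2[OF f] and FL = has_fourier_L2_L2[OF F]
  note FL[THEN L2_measurable, measurable]
  have xF: "xmult F \<in> Lp 2" and supp: "AE \<xi> in lborel. \<xi> < 0 \<longrightarrow> F \<xi> = 0"
    using H1_plus_iff_fourier[OF fL F] f by auto
  define H where "H \<xi> = complex_of_real (\<bar>\<xi>\<bar> powr (1/2)) * F \<xi>" for \<xi>
  have HL: "H \<in> Lp 2"
  proof (rule L2_bound)
    show "(\<lambda>\<xi>. complex_of_real (cmod (F \<xi>)) + complex_of_real (cmod (xmult F \<xi>))) \<in> Lp 2"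
      by (intro L2_add L2_bound[OF FL] L2_bound[OF xF]) auto
    show "H \<in> borel_measurable lborel" unfolding H_def[abs_def] by measurable
    show "AE \<xi> in lborel. cmod (H \<xi>) \<le> cmod (complex_of_real (cmod (F \<xi>)) + complex_of_real (cmod (xmult F \<xi>)))"
    proof (rule AE_I2)
      fix \<xi> :: real
      have "\<bar>\<xi>\<bar> powr (1/2) \<le> 1 + \<bar>\<xi>\<bar>"
      proof -
        have "sqrt \<bar>\<xi>\<bar> \<le> 1 + \<bar>\<xi>\<bar>"
          by (rule real_le_lsqrt) (auto simp: power2_eq_square algebra_simps)
        then show ?thesis by (simp add: powr_half_sqrt)
      qed
      then have "cmod (H \<xi>) \<le> (1 + \<bar>\<xi>\<bar>) * cmod (F \<xi>)" by (simp add: H_def norm_mult mult_right_mono)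
      also have "\<dots> = cmod (F \<xi>) + cmod (xmult F \<xi>)" by (simp add: norm_mult algebra_simps)
      also have "\<dots> = cmod (complex_of_real (cmod (F \<xi>)) + complex_of_real (cmod (xmult F \<xi>)))"
        unfolding of_real_add[symmetric] norm_of_real by simp
      finally show "cmod (H \<xi>) \<le> cmod (complex_of_real (cmod (F \<xi>)) + complex_of_real (cmod (xmult F \<xi>)))" .
    qed
  qed
  obtain h where h: "h \<in> Lp 2" "has_fourier_L2 h H" using has_fourier_surj[OF HL] by blast
  have eqH: "AE \<xi> in lborel. complex_of_real (\<bar>\<xi>\<bar> powr (1/2)) * fourier_L2 f \<xi> = H \<xi>"
    using fourier_L2_eq[OF fL F] by eventually_elim (simp add: H_def)
  have "AE \<xi> in lborel. fourier_L2 h \<xi> = complex_of_real (\<bar>\<xi>\<bar> powr (1/2)) * fourier_L2 f \<xi>"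
    using fourier_L2_eq[OF h] eqH by eventually_elim simp
  with h(1) have "h \<in> Lp 2 \<and> (AE \<xi> in lborel. fourier_L2 h \<xi> = complex_of_real (\<bar>\<xi>\<bar> powr (1/2)) * fourier_L2 f \<xi>)" ..
  then have "\<exists>g. g \<in> Lp 2 \<and> (AE \<xi> in lborel. fourier_L2 g \<xi> = complex_of_real (\<bar>\<xi>\<bar> powr (1/2)) * fourier_L2 f \<xi>)"
    by blast
  from someI_ex[OF this] have "abs_D (1/2) f \<in> Lp 2 \<and>
    (AE \<xi> in lborel. fourier_L2 (abs_D (1/2) f) \<xi> = complex_of_real (\<bar>\<xi>\<bar> powr (1/2)) * fourier_L2 f \<xi>)"
    unfolding abs_D_def .
  then have g: "abs_D (1/2) f \<in> Lp 2"
    and gF: "AE \<xi> in lborel. fourier_L2 (abs_D (1/2) f) \<xi> = complex_of_real (\<bar>\<xi>\<bar> powr (1/2)) * fourier_L2 f \<xi>" by auto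
  have "AE \<xi> in lborel. fourier_L2 (abs_D (1/2) f) \<xi> = H \<xi>" using gF eqH by eventually_elim simp
  then have "l2norm (fourier_L2 (abs_D (1/2) f)) = l2norm H"
    by (intro l2norm_cong_AE L2_measurable[OF HL] L2_measurable[OF has_fourier_L2_L2[OF fourier_L2_has[OF g]]])
  then have "l2norm H = sqrt (2 * pi) * l2norm (abs_D (1/2) f)"
    using has_fourier_norm[OF g fourier_L2_has[OF g]] by simp
  then have "2 * pi * (l2norm (abs_D (1/2) f))\<^sup>2 = (l2norm H)\<^sup>2"
    by (simp add: power_mult_distrib)
  also have "\<dots> = Re (LINT \<xi>|lborel. H \<xi> * cnj (H \<xi>))"
    using l2inner_self[of H] by (simp add: l2inner_def)
  also have "(LINT \<xi>|lborel. H \<xi> * cnj (H \<xi>)) = (LINT \<xi>|lborel. xmult F \<xi> * cnj (F \<xi>))"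
  proof (rule integral_cong_AE)
    show "(\<lambda>\<xi>. H \<xi> * cnj (H \<xi>)) \<in> borel_measurable lborel" using L2_measurable[OF HL] by measurable
    show "AE \<xi> in lborel. H \<xi> * cnj (H \<xi>) = xmult F \<xi> * cnj (F \<xi>)"
      using supp
    proof eventually_elim
      case (elim \<xi>)
      show ?case
      proof (cases "\<xi> < 0")
        case False
        have "complex_of_real (sqrt \<bar>\<xi>\<bar>) * complex_of_real (sqrt \<bar>\<xi>\<bar>) = complex_of_real \<xi>"
          using False by (simp flip: of_real_mult)
        then have "complex_of_real (sqrt \<bar>\<xi>\<bar>) * F \<xi> * (complex_of_real (sqrt \<bar>\<xi>\<bar>) * cnj (F \<xi>)) = complex_of_real \<xi> * F \<xi> * cnj (F \<xi>)"
          by (metis mult.assoc mult.left_commute)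
        then show ?thesis by (simp add: H_def powr_half_sqrt)
      qed (use elim in \<open>simp add: H_def\<close>)
    qed
  qed measurable
  finally show ?thesis by (simp add: l2inner_def)
qed

lemma H1_plus_diff:
  assumes f: "f \<in> H1_plus" and g: "g \<in> H1_plus" shows "(\<lambda>x. f x - g x) \<in> H1_plus"
proof -
  note fL = H1_plus_L2[OF f] and gL = H1_plus_L2[OF g]
  obtain F G where F: "has_fourier_L2 f F" and G: "has_fourier_L2 g G"
    using has_fourier_exists fL gL by blast
  have "xmult F \<in> Lp 2" "AE \<xi> in lborel. \<xi> < 0 \<longrightarrow> F \<xi> = 0" "xmult G \<in> Lp 2" "AE \<xi> in lborel. \<xi> < 0 \<longrightarrow> G \<xi> = 0"
    using H1_plus_iff_fourier[OF fL F] f H1_plus_iff_fourier[OF gL G] g by auto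
  then have "xmult (\<lambda>\<xi>. F \<xi> - G \<xi>) \<in> Lp 2 \<and> (AE \<xi> in lborel. \<xi> < 0 \<longrightarrow> F \<xi> - G \<xi> = 0)"
    using L2_diff[of "xmult F" "xmult G"] by (auto simp: right_diff_distrib elim: AE_mp)
  then show ?thesis using H1_plus_iff_fourier[OF L2_diff[OF fL gL] has_fourier_diff[OF fL gL F G]] by simp
qed

lemma H1_plus_shift:
  assumes f: "f \<in> H1_plus" shows "(\<lambda>x. f (x + h)) \<in> H1_plus"
proof -
  note fL = H1_plus_L2[OF f]
  obtain F where F: "has_fourier_L2 f F" using has_fourier_exists fL by blast
  have x: "xmult F \<in> Lp 2" and s: "AE \<xi> in lborel. \<xi> < 0 \<longrightarrow> F \<xi> = 0"
    using H1_plus_iff_fourier[OF fL F] f by auto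
  have "(\<lambda>\<xi>. iexp (h * \<xi>) * xmult F \<xi>) \<in> Lp 2"
    by (rule L2_bounded_mult[OF x, where B=1]) auto
  then have "xmult (\<lambda>\<xi>. iexp (h * \<xi>) * F \<xi>) \<in> Lp 2" by (simp add: mult_ac)
  moreover have "AE \<xi> in lborel. \<xi> < 0 \<longrightarrow> iexp (h * \<xi>) * F \<xi> = 0"
    using s by eventually_elim simp
  ultimately show ?thesis
    using H1_plus_iff_fourier[OF L2_shift[OF fL] has_fourier_shift[OF fL F]] by simp
qed

lemma l2norm_weak_deriv_shift:
  assumes f: "f \<in> H1_plus" shows "l2norm (weak_deriv (\<lambda>x. f (x + h))) = l2norm (weak_deriv f)"
proof -
  note fL = H1_plus_L2[OF f]
  obtain F where F: "has_fourier_L2 f F" using has_fourier_exists fL by blast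
  have "l2norm (xmult (\<lambda>\<xi>. iexp (h * \<xi>) * F \<xi>)) = l2norm (xmult F)"
    unfolding l2norm_def norm_mult norm_kernel by simp
  then have "sqrt (2 * pi) * l2norm (weak_deriv (\<lambda>x. f (x + h))) = sqrt (2 * pi) * l2norm (weak_deriv f)"
    using l2norm_weak_deriv[OF H1_plus_H1[OF f] F]
      l2norm_weak_deriv[OF H1_plus_H1[OF H1_plus_shift[OF f]] has_fourier_shift[OF fL F]] by metis
  then show ?thesis by simp
qed

lemma l2norm_abs_D_half_shift:
  assumes f: "f \<in> H1_plus" shows "l2norm (abs_D (1/2) (\<lambda>x. f (x + h))) = l2norm (abs_D (1/2) f)"
proof -
  note fL = H1_plus_L2[OF f]
  obtain F where F: "has_fourier_L2 f F" using has_fourier_exists fL by blast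
  define e where "e \<xi> = iexp (h * \<xi>)" for \<xi>
  have e: "e \<xi> * cnj (e \<xi>) = 1" for \<xi>
    using complex_norm_square[of "e \<xi>"] by (simp add: e_def)
  have eq: "xmult (\<lambda>\<xi>. e \<xi> * F \<xi>) \<xi> * cnj (e \<xi> * F \<xi>) = xmult F \<xi> * cnj (F \<xi>)" for \<xi>
  proof -
    have "xmult (\<lambda>\<xi>. e \<xi> * F \<xi>) \<xi> * cnj (e \<xi> * F \<xi>) = (e \<xi> * cnj (e \<xi>)) * (xmult F \<xi> * cnj (F \<xi>))"
      by (simp only: complex_cnj_mult mult_ac)
    then show ?thesis unfolding e by simp
  qed
  then have "l2inner (xmult (\<lambda>\<xi>. e \<xi> * F \<xi>)) (\<lambda>\<xi>. e \<xi> * F \<xi>) = l2inner (xmult F) F"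
    unfolding l2inner_def by (intro Bochner_Integration.integral_cong refl)
  then have "2 * pi * (l2norm (abs_D (1/2) (\<lambda>x. f (x + h))))\<^sup>2 = 2 * pi * (l2norm (abs_D (1/2) f))\<^sup>2"
    using l2norm_abs_D_half[OF f F] l2norm_abs_D_half[OF H1_plus_shift[OF f] has_fourier_shift[OF fL F]]
    unfolding e_def by simp
  then have "(l2norm (abs_D (1/2) (\<lambda>x. f (x + h))))\<^sup>2 = (l2norm (abs_D (1/2) f))\<^sup>2" by simp
  then show ?thesis by (rule power2_eq_imp_eq) auto
qed

section \<open>Continuous representatives with a common modulus of continuity\<close>

definition sobolev_kernel :: "real \<Rightarrow> complex" where
  "sobolev_kernel \<xi> = complex_of_real (1 / sqrt (1 + \<xi>\<^sup>2))"

definition sobolev_norm :: "(real \<Rightarrow> complex) \<Rightarrow> real" where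
  "sobolev_norm F = sqrt ((l2norm F)\<^sup>2 + (l2norm (xmult F))\<^sup>2)"

text \<open>The L2 distance between the kernel and its modulation by \<open>h\<close>: a modulus of
  continuity valid simultaneously for all functions with a bounded
  \<open>sobolev_norm\<close>.\<close>

definition sobolev_modulus :: "real \<Rightarrow> real" where
  "sobolev_modulus h = l2norm (\<lambda>\<xi>. (iexp (h * \<xi>) - 1) * sobolev_kernel \<xi>)"

text \<open>The inversion integral, written through \<open>ft\<close> and conjugation to match
  \<open>has_fourier_inverse\<close>. For integrable \<open>F\<close> it is an absolutely convergent
  integral at every point, so it singles out a definite function within its almost everywhere
  class.\<close>

definition ift :: "(real \<Rightarrow> complex) \<Rightarrow> real \<Rightarrow> complex" where
  "ift F x = complex_of_real (1 / (2 * pi)) * cnj (ft (\<lambda>\<xi>. cnj (F \<xi>)) x)"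

lemma sobolev_kernel_measurable[measurable]: "sobolev_kernel \<in> borel_measurable borel"
  unfolding sobolev_kernel_def[abs_def] by measurable

lemma sobolev_kernel_L2: "sobolev_kernel \<in> Lp 2"
  unfolding Lp_2_iff
proof
  have "(\<lambda>\<xi>. (cmod (sobolev_kernel \<xi>))\<^sup>2) = (\<lambda>\<xi>. inverse (1 + \<xi>\<^sup>2))"
    by (auto simp: sobolev_kernel_def norm_divide power_divide inverse_eq_divide)
  moreover have "integrable lborel (\<lambda>\<xi>::real. inverse (1 + \<xi>\<^sup>2))"
    using integrable_inverse_1_plus_square by (simp add: set_integrable_def)
  ultimately show "integrable lborel (\<lambda>\<xi>. (cmod (sobolev_kernel \<xi>))\<^sup>2)" by simp
qed simp

lemma sobolev_weight:
  assumes F: "F \<in> Lp 2" and x: "xmult F \<in> Lp 2"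
  shows "(\<lambda>\<xi>. complex_of_real (sqrt (1 + \<xi>\<^sup>2)) * F \<xi>) \<in> Lp 2"
    and "l2norm (\<lambda>\<xi>. complex_of_real (sqrt (1 + \<xi>\<^sup>2)) * F \<xi>) = sobolev_norm F"
proof -
  note F[THEN L2_measurable, measurable]
  have eq: "(cmod (complex_of_real (sqrt (1 + \<xi>\<^sup>2)) * F \<xi>))\<^sup>2 = (cmod (F \<xi>))\<^sup>2 + (cmod (xmult F \<xi>))\<^sup>2" for \<xi>
    by (simp add: norm_mult power_mult_distrib algebra_simps)
  show "(\<lambda>\<xi>. complex_of_real (sqrt (1 + \<xi>\<^sup>2)) * F \<xi>) \<in> Lp 2"
    unfolding Lp_2_iff eq using L2_integrable_sq[OF F] L2_integrable_sq[OF x] by auto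
  show "l2norm (\<lambda>\<xi>. complex_of_real (sqrt (1 + \<xi>\<^sup>2)) * F \<xi>) = sobolev_norm F"
    unfolding l2norm_def[of "\<lambda>\<xi>. complex_of_real (sqrt (1 + \<xi>\<^sup>2)) * F \<xi>"] eq sobolev_norm_def l2norm_sq
    using L2_integrable_sq[OF F] L2_integrable_sq[OF x] by simp
qed

lemma sobolev_factor: "F \<xi> = sobolev_kernel \<xi> * (complex_of_real (sqrt (1 + \<xi>\<^sup>2)) * F \<xi>)"
proof -
  have "1 + \<xi>\<^sup>2 > 0" by (simp add: add_pos_nonneg)
  then have "complex_of_real (1 / sqrt (1 + \<xi>\<^sup>2)) * complex_of_real (sqrt (1 + \<xi>\<^sup>2)) = 1"
    unfolding of_real_mult[symmetric] by (simp del: of_real_mult)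
  then show ?thesis by (simp only: sobolev_kernel_def mult.assoc[symmetric] mult_1)
qed

lemma sobolev_integrable:
  assumes F: "F \<in> Lp 2" and x: "xmult F \<in> Lp 2"
  shows "integrable lborel F"
  using L2_mult_integrable[OF sobolev_kernel_L2 sobolev_weight(1)[OF F x]] sobolev_factor[of F] by simp

lemma ift_eq: "ift F x = complex_of_real (1 / (2 * pi)) * (LINT \<xi>|lborel. iexp (x * \<xi>) * F \<xi>)"
  unfolding ift_def ft_def Bochner_Integration.integral_cnj[symmetric] by (simp add: exp_cnj mult_ac)

lemma ift_representative:
  assumes f: "f \<in> Lp 2" and F: "has_fourier_L2 f F" and x: "xmult F \<in> Lp 2"
  shows "AE t in lborel. f t = ift F t"
proof -
  note FL = has_fourier_L2_L2[OF F]
  have i: "integrable lborel (\<lambda>\<xi>. cnj (F \<xi>))" using sobolev_integrable[OF FL x] by simp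
  have h: "has_fourier_L2 (\<lambda>t. ift F t) F"
    unfolding ift_def by (rule has_fourier_inverse[OF FL has_fourier_L1[OF i L2_cnj[OF FL]]])
  have "ft (\<lambda>\<xi>. cnj (F \<xi>)) \<in> Lp 2" using Plancherel_L1_L2(1)[OF i L2_cnj[OF FL]] .
  then have "ift F \<in> Lp 2" unfolding ift_def[abs_def] by (intro L2_cmult L2_cnj)
  from has_fourier_inj[OF f this F h] show ?thesis .
qed

text \<open>Writing \<open>F\<close> as \<open>sobolev_kernel\<close> times the weighted
  \<open>W\<close>, both estimates are Cauchy-Schwarz, with all dependence on the points kept on the
  kernel. Square integrability of the kernel is where dimension one enters. The factor
  \<open>1 / (2 * pi)\<close> is simply bounded by 1.\<close>

lemma ift_bound:
  assumes F: "F \<in> Lp 2" and x: "xmult F \<in> Lp 2"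
  shows "cmod (ift F t) \<le> l2norm sobolev_kernel * sobolev_norm F"
    and "cmod (ift F t - ift F s) \<le> sobolev_modulus (t - s) * sobolev_norm F"
proof -
  define W where "W \<xi> = complex_of_real (sqrt (1 + \<xi>\<^sup>2)) * F \<xi>" for \<xi>
  have W: "W \<in> Lp 2" "l2norm W = sobolev_norm F" using sobolev_weight[OF F x] by (simp_all add: W_def[abs_def])
  have FW: "F \<xi> = sobolev_kernel \<xi> * W \<xi>" for \<xi> unfolding W_def by (rule sobolev_factor)
  have pi1: "cmod (complex_of_real (1 / (2 * pi)) * z) \<le> cmod z" for z
  proof -
    have "0 \<le> 1 / (2 * pi)" "1 / (2 * pi) \<le> 1" using pi_gt3 by auto
    then show ?thesis unfolding norm_mult norm_of_real by (intro mult_left_le_one_le) auto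
  qed
  have int: "integrable lborel (\<lambda>\<xi>. iexp (t * \<xi>) * F \<xi>)" for t
    by (rule Bochner_Integration.integrable_bound[OF sobolev_integrable[OF F x]])
      (use L2_measurable[OF F] in \<open>auto simp: norm_mult\<close>)
  have "cmod (ift F t) \<le> cmod (LINT \<xi>|lborel. iexp (t * \<xi>) * F \<xi>)"
    unfolding ift_eq by (rule pi1)
  also have "\<dots> \<le> (LINT \<xi>|lborel. cmod (sobolev_kernel \<xi>) * cmod (W \<xi>))"
    by (rule order_trans[OF integral_norm_bound]) (simp add: norm_mult FW)
  also have "\<dots> \<le> l2norm sobolev_kernel * sobolev_norm F"
    using L2_Cauchy_Schwarz[OF sobolev_kernel_L2 W(1)] W(2) by simp
  finally show "cmod (ift F t) \<le> l2norm sobolev_kernel * sobolev_norm F" .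
  define E where "E \<xi> = (iexp ((t - s) * \<xi>) - 1) * sobolev_kernel \<xi>" for \<xi>
  have EL: "E \<in> Lp 2"
  proof -
    have "cmod (iexp ((t - s) * \<xi>) - 1) \<le> 2" for \<xi>
      using norm_triangle_ineq4[of "iexp ((t - s) * \<xi>)" 1] by (simp only: norm_kernel norm_one)
    then show ?thesis unfolding E_def[abs_def]
      by (intro L2_bounded_mult[OF sobolev_kernel_L2]) auto
  qed
  have "ift F t - ift F s = complex_of_real (1 / (2 * pi)) * (LINT \<xi>|lborel. iexp (t * \<xi>) * F \<xi> - iexp (s * \<xi>) * F \<xi>)"
    unfolding ift_eq using int by (simp add: right_diff_distrib)
  also have "cmod \<dots> \<le> cmod (LINT \<xi>|lborel. iexp (t * \<xi>) * F \<xi> - iexp (s * \<xi>) * F \<xi>)"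
    by (rule pi1)
  also have "(\<lambda>\<xi>. iexp (t * \<xi>) * F \<xi> - iexp (s * \<xi>) * F \<xi>)
     = (\<lambda>\<xi>. iexp (s * \<xi>) * (E \<xi> * W \<xi>))"
  proof
    fix \<xi>
    have "iexp (t * \<xi>) = iexp (s * \<xi>) * iexp ((t - s) * \<xi>)"
      unfolding exp_add[symmetric] by (simp add: algebra_simps)
    then show "iexp (t * \<xi>) * F \<xi> - iexp (s * \<xi>) * F \<xi> = iexp (s * \<xi>) * (E \<xi> * W \<xi>)"
      unfolding E_def FW by (simp add: algebra_simps)
  qed
  also have "cmod (LINT \<xi>|lborel. iexp (s * \<xi>) * (E \<xi> * W \<xi>)) \<le> (LINT \<xi>|lborel. cmod (E \<xi>) * cmod (W \<xi>))"
    by (rule order_trans[OF integral_norm_bound]) (simp add: norm_mult)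
  also have "\<dots> \<le> sobolev_modulus (t - s) * sobolev_norm F"
    using L2_Cauchy_Schwarz[OF EL W(1)] W(2) by (simp add: sobolev_modulus_def E_def[abs_def])
  finally show "cmod (ift F t - ift F s) \<le> sobolev_modulus (t - s) * sobolev_norm F" .
qed

lemma sobolev_modulus_tendsto: assumes "h \<longlonglongrightarrow> 0" shows "(\<lambda>n. sobolev_modulus (h n)) \<longlonglongrightarrow> 0"
  unfolding sobolev_modulus_def
proof (rule l2norm_dominated)
  show "(\<lambda>\<xi>. 2 * sobolev_kernel \<xi>) \<in> Lp 2" by (intro L2_cmult sobolev_kernel_L2)
  show "AE \<xi> in lborel. (\<lambda>n. (iexp (h n * \<xi>) - 1) * sobolev_kernel \<xi>) \<longlonglongrightarrow> 0"
  proof (rule AE_I2)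
    fix \<xi>
    have "(\<lambda>n. (iexp (h n * \<xi>) - 1) * sobolev_kernel \<xi>) \<longlonglongrightarrow> (iexp (0 * \<xi>) - 1) * sobolev_kernel \<xi>"
      by (intro tendsto_intros assms)
    then show "(\<lambda>n. (iexp (h n * \<xi>) - 1) * sobolev_kernel \<xi>) \<longlonglongrightarrow> 0" by simp
  qed
  show "AE \<xi> in lborel. cmod ((iexp (h n * \<xi>) - 1) * sobolev_kernel \<xi>) \<le> cmod (2 * sobolev_kernel \<xi>)" for n
  proof (rule AE_I2)
    fix \<xi>
    have "cmod (iexp (h n * \<xi>) - 1) \<le> 2"
      using norm_triangle_ineq4[of "iexp (h n * \<xi>)" 1] by (simp only: norm_kernel norm_one)
    then show "cmod ((iexp (h n * \<xi>) - 1) * sobolev_kernel \<xi>) \<le> cmod (2 * sobolev_kernel \<xi>)"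
      unfolding norm_mult by (intro mult_right_mono) auto
  qed
qed measurable

section \<open>Weak limits\<close>

text \<open>Replacing \<open>h\<close> by a truncation makes \<open>M * cmod (t x)\<close> an
  integrable majorant, and the discarded tail costs at most \<open>C\<close> times its norm. The
  moduli stand inside the integral because the splitting of the mass needs this stronger form of
  weak convergence.\<close>

lemma pairing_tendsto_0:
  assumes r: "\<And>n. r n \<in> Lp 2" and C: "\<And>n. l2norm (r n) \<le> C"
    and M: "\<And>n::nat. AE x in lborel. cmod (r n x) \<le> M"
    and lim: "AE x in lborel. (\<lambda>n. r n x) \<longlonglongrightarrow> 0" and h: "h \<in> Lp 2"
  shows "(\<lambda>n. LINT x|lborel. cmod (r n x) * cmod (h x)) \<longlonglongrightarrow> 0"
proof (rule LIMSEQ_I)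
  fix e :: real assume e: "e > 0"
  have [measurable]: "r n \<in> borel_measurable borel" "h \<in> borel_measurable borel" for n
    using L2_measurable[OF r] L2_measurable[OF h] by auto
  have C0: "C \<ge> 0" using C[of 0] l2norm_nonneg[of "r 0"] by linarith
  \<comment> \<open>\<open>C + 1\<close> rather than \<open>C\<close> covers the case
    \<open>C = 0\<close>.\<close>
  have "e / (2 * (C + 1)) > 0" using e C0 by simp
  from LIMSEQ_D[OF trunc_lim_seq[OF h] this] obtain K :: nat
    where K: "l2norm (\<lambda>x. trunc (real K) h x - h x) < e / (2 * (C + 1))" by auto
  define t where "t = trunc (real K) h"
  have t: "t \<in> Lp 2" "integrable lborel t" unfolding t_def using trunc_L2[OF h] trunc_integrable[OF h] by auto
  have [measurable]: "t \<in> borel_measurable borel" using t by auto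
  have "(\<lambda>n. LINT x|lborel. cmod (r n x) * cmod (t x)) \<longlonglongrightarrow> (LINT x::real|lborel. 0)"
  proof (rule integral_dominated_convergence[where w="\<lambda>x. M * cmod (t x)"])
    show "AE x in lborel. (\<lambda>n. cmod (r n x) * cmod (t x)) \<longlonglongrightarrow> 0"
      using lim
    proof eventually_elim
      case (elim x)
      from tendsto_mult_right[OF tendsto_norm[OF elim], of "cmod (t x)"] show ?case by simp
    qed
    show "AE x in lborel. norm (cmod (r n x) * cmod (t x)) \<le> M * cmod (t x)" for n
      using M[of n] by eventually_elim (simp add: mult_right_mono)
    show "integrable lborel (\<lambda>x. M * cmod (t x))" using t by auto
  qed measurable
  then have "(\<lambda>n. LINT x|lborel. cmod (r n x) * cmod (t x)) \<longlonglongrightarrow> 0" by simp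
  from LIMSEQ_D[OF this, of "e/2"] e obtain N where N: "\<And>n. n \<ge> N \<Longrightarrow> \<bar>LINT x|lborel. cmod (r n x) * cmod (t x)\<bar> < e / 2"
    by auto
  have "norm ((LINT x|lborel. cmod (r n x) * cmod (h x)) - 0) < e" if "n \<ge> N" for n
  proof -
    have ht: "(\<lambda>x. t x - h x) \<in> Lp 2" using t h by auto
    have "(LINT x|lborel. cmod (r n x) * cmod (h x)) \<le> (LINT x|lborel. cmod (r n x) * cmod (t x) + cmod (r n x) * cmod (t x - h x))"
    proof (rule integral_mono)
      show "integrable lborel (\<lambda>x. cmod (r n x) * cmod (h x))"
        by (rule L2_norm_mult_integrable[OF r h])
      show "integrable lborel (\<lambda>x. cmod (r n x) * cmod (t x) + cmod (r n x) * cmod (t x - h x))"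
        by (intro Bochner_Integration.integrable_add L2_norm_mult_integrable r t ht)
      fix x
      have "cmod (h x) \<le> cmod (t x) + cmod (t x - h x)"
        using norm_triangle_ineq4[of "t x" "t x - h x"] by simp
      then show "cmod (r n x) * cmod (h x) \<le> cmod (r n x) * cmod (t x) + cmod (r n x) * cmod (t x - h x)"
        unfolding distrib_left[symmetric] by (rule mult_left_mono) simp
    qed
    also have "\<dots> = (LINT x|lborel. cmod (r n x) * cmod (t x)) + (LINT x|lborel. cmod (r n x) * cmod (t x - h x))"
      by (intro Bochner_Integration.integral_add L2_norm_mult_integrable r t ht)
    also have "(LINT x|lborel. cmod (r n x) * cmod (t x - h x)) \<le> C * (e / (2 * (C + 1)))"
      using L2_Cauchy_Schwarz[OF r ht, of n] mult_mono[OF C[of n] less_imp_le[OF K] C0 l2norm_nonneg]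
      by (simp add: t_def)
    also have "C * (e / (2 * (C + 1))) \<le> e / 2" using C0 e by (simp add: field_simps)
    finally have "(LINT x|lborel. cmod (r n x) * cmod (h x)) < e" using N[OF that] by linarith
    moreover have "(LINT x|lborel. cmod (r n x) * cmod (h x)) \<ge> 0" by simp
    ultimately show ?thesis by simp
  qed
  then show "\<exists>no. \<forall>n\<ge>no. norm ((LINT x|lborel. cmod (r n x) * cmod (h x)) - 0) < e" by blast
qed

definition weakly_null :: "(nat \<Rightarrow> real \<Rightarrow> complex) \<Rightarrow> bool" where
  "weakly_null r \<longleftrightarrow> (\<forall>n. r n \<in> Lp 2) \<and> (\<forall>h\<in>Lp 2. (\<lambda>n. l2inner (r n) h) \<longlonglongrightarrow> 0)"

lemma weakly_nullI_pointwise: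
  assumes r: "\<And>n. r n \<in> Lp 2" and "\<And>n. l2norm (r n) \<le> C"
    and "\<And>n::nat. AE x in lborel. cmod (r n x) \<le> M"
    and "AE x in lborel. (\<lambda>n. r n x) \<longlonglongrightarrow> 0"
  shows "weakly_null r"
  unfolding weakly_null_def
proof (intro conjI allI ballI r)
  fix h assume h: "h \<in> Lp 2"
  show "(\<lambda>n. l2inner (r n) h) \<longlonglongrightarrow> 0"
  proof (rule Lim_null_comparison[OF _ pairing_tendsto_0[OF assms h]])
    have "cmod (l2inner (r n) h) \<le> (LINT x|lborel. cmod (r n x) * cmod (h x))" for n
      unfolding l2inner_def by (rule order_trans[OF integral_norm_bound]) (simp add: norm_mult)
    then show "\<forall>\<^sub>F n in sequentially. norm (l2inner (r n) h) \<le> (LINT x|lborel. cmod (r n x) * cmod (h x))" by simp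
  qed
qed

text \<open>Every test function on the frequency side is itself a transform, so Parseval transports
  the pairings.\<close>

lemma weakly_null_fourier:
  assumes w: "weakly_null r" and R: "\<And>n. has_fourier_L2 (r n) (R n)"
  shows "weakly_null R"
  unfolding weakly_null_def
proof (intro conjI allI ballI)
  have r: "r n \<in> Lp 2" for n using w by (simp add: weakly_null_def)
  show "R n \<in> Lp 2" for n by (rule has_fourier_L2_L2[OF R])
  fix H assume H: "H \<in> Lp 2"
  obtain h where h: "h \<in> Lp 2" "has_fourier_L2 h H" using has_fourier_surj[OF H] by blast
  have "(\<lambda>n. complex_of_real (2 * pi) * l2inner (r n) h) \<longlonglongrightarrow> complex_of_real (2 * pi) * 0"
    using w h by (intro tendsto_mult tendsto_const) (simp add: weakly_null_def)
  then show "(\<lambda>n. l2inner (R n) H) \<longlonglongrightarrow> 0"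
    using has_fourier_inner[OF r h(1) R h(2)] by simp
qed

lemma xmult_trunc_L2: assumes "H \<in> Lp 2" shows "xmult (trunc K H) \<in> Lp 2"
proof -
  have "(\<lambda>\<xi>. (complex_of_real \<xi> * indicator {-K..K} \<xi>) * H \<xi>) \<in> Lp 2"
    by (rule L2_bounded_mult[OF assms, where B="\<bar>K\<bar>"]) (auto simp: norm_mult indicator_def)
  then show ?thesis by (simp add: trunc_def mult_ac)
qed

lemma xmult_trunc: "xmult (trunc K H) = trunc K (xmult H)"
  by (auto simp: trunc_def)

lemma l2inner_xmult: "l2inner (xmult F) G = l2inner F (xmult G)"
  by (simp add: l2inner_def mult_ac)

text \<open>Multiplication by \<open>\<xi>\<close> is symmetric and can be moved onto a test
  function cut off in frequency, where it is bounded; the uniform bound \<open>C\<close> absorbs the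
  remaining tail.\<close>

lemma weakly_null_xmult:
  assumes w: "weakly_null R" and x: "\<And>n. xmult (R n) \<in> Lp 2" and C: "\<And>n. l2norm (xmult (R n)) \<le> C"
  shows "weakly_null (\<lambda>n. xmult (R n))"
  unfolding weakly_null_def
proof (intro conjI allI ballI x)
  fix H assume H: "H \<in> Lp 2"
  have C0: "C \<ge> 0" using C[of 0] l2norm_nonneg[of "xmult (R 0)"] by linarith
  show "(\<lambda>n. l2inner (xmult (R n)) H) \<longlonglongrightarrow> 0"
  proof (rule LIMSEQ_I)
    fix e :: real assume e: "e > 0"
    have "e / (2 * (C + 1)) > 0" using e C0 by simp
    from LIMSEQ_D[OF trunc_lim_seq[OF H] this] obtain K :: nat
      where K: "l2norm (\<lambda>x. trunc (real K) H x - H x) < e / (2 * (C + 1))" by auto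
    have "(\<lambda>n. l2inner (R n) (xmult (trunc (real K) H))) \<longlonglongrightarrow> 0"
      using w xmult_trunc_L2[OF H] by (simp add: weakly_null_def)
    from LIMSEQ_D[OF this, of "e/2"] e
    obtain N where N: "\<And>n. n \<ge> N \<Longrightarrow> cmod (l2inner (R n) (xmult (trunc (real K) H))) < e / 2" by auto
    have "norm (l2inner (xmult (R n)) H - 0) < e" if "n \<ge> N" for n
    proof -
      have TL: "trunc (real K) H \<in> Lp 2" by (rule trunc_L2[OF H])
      have "l2inner (xmult (R n)) H = l2inner (R n) (xmult (trunc (real K) H)) - l2inner (xmult (R n)) (\<lambda>x. trunc (real K) H x - H x)"
        unfolding l2inner_diff_right[OF TL H x] l2inner_xmult[of "R n"] by simp
      then have "cmod (l2inner (xmult (R n)) H) \<le> cmod (l2inner (R n) (xmult (trunc (real K) H))) + cmod (l2inner (xmult (R n)) (\<lambda>x. trunc (real K) H x - H x))"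
        using norm_triangle_ineq4 by metis
      moreover have "cmod (l2inner (xmult (R n)) (\<lambda>x. trunc (real K) H x - H x)) \<le> C * (e / (2 * (C + 1)))"
        using l2inner_le[OF x L2_diff[OF TL H], of n] mult_mono[OF C[of n] less_imp_le[OF K] C0 l2norm_nonneg] by linarith
      moreover have "C * (e / (2 * (C + 1))) \<le> e / 2" using C0 e by (simp add: field_simps)
      ultimately have "cmod (l2inner (xmult (R n)) H) < e" using N[OF that] by linarith
      then show ?thesis by simp
    qed
    then show "\<exists>no. \<forall>n\<ge>no. norm (l2inner (xmult (R n)) H - 0) < e" by blast
  qed
qed

text \<open>Membership is read off the transform \<open>V\<close> by duality: the vanishing on
  negative frequencies and the bound on \<open>xmult\<close> both survive weak convergence when the
  test function is built from \<open>V\<close>. Fatou removes the cutoff in the second case.\<close>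

lemma H1_plus_weak_limit:
  assumes g: "\<And>n. g n \<in> H1_plus" and C: "\<And>n. l2norm (weak_deriv (g n)) \<le> C" and U: "U \<in> Lp 2"
    and w: "weakly_null (\<lambda>n x. g n x - U x)"
  shows "U \<in> H1_plus"
proof -
  note gL = H1_plus_L2[OF g]
  obtain V where V: "has_fourier_L2 U V" using has_fourier_exists[OF U] by blast
  have "\<forall>n. \<exists>G. has_fourier_L2 (g n) G" using has_fourier_exists[OF gL] by blast
  then obtain G where G: "\<And>n. has_fourier_L2 (g n) (G n)" by metis
  note VL = has_fourier_L2_L2[OF V] and GL = has_fourier_L2_L2[OF G]
  note VL[THEN L2_measurable, measurable]
  have xG: "xmult (G n) \<in> Lp 2" and supp: "AE \<xi> in lborel. \<xi> < 0 \<longrightarrow> G n \<xi> = 0" for n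
    using H1_plus_iff_fourier[OF gL G] g by auto
  have C': "l2norm (xmult (G n)) \<le> sqrt (2 * pi) * C" for n
    unfolding l2norm_weak_deriv[OF H1_plus_H1[OF g] G, symmetric] by (intro mult_left_mono C) simp
  have w': "weakly_null (\<lambda>n \<xi>. G n \<xi> - V \<xi>)"
    by (rule weakly_null_fourier[OF w]) (rule has_fourier_diff[OF gL U G V])
  have lim: "(\<lambda>n. l2inner (G n) H) \<longlonglongrightarrow> l2inner V H" if H: "H \<in> Lp 2" for H
  proof -
    have "(\<lambda>n. l2inner (\<lambda>\<xi>. G n \<xi> - V \<xi>) H) \<longlonglongrightarrow> 0" using w' H by (simp add: weakly_null_def)
    then show ?thesis unfolding l2inner_diff_left[OF GL VL H] by (rule LIM_zero_cancel)
  qed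
  have "AE \<xi> in lborel. \<xi> < 0 \<longrightarrow> V \<xi> = 0"
  proof -
    \<comment> \<open>test the weak convergence with the negative frequency part of the limit itself\<close>
    define H where "H \<xi> = indicator {..<0} \<xi> * V \<xi>" for \<xi>
    have HL: "H \<in> Lp 2" unfolding H_def[abs_def] by (rule L2_indicator[OF VL]) auto
    note HL[THEN L2_measurable, measurable] GL[THEN L2_measurable, measurable]
    have "l2inner (G n) H = (LINT \<xi>::real|lborel. 0)" for n
      unfolding l2inner_def
      by (rule integral_cong_AE) (measurable, use supp[of n] in eventually_elim, auto simp: H_def indicator_def)
    then have "(\<lambda>n. 0) \<longlonglongrightarrow> l2inner V H" using lim[OF HL] by simp
    then have "l2inner V H = 0" using LIMSEQ_unique[OF _ tendsto_const] by metis
    moreover have "l2inner V H = l2inner H H"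
      unfolding l2inner_def by (intro Bochner_Integration.integral_cong refl) (auto simp: H_def indicator_def)
    ultimately have "l2norm H = 0" by (simp add: l2inner_self)
    then have "AE \<xi> in lborel. H \<xi> = 0" using l2norm_eq_0[OF HL] by simp
    then show ?thesis by eventually_elim (auto simp: H_def indicator_def)
  qed
  moreover have "xmult V \<in> Lp 2"
  proof (rule L2_Fatou(1))
    show "xmult (trunc (real K) V) \<in> Lp 2" for K by (rule xmult_trunc_L2[OF VL])
    show "l2norm (xmult (trunc (real K) V)) \<le> sqrt (2 * pi) * C" for K
    proof -
      \<comment> \<open>test with \<open>\<xi>\<^sup>2 V\<close> cut off at frequency \<open>K\<close>\<close>
      define T where "T = trunc (real K) V"
      have TL: "T \<in> Lp 2" unfolding T_def by (rule trunc_L2[OF VL])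
      have xT: "xmult T \<in> Lp 2" unfolding T_def by (rule xmult_trunc_L2[OF VL])
      have TT: "trunc (real K) T = T" by (auto simp: T_def trunc_def indicator_def)
      have xxT: "xmult (xmult T) \<in> Lp 2"
        using xmult_trunc_L2[OF xT, of "real K"] unfolding xmult_trunc[symmetric] TT .
      have "l2inner V (xmult (xmult T)) = l2inner (xmult T) (xmult T)"
        unfolding l2inner_def T_def by (intro Bochner_Integration.integral_cong refl) (auto simp: trunc_def indicator_def)
      then have "l2inner V (xmult (xmult T)) = complex_of_real ((l2norm (xmult T))\<^sup>2)" by (simp only: l2inner_self)
      then have "(\<lambda>n. cmod (l2inner (G n) (xmult (xmult T)))) \<longlonglongrightarrow> (l2norm (xmult T))\<^sup>2"
        using tendsto_norm[OF lim[OF xxT]] by (simp add: norm_power)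
      moreover have "cmod (l2inner (G n) (xmult (xmult T))) \<le> sqrt (2 * pi) * C * l2norm (xmult T)" for n
        using l2inner_le[OF xG xT, of n] mult_right_mono[OF C'[of n] l2norm_nonneg[of "xmult T"]]
        unfolding l2inner_xmult[of "G n"] by linarith
      ultimately have le: "(l2norm (xmult T))\<^sup>2 \<le> sqrt (2 * pi) * C * l2norm (xmult T)"
        by (intro LIMSEQ_le_const2) auto
      have C0: "sqrt (2 * pi) * C \<ge> 0" using C'[of 0] l2norm_nonneg[of "xmult (G 0)"] by linarith
      have "l2norm (xmult T) \<le> sqrt (2 * pi) * C"
      proof (cases "l2norm (xmult T) = 0")
        case False
        then have "l2norm (xmult T) > 0" using l2norm_nonneg[of "xmult T"] by linarith
        then show ?thesis using le unfolding power2_eq_square by (rule mult_right_le_imp_le[rotated])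
      qed (use C0 in simp)
      then show ?thesis by (simp add: T_def)
    qed
    show "AE x in lborel. (\<lambda>n. xmult (trunc (real n) V) x) \<longlonglongrightarrow> xmult V x"
    proof (rule AE_I2)
      fix x :: real
      obtain K :: nat where K: "\<bar>x\<bar> \<le> real K" using real_arch_simple by blast
      have "\<forall>\<^sub>F n in sequentially. xmult (trunc (real n) V) x = xmult V x"
        using eventually_ge_at_top[of K] by eventually_elim (use K in \<open>auto simp: trunc_def indicator_def\<close>)
      then show "(\<lambda>n. xmult (trunc (real n) V) x) \<longlonglongrightarrow> xmult V x" by (rule tendsto_eventually)
    qed
  qed measurable
  ultimately show ?thesis using H1_plus_iff_fourier[OF U V] by blast
qed

text \<open>On the transform side all three quantities are quadratic forms evaluated at
  \<open>R n + V\<close>. Their cross terms pair \<open>R n\<close> or \<open>xmult (R n)\<close>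
  with a fixed L2 function and hence vanish in the limit; the half-derivative has two of them, one
  of each kind.\<close>

lemma energy_splitting:
  assumes g: "\<And>n. g n \<in> H1_plus" and U: "U \<in> H1_plus" and w: "weakly_null (\<lambda>n x. g n x - U x)"
    and C: "\<And>n. l2norm (weak_deriv (g n)) \<le> C"
  shows "(\<lambda>n. (l2norm (g n))\<^sup>2 - (l2norm (\<lambda>x. g n x - U x))\<^sup>2) \<longlonglongrightarrow> (l2norm U)\<^sup>2"
    and "(\<lambda>n. (l2norm (weak_deriv (g n)))\<^sup>2 - (l2norm (weak_deriv (\<lambda>x. g n x - U x)))\<^sup>2) \<longlonglongrightarrow> (l2norm (weak_deriv U))\<^sup>2"
    and "(\<lambda>n. (l2norm (abs_D (1/2) (g n)))\<^sup>2 - (l2norm (abs_D (1/2) (\<lambda>x. g n x - U x)))\<^sup>2) \<longlonglongrightarrow> (l2norm (abs_D (1/2) U))\<^sup>2"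
proof -
  define r where "r n x = g n x - U x" for n x
  note gL = H1_plus_L2[OF g] and UL = H1_plus_L2[OF U]
  have r: "r n \<in> H1_plus" for n unfolding r_def[abs_def] by (rule H1_plus_diff[OF g U])
  note rL = H1_plus_L2[OF r]
  obtain V where V: "has_fourier_L2 U V" using has_fourier_exists[OF UL] by blast
  have "\<forall>n. \<exists>G. has_fourier_L2 (g n) G" using has_fourier_exists[OF gL] by blast
  then obtain G where G: "\<And>n. has_fourier_L2 (g n) (G n)" by metis
  define R where "R n \<xi> = G n \<xi> - V \<xi>" for n \<xi>
  have R: "has_fourier_L2 (r n) (R n)" for n
    unfolding R_def[abs_def] r_def[abs_def] by (rule has_fourier_diff[OF gL UL G V])
  note VL = has_fourier_L2_L2[OF V] and GL = has_fourier_L2_L2[OF G] and RL = has_fourier_L2_L2[OF R]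
  have xV: "xmult V \<in> Lp 2" using H1_plus_iff_fourier[OF UL V] U by auto
  have xG: "xmult (G n) \<in> Lp 2" for n using H1_plus_iff_fourier[OF gL G] g by auto
  have xR: "xmult (R n) \<in> Lp 2" for n using H1_plus_iff_fourier[OF rL R] r by auto
  have w: "weakly_null r" using w unfolding r_def[abs_def] .
  have wR: "weakly_null R" by (rule weakly_null_fourier[OF w R])
  have "l2norm (xmult (R n)) \<le> sqrt (2 * pi) * C + l2norm (xmult V)" for n
  proof -
    have "l2norm (xmult (R n)) \<le> l2norm (xmult (G n)) + l2norm (\<lambda>\<xi>. - xmult V \<xi>)"
      using l2norm_triangle[OF xG L2_uminus[OF xV], of n] by (simp add: R_def algebra_simps)
    moreover have "l2norm (xmult (G n)) \<le> sqrt (2 * pi) * C"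
      unfolding l2norm_weak_deriv[OF H1_plus_H1[OF g] G, symmetric] by (intro mult_left_mono C) simp
    moreover have "l2norm (\<lambda>\<xi>. - xmult V \<xi>) = l2norm (xmult V)" by (rule l2norm_uminus)
    ultimately show ?thesis by linarith
  qed
  then have wxR: "weakly_null (\<lambda>n. xmult (R n))" by (intro weakly_null_xmult[OF wR xR])
  have lim: "(\<lambda>n. Re (l2inner (q n) h)) \<longlonglongrightarrow> 0" if "weakly_null q" "h \<in> Lp 2" for q h
    using tendsto_Re[of "\<lambda>n. l2inner (q n) h" 0] that by (simp add: weakly_null_def)
  have "(l2norm (g n))\<^sup>2 - (l2norm (r n))\<^sup>2 = (l2norm U)\<^sup>2 + 2 * Re (l2inner (r n) U)" for n
    using l2norm_add_sq[OF rL UL, of n] by (simp add: r_def)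
  moreover have "(\<lambda>n. (l2norm U)\<^sup>2 + 2 * Re (l2inner (r n) U)) \<longlonglongrightarrow> (l2norm U)\<^sup>2 + 2 * 0"
    by (intro tendsto_intros lim w UL)
  ultimately show "(\<lambda>n. (l2norm (g n))\<^sup>2 - (l2norm (\<lambda>x. g n x - U x))\<^sup>2) \<longlonglongrightarrow> (l2norm U)\<^sup>2"
    unfolding r_def by simp
  have Gsum: "xmult (G n) = (\<lambda>\<xi>. xmult (R n) \<xi> + xmult V \<xi>)" "G n = (\<lambda>\<xi>. R n \<xi> + V \<xi>)" for n
    by (auto simp: R_def algebra_simps)
  have cancel: "(\<lambda>n. a n - b n) \<longlonglongrightarrow> c" if "\<And>n. 2 * pi * a n - 2 * pi * b n = 2 * pi * c + d n" "d \<longlonglongrightarrow> 0" for a b d :: "nat \<Rightarrow> real" and c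
  proof -
    have "a n - b n = c + 1 / (2 * pi) * d n" for n using that(1)[of n] by (simp add: field_simps)
    moreover have "(\<lambda>n. c + 1 / (2 * pi) * d n) \<longlonglongrightarrow> c + 1 / (2 * pi) * 0" by (intro tendsto_intros that(2))
    ultimately show ?thesis by simp
  qed
  have wd: "2 * pi * (l2norm (weak_deriv h))\<^sup>2 = (l2norm (xmult H))\<^sup>2" if "h \<in> H1_plus" "has_fourier_L2 h H" for h H
    unfolding l2norm_weak_deriv[OF H1_plus_H1[OF that(1)] that(2), symmetric] by (simp add: power_mult_distrib)
  have "(\<lambda>n. (l2norm (weak_deriv (g n)))\<^sup>2 - (l2norm (weak_deriv (r n)))\<^sup>2) \<longlonglongrightarrow> (l2norm (weak_deriv U))\<^sup>2"
  proof (rule cancel)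
    show "2 * pi * (l2norm (weak_deriv (g n)))\<^sup>2 - 2 * pi * (l2norm (weak_deriv (r n)))\<^sup>2 =
      2 * pi * (l2norm (weak_deriv U))\<^sup>2 + 2 * Re (l2inner (xmult (R n)) (xmult V))" for n
      unfolding wd[OF g G] wd[OF r R] wd[OF U V] Gsum(1) l2norm_add_sq[OF xR xV] by simp
    show "(\<lambda>n. 2 * Re (l2inner (xmult (R n)) (xmult V))) \<longlonglongrightarrow> 0"
      by (intro tendsto_mult_right_zero lim wxR xV)
  qed
  then show "(\<lambda>n. (l2norm (weak_deriv (g n)))\<^sup>2 - (l2norm (weak_deriv (\<lambda>x. g n x - U x)))\<^sup>2) \<longlonglongrightarrow> (l2norm (weak_deriv U))\<^sup>2"
    unfolding r_def .
  have "(\<lambda>n. (l2norm (abs_D (1/2) (g n)))\<^sup>2 - (l2norm (abs_D (1/2) (r n)))\<^sup>2) \<longlonglongrightarrow> (l2norm (abs_D (1/2) U))\<^sup>2"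
  proof (rule cancel)
    show "2 * pi * (l2norm (abs_D (1/2) (g n)))\<^sup>2 - 2 * pi * (l2norm (abs_D (1/2) (r n)))\<^sup>2 =
      2 * pi * (l2norm (abs_D (1/2) U))\<^sup>2 + (Re (l2inner (xmult (R n)) V) + Re (l2inner (R n) (xmult V)))" for n
    proof -
      have "l2inner (xmult (G n)) (G n) = l2inner (xmult (R n)) (G n) + l2inner (xmult V) (G n)"
        unfolding Gsum(1) by (rule l2inner_add_left[OF xR xV GL])
      moreover have "l2inner (xmult (R n)) (G n) = cnj (l2inner (R n) (xmult (R n)) + l2inner V (xmult (R n)))"
        unfolding l2inner_commute[of "xmult (R n)"] Gsum(2)[of n] l2inner_add_left[OF RL VL xR] ..
      moreover have "l2inner (xmult V) (G n) = cnj (l2inner (R n) (xmult V) + l2inner V (xmult V))"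
        unfolding l2inner_commute[of "xmult V"] Gsum(2)[of n] l2inner_add_left[OF RL VL xV] ..
      moreover have "Re (l2inner V (xmult (R n))) = Re (l2inner (xmult (R n)) V)"
        by (subst l2inner_commute) simp
      moreover have "l2inner V (xmult V) = l2inner (xmult V) V" "l2inner (R n) (xmult (R n)) = l2inner (xmult (R n)) (R n)"
        by (rule l2inner_xmult[symmetric])+
      ultimately show ?thesis
        unfolding l2norm_abs_D_half[OF g G] l2norm_abs_D_half[OF r R] l2norm_abs_D_half[OF U V] by simp
    qed
    have "(\<lambda>n. Re (l2inner (xmult (R n)) V) + Re (l2inner (R n) (xmult V))) \<longlonglongrightarrow> 0 + 0"
      by (intro tendsto_add lim wxR wR xV VL)
    then show "(\<lambda>n. Re (l2inner (xmult (R n)) V) + Re (l2inner (R n) (xmult V))) \<longlonglongrightarrow> 0" by simp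
  qed
  then show "(\<lambda>n. (l2norm (abs_D (1/2) (g n)))\<^sup>2 - (l2norm (abs_D (1/2) (\<lambda>x. g n x - U x)))\<^sup>2) \<longlonglongrightarrow> (l2norm (abs_D (1/2) U))\<^sup>2"
    unfolding r_def .
qed

text \<open>Cauchy-Schwarz for \<open>l2inner (xmult F) F\<close>. It bounds the half-derivatives
  along the sequence and later makes those of the remainders tend to 0 even when
  \<open>\<gamma> = 0\<close>.\<close>

lemma abs_D_half_interpolation:
  assumes f: "f \<in> H1_plus"
  shows "(l2norm (abs_D (1/2) f))\<^sup>2 \<le> l2norm (weak_deriv f) * l2norm f"
proof -
  note fL = H1_plus_L2[OF f]
  obtain F where F: "has_fourier_L2 f F" using has_fourier_exists[OF fL] by blast
  have x: "xmult F \<in> Lp 2" using H1_plus_iff_fourier[OF fL F] f by auto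
  have "2 * pi * (l2norm (abs_D (1/2) f))\<^sup>2 \<le> l2norm (xmult F) * l2norm F"
    unfolding l2norm_abs_D_half[OF f F]
    by (rule order_trans[OF complex_Re_le_cmod l2inner_le[OF x has_fourier_L2_L2[OF F]]])
  also have "\<dots> = (sqrt (2 * pi) * l2norm (weak_deriv f)) * (sqrt (2 * pi) * l2norm f)"
    unfolding l2norm_weak_deriv[OF H1_plus_H1[OF f] F] has_fourier_norm[OF fL F] ..
  also have "\<dots> = 2 * pi * (l2norm (weak_deriv f) * l2norm f)"
    using real_sqrt_mult_self[of "2 * pi"] by (simp only: mult.commute mult.left_commute) simp
  finally show ?thesis by simp
qed

section \<open>The Gagliardo-Nirenberg functional\<close>

text \<open>The mean value theorem with monotonicity of the derivative; \<open>x = 0\<close> is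
  treated apart because the derivative of a real power is used only at a positive base.\<close>

lemma powr_diff_le:
  fixes x y p :: real
  assumes "0 \<le> x" "x \<le> y" "p \<ge> 1"
  shows "y powr p - x powr p \<le> p * y powr (p - 1) * (y - x)"
proof (cases "x = 0")
  case True
  then show ?thesis
  proof (cases "y = 0")
    case False
    then have y: "y > 0" using assms True by simp
    have "y powr (p - 1) * y = y powr p" using powr_mult_base[of y "p - 1"] y by (simp add: mult.commute)
    then have "p * y powr (p - 1) * (y - x) = p * y powr p" unfolding True by (metis diff_zero mult.assoc)
    moreover have "1 * y powr p \<le> p * y powr p" by (rule mult_right_mono) (use assms in auto)
    ultimately have "y powr p \<le> p * y powr (p - 1) * (y - x)" by linarith
    then show ?thesis using True by simp
  qed simp
next
  case False
  then have x: "x > 0" using assms by simp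
  show ?thesis
  proof (cases "x = y")
    case False
    then have xy: "x < y" using assms by simp
    have "((\<lambda>t. t powr p) has_real_derivative p * t powr (p - 1)) (at t)" if "x \<le> t" for t
      using has_real_derivative_powr[of t p] that x by simp
    from MVT2[OF xy this] obtain z where z: "x < z" "z < y" "y powr p - x powr p = (y - x) * (p * z powr (p - 1))"
      by auto
    have "z powr (p - 1) \<le> y powr (p - 1)" using z x assms by (intro powr_mono2) auto
    then have "(y - x) * (p * z powr (p - 1)) \<le> (y - x) * (p * y powr (p - 1))"
      using xy assms by (intro mult_left_mono) auto
    then show ?thesis using z(3) by (simp add: mult_ac)
  qed simp
qed

text \<open>Each summand satisfies \<open>t powr p \<le> t * (x + y) powr (p - 1)\<close>; adding
  the two bounds gives the claim.\<close>

lemma powr_superadditive: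
  fixes x y p :: real
  assumes "x \<ge> 0" "y \<ge> 0" "p \<ge> 1"
  shows "x powr p + y powr p \<le> (x + y) powr p"
proof (cases "x + y = 0")
  case True
  then show ?thesis using assms by (simp add: add_nonneg_eq_0_iff)
next
  case False
  then have s: "x + y > 0" using assms by simp
  have le: "t powr p \<le> t * (x + y) powr (p - 1)" if "0 \<le> t" "t \<le> x + y" for t
  proof (cases "t = 0")
    case False
    then have t: "t > 0" using that by simp
    have "t powr p = t * t powr (p - 1)" using powr_mult_base[of t "p - 1"] t by simp
    also have "\<dots> \<le> t * (x + y) powr (p - 1)" using that assms by (intro mult_left_mono powr_mono2) auto
    finally show ?thesis .
  qed simp
  have "x powr p + y powr p \<le> (x + y) * (x + y) powr (p - 1)"
    using le[of x] le[of y] assms by (simp add: distrib_right)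
  also have "\<dots> = (x + y) powr p" using powr_mult_base[of "x + y" "p - 1"] s by simp
  finally show ?thesis .
qed

text \<open>With \<open>a \<ge> b\<close> the two moduli in order, everything is measured by
  \<open>k = a powr (p - 1) * b\<close>, which is at most \<open>M powr (p - 2) * (a * b)\<close>.
  The excess above is at most \<open>p * 2 powr (p - 1) * k\<close> since
  \<open>a + b \<le> 2 * a\<close>, the defect below at most \<open>(p + 1) * k\<close>; the
  constant is the sum of both.\<close>

lemma Brezis_Lieb_pointwise:
  fixes z w :: complex
  assumes p: "p \<ge> 2" and zM: "cmod z \<le> M" and wM: "cmod w \<le> M"
  shows "\<bar>cmod (z + w) powr p - cmod z powr p - cmod w powr p\<bar> \<le> (p * 2 powr (p - 1) + p + 1) * M powr (p - 2) * (cmod z * cmod w)"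
proof -
  have main: "\<bar>c powr p - a powr p - b powr p\<bar> \<le> (p * 2 powr (p - 1) + p + 1) * M powr (p - 2) * (a * b)"
    if "0 \<le> b" "b \<le> a" "a \<le> M" "c \<le> a + b" "a - b \<le> c" for a b c :: real
  proof (cases "a = 0")
    case True
    then have "b = 0" "c = 0" using that by auto
    then show ?thesis using True by simp
  next
    case False
    then have a: "a > 0" using that by simp
    define k where "k = a powr (p - 1) * b"
    have k0: "k \<ge> 0" using that by (simp add: k_def)
    have kM: "k \<le> M powr (p - 2) * (a * b)"
    proof -
      have "a powr (p - 1) = a * a powr (p - 2)" using powr_mult_base[of a "p - 2"] a by simp
      then have "k = a powr (p - 2) * (a * b)" by (simp add: k_def)
      also have "\<dots> \<le> M powr (p - 2) * (a * b)" using that p a by (intro mult_right_mono powr_mono2) auto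
      finally show ?thesis .
    qed
    have bk: "b powr p \<le> k"
    proof (cases "b = 0")
      case False
      then have b: "b > 0" using that by simp
      have "b powr p = b powr (p - 1) * b" using powr_mult_base[of b "p - 1"] b by (simp add: mult.commute)
      also have "\<dots> \<le> k" unfolding k_def using that p by (intro mult_right_mono powr_mono2) auto
      finally show ?thesis .
    qed (use k0 in simp)
    have "c powr p \<le> (a + b) powr p" using that p by (intro powr_mono2) auto
    moreover have "(a + b) powr p - a powr p \<le> p * (a + b) powr (p - 1) * b"
      using powr_diff_le[of a "a + b" p] that p a by simp
    moreover have "p * (a + b) powr (p - 1) * b \<le> p * 2 powr (p - 1) * k"
    proof -
      have "(a + b) powr (p - 1) \<le> (2 * a) powr (p - 1)" using that p by (intro powr_mono2) auto
      also have "\<dots> = 2 powr (p - 1) * a powr (p - 1)" using a by (simp add: powr_mult)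
      finally have "p * (a + b) powr (p - 1) * b \<le> p * (2 powr (p - 1) * a powr (p - 1)) * b"
        using that p by (intro mult_right_mono mult_left_mono) auto
      then show ?thesis by (simp add: k_def mult_ac)
    qed
    moreover have "b powr p \<ge> 0" by simp
    ultimately have up: "c powr p - a powr p - b powr p \<le> p * 2 powr (p - 1) * k" by linarith
    have "(a - b) powr p \<le> c powr p" using that p by (intro powr_mono2) auto
    moreover have "a powr p - (a - b) powr p \<le> p * k"
      using powr_diff_le[of "a - b" a p] that p by (simp add: k_def mult_ac)
    ultimately have lo: "- (c powr p - a powr p - b powr p) \<le> p * k + k" using bk by linarith
    have "p * 2 powr (p - 1) * k \<ge> 0" "p * k \<ge> 0" using p k0 by auto
    then have "\<bar>c powr p - a powr p - b powr p\<bar> \<le> (p * 2 powr (p - 1) + p + 1) * k"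
      using up lo k0 unfolding distrib_right abs_le_iff by auto
    also have "\<dots> \<le> (p * 2 powr (p - 1) + p + 1) * (M powr (p - 2) * (a * b))"
      using kM p by (intro mult_left_mono) auto
    finally show ?thesis by (simp add: mult.assoc)
  qed
  have t: "cmod (z + w) \<le> cmod z + cmod w" "cmod z - cmod w \<le> cmod (z + w)" "cmod w - cmod z \<le> cmod (z + w)"
    using norm_triangle_ineq[of z w] norm_diff_ineq[of z w] norm_diff_ineq[of w z] by (auto simp: add.commute)
  show ?thesis
  proof (cases "cmod w \<le> cmod z")
    case True
    then show ?thesis using main[of "cmod w" "cmod z" "cmod (z + w)"] t zM by simp
  next
    case False
    then show ?thesis using main[of "cmod z" "cmod w" "cmod (z + w)"] t wM
      by (simp add: mult.commute[of "cmod z"] diff_right_commute add.commute)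
  qed
qed

text \<open>The numerator of the functional in terms of the squared norms \<open>a\<close> of the
  derivative, \<open>b\<close> of the function and \<open>p\<close> of the half-derivative, since
  the squares are what adds up asymptotically.\<close>

definition GN_energy :: "real \<Rightarrow> real \<Rightarrow> real \<Rightarrow> real \<Rightarrow> real \<Rightarrow> real" where
  "GN_energy m \<gamma> a b p = a powr (m / 2) * b powr (m / 2 + 1) + \<gamma> * p powr m * b"

text \<open>
  Superadditivity of the powers \<open>m / 2\<close> requires \<open>m \<ge> 2\<close>. The two cross terms rule out a splitting of the
  mass.
\<close>

lemma GN_energy_superadditive:
  assumes m: "m \<ge> 2" and \<gamma>: "\<gamma> \<ge> 0"
    and nn: "a \<ge> 0" "b \<ge> 0" "p \<ge> 0" "a' \<ge> 0" "b' \<ge> 0" "p' \<ge> 0"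
  shows "GN_energy m \<gamma> a b p + GN_energy m \<gamma> a' b' p' + a powr (m/2) * b' powr (m/2 + 1) + a' powr (m/2) * b powr (m/2 + 1)
    \<le> GN_energy m \<gamma> (a + a') (b + b') (p + p')"
proof -
  have "(a powr (m/2) + a' powr (m/2)) * (b powr (m/2 + 1) + b' powr (m/2 + 1)) \<le> (a + a') powr (m/2) * (b + b') powr (m/2 + 1)"
    using m nn by (intro mult_mono powr_superadditive) auto
  moreover have "(p powr m + p' powr m) * (b + b') \<le> (p + p') powr m * (b + b')"
    using m nn by (intro mult_right_mono powr_superadditive) auto
  then have "p powr m * b + p' powr m * b' \<le> (p + p') powr m * (b + b')"
  proof -
    have "0 \<le> p powr m * b'" "0 \<le> p' powr m * b" using nn by auto
    then have "p powr m * b + p' powr m * b' \<le> (p powr m + p' powr m) * (b + b')" unfolding distrib_left distrib_right by linarith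
    then show ?thesis using \<open>(p powr m + p' powr m) * (b + b') \<le> (p + p') powr m * (b + b')\<close> by linarith
  qed
  then have "\<gamma> * (p powr m * b + p' powr m * b') \<le> \<gamma> * ((p + p') powr m * (b + b'))" using \<gamma> by (rule mult_left_mono)
  ultimately show ?thesis unfolding GN_energy_def distrib_left distrib_right mult.assoc by linarith
qed

lemma GN_energy_tendsto:
  assumes m: "m \<ge> 2" and "a \<longlonglongrightarrow> a0" "b \<longlonglongrightarrow> b0" "p \<longlonglongrightarrow> p0" "\<And>n. a n \<ge> 0" "\<And>n. b n \<ge> 0" "\<And>n. p n \<ge> 0"
  shows "(\<lambda>n. GN_energy m \<gamma> (a n) (b n) (p n)) \<longlonglongrightarrow> GN_energy m \<gamma> a0 b0 p0"
  unfolding GN_energy_def using assms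
  by (intro tendsto_add tendsto_mult tendsto_const tendsto_powr') (auto intro: always_eventually)

section \<open>Splitting of the mass and the variational inequality\<close>

definition Lp_mass :: "real \<Rightarrow> (real \<Rightarrow> complex) \<Rightarrow> real" where
  "Lp_mass p f = (LINT x|lborel. cmod (f x) powr p)"

lemma Lp_mass_nonneg[simp]: "Lp_mass p f \<ge> 0"
  unfolding Lp_mass_def by (intro integral_nonneg_AE) auto

lemma Lp_norm_powr: assumes "p > 0" shows "Lp_norm p f powr p = Lp_mass p f"
  using assms Lp_mass_nonneg[of p f] unfolding Lp_norm_def Lp_mass_def[symmetric] by (simp add: powr_powr)

lemma Lp_mass_bounded:
  assumes f: "f \<in> Lp 2" and M: "AE x in lborel. cmod (f x) \<le> M" and p: "p \<ge> 2"
  shows "integrable lborel (\<lambda>x. cmod (f x) powr p)" "Lp_mass p f \<le> M powr (p - 2) * (l2norm f)\<^sup>2"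
proof -
  note L2_measurable[OF f, measurable]
  have le: "AE x in lborel. cmod (f x) powr p \<le> M powr (p - 2) * (cmod (f x))\<^sup>2"
    using M
  proof eventually_elim
    case (elim x)
    show ?case
    proof (cases "f x = 0")
      case False
      then have "cmod (f x) powr p = cmod (f x) powr (p - 2) * cmod (f x) powr 2"
        unfolding powr_add[symmetric] by simp
      also have "\<dots> \<le> M powr (p - 2) * cmod (f x) powr 2"
        using elim p by (intro mult_right_mono powr_mono2) auto
      finally show ?thesis by (simp add: powr_numeral)
    qed simp
  qed
  have i: "integrable lborel (\<lambda>x. M powr (p - 2) * (cmod (f x))\<^sup>2)" using L2_integrable_sq[OF f] by simp
  show j: "integrable lborel (\<lambda>x. cmod (f x) powr p)"
    by (rule Bochner_Integration.integrable_bound[OF i]) (measurable, use le in eventually_elim, simp)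
  show "Lp_mass p f \<le> M powr (p - 2) * (l2norm f)\<^sup>2"
    unfolding Lp_mass_def l2norm_sq using integral_mono_AE[OF j i le] by simp
qed

text \<open>The uniform bound \<open>M\<close> dominates the pointwise defect by a multiple of
  \<open>cmod (r n x) * cmod (U x)\<close>, whose integral tends to 0 by
  \<open>pairing_tendsto_0\<close>.\<close>

lemma Brezis_Lieb:
  assumes p: "p \<ge> 2" and r: "\<And>n. r n \<in> Lp 2" and C: "\<And>n. l2norm (r n) \<le> C"
    and M: "\<And>n::nat. AE x in lborel. cmod (r n x) \<le> M"
    and lim: "AE x in lborel. (\<lambda>n. r n x) \<longlonglongrightarrow> 0"
    and U: "U \<in> Lp 2" and UM: "AE x in lborel. cmod (U x) \<le> M"
  shows "(\<lambda>n. Lp_mass p (\<lambda>x. r n x + U x) - Lp_mass p (r n)) \<longlonglongrightarrow> Lp_mass p U"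
proof -
  define K where "K = (p * 2 powr (p - 1) + p + 1) * M powr (p - 2)"
  note L2_measurable[OF U, measurable] L2_measurable[OF r, measurable]
  have "(\<lambda>n. Lp_mass p (\<lambda>x. r n x + U x) - Lp_mass p (r n) - Lp_mass p U) \<longlonglongrightarrow> 0"
  proof (rule Lim_null_comparison)
    show "(\<lambda>n. K * (LINT x|lborel. cmod (r n x) * cmod (U x))) \<longlonglongrightarrow> 0"
      by (rule tendsto_mult_right_zero[OF pairing_tendsto_0[OF r C M lim U]])
    have "norm (Lp_mass p (\<lambda>x. r n x + U x) - Lp_mass p (r n) - Lp_mass p U) \<le> K * (LINT x|lborel. cmod (r n x) * cmod (U x))" for n
    proof -
      have i1: "integrable lborel (\<lambda>x. cmod (r n x) powr p)" by (rule Lp_mass_bounded(1)[OF r M p])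
      have i2: "integrable lborel (\<lambda>x. cmod (U x) powr p)" by (rule Lp_mass_bounded(1)[OF U UM p])
      have "AE x in lborel. cmod (r n x + U x) \<le> M + M"
        using M[of n] UM by eventually_elim (meson add_mono norm_triangle_ineq order_trans)
      then have i3: "integrable lborel (\<lambda>x. cmod (r n x + U x) powr p)"
        by (rule Lp_mass_bounded(1)[OF L2_add[OF r U] _ p])
      have eq: "Lp_mass p (\<lambda>x. r n x + U x) - Lp_mass p (r n) - Lp_mass p U =
        (LINT x|lborel. cmod (r n x + U x) powr p - cmod (r n x) powr p - cmod (U x) powr p)"
        unfolding Lp_mass_def using i1 i2 i3 by simp
      have "\<bar>LINT x|lborel. cmod (r n x + U x) powr p - cmod (r n x) powr p - cmod (U x) powr p\<bar> \<le>
         (LINT x|lborel. \<bar>cmod (r n x + U x) powr p - cmod (r n x) powr p - cmod (U x) powr p\<bar>)"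
        by (rule integral_abs_bound)
      also have "\<dots> \<le> (LINT x|lborel. K * (cmod (r n x) * cmod (U x)))"
      proof (rule integral_mono_AE)
        show "integrable lborel (\<lambda>x. \<bar>cmod (r n x + U x) powr p - cmod (r n x) powr p - cmod (U x) powr p\<bar>)"
          using i1 i2 i3 by simp
        show "integrable lborel (\<lambda>x. K * (cmod (r n x) * cmod (U x)))"
          by (intro integrable_mult_right L2_norm_mult_integrable r U)
        show "AE x in lborel. \<bar>cmod (r n x + U x) powr p - cmod (r n x) powr p - cmod (U x) powr p\<bar> \<le> K * (cmod (r n x) * cmod (U x))"
          using M[of n] UM unfolding K_def by eventually_elim (rule Brezis_Lieb_pointwise[OF p])
      qed
      finally show ?thesis unfolding eq by simp
    qed
    then show "\<forall>\<^sub>F n in sequentially. norm (Lp_mass p (\<lambda>x. r n x + U x) - Lp_mass p (r n) - Lp_mass p U) \<le> K * (LINT x|lborel. cmod (r n x) * cmod (U x))"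
      by simp
  qed
  then show ?thesis by (rule LIM_zero_cancel)
qed

abbreviation energy :: "real \<Rightarrow> real \<Rightarrow> (real \<Rightarrow> complex) \<Rightarrow> real" where
  "energy m \<gamma> f \<equiv> GN_energy m \<gamma> ((l2norm (weak_deriv f))\<^sup>2) ((l2norm f)\<^sup>2) ((l2norm (abs_D (1/2) f))\<^sup>2)"

lemma powr_sq_half: "x \<ge> 0 \<Longrightarrow> (x\<^sup>2) powr s = x powr (2 * s)" for x s :: real
  by (cases "x = 0") (simp_all add: powr_powr flip: powr_numeral)

lemma I_fun_eq:
  assumes "m \<ge> 2"
  shows "I_fun m \<gamma> f = energy m \<gamma> f / Lp_mass (2 * m + 2) f"
proof -
  have "Lp_norm (2 * m + 2) f powr (2 * m + 2) = Lp_mass (2 * m + 2) f"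
    using assms by (intro Lp_norm_powr) simp
  then show ?thesis
    unfolding I_fun_def Lp_norm_2 GN_energy_def by (simp add: powr_sq_half)
qed

lemma energy_nonneg: "\<gamma> \<ge> 0 \<Longrightarrow> energy m \<gamma> f \<ge> 0"
  by (simp add: GN_energy_def)

text \<open>Clearing the denominator lets the inequality cover functions of mass zero, so that it
  applies to every remainder without a case distinction.\<close>

lemma J_inf_le:
  assumes m: "m \<ge> 2" and \<gamma>: "\<gamma> \<ge> 0" and f: "f \<in> H1_plus" and M: "AE x in lborel. cmod (f x) \<le> M"
  shows "J_inf m \<gamma> * Lp_mass (2 * m + 2) f \<le> energy m \<gamma> f"
proof (cases "Lp_mass (2 * m + 2) f = 0")
  case False
  then have pos: "Lp_mass (2 * m + 2) f > 0" using Lp_mass_nonneg[of "2 * m + 2" f] by linarith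
  have "\<not> (AE x in lborel. f x = 0)"
  proof
    assume "AE x in lborel. f x = 0"
    then have "AE x in lborel. cmod (f x) powr (2 * m + 2) = 0" by eventually_elim simp
    then have "Lp_mass (2 * m + 2) f = 0" unfolding Lp_mass_def by (rule integral_eq_zero_AE)
    then show False using False by simp
  qed
  then have nz: "f \<in> H1_plus_nz" using f by (simp add: H1_plus_nz_def)
  have "bdd_below (I_fun m \<gamma> ` H1_plus_nz)"
    by (intro bdd_belowI[of _ 0]) (auto simp: I_fun_eq[OF m] intro!: divide_nonneg_nonneg energy_nonneg[OF \<gamma>])
  then have "J_inf m \<gamma> \<le> I_fun m \<gamma> f" unfolding J_inf_def by (rule cINF_lower[OF _ nz])
  then show ?thesis unfolding I_fun_eq[OF m] using pos by (simp add: pos_le_divide_eq)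
qed (simp add: energy_nonneg[OF \<gamma>])

text \<open>The value 1/2 is one convenient threshold below 1: it bounds the mass by
  \<open>(1/2) powr (2 * m)\<close>, which is less than 1.\<close>

lemma exists_large_value:
  assumes m: "m \<ge> 2" and f: "f \<in> Lp 2" and \<phi>: "AE x in lborel. f x = \<phi> x"
    and f1: "l2norm f = 1" and fp: "Lp_mass (2 * m + 2) f = 1"
  shows "\<exists>x. cmod (\<phi> x) \<ge> 1/2"
proof (rule ccontr)
  assume "\<not> ?thesis"
  then have "cmod (\<phi> x) \<le> 1/2" for x by (simp add: not_le less_imp_le)
  then have "AE x in lborel. cmod (f x) \<le> 1/2" using \<phi> by auto
  then have "Lp_mass (2 * m + 2) f \<le> (1/2) powr (2 * m + 2 - 2) * (l2norm f)\<^sup>2"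
    by (rule Lp_mass_bounded(2)[OF f]) (use m in simp)
  then have "1 \<le> (1/2::real) powr (2 * m)" using f1 fp by simp
  moreover have "(1/2::real) powr (2 * m) < (1/2) powr 0" by (rule powr_less_mono') (use m in auto)
  ultimately show False by simp
qed

lemma AE_lborel_exists_Ioo:
  assumes "AE x in lborel. P x" "a < b" shows "\<exists>x::real. a < x \<and> x < b \<and> P x"
proof (rule ccontr)
  assume "\<not> ?thesis"
  then have "AE x in lborel. x \<notin> {a<..<b}" using assms(1) by (auto elim: AE_mp)
  then have "{a<..<b} \<in> null_sets lborel" by (subst AE_iff_null_sets) auto
  then show False using assms(2) by (simp add: null_sets_def)
qed

section \<open>Compactness of minimizing sequences\<close>

lemma ift_shift: "ift (\<lambda>\<xi>. iexp (h * \<xi>) * F \<xi>) t = ift F (t + h)"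
proof -
  have eq: "iexp (t * \<xi>) * (iexp (h * \<xi>) * F \<xi>) = iexp ((t + h) * \<xi>) * F \<xi>" for \<xi>
    unfolding mult.assoc[symmetric] exp_add[symmetric] by (simp add: algebra_simps)
  show ?thesis unfolding ift_eq eq ..
qed

lemma sobolev_norm_fourier:
  assumes f: "f \<in> H1" and F: "has_fourier_L2 f F"
  shows "sobolev_norm F = sqrt (2 * pi) * H1_norm f"
proof -
  have "(l2norm F)\<^sup>2 + (l2norm (xmult F))\<^sup>2 = 2 * pi * ((l2norm f)\<^sup>2 + (l2norm (weak_deriv f))\<^sup>2)"
    unfolding l2norm_weak_deriv[OF f F, symmetric] has_fourier_norm[OF H1_L2[OF f] F]
    by (simp add: power_mult_distrib algebra_simps)
  then show ?thesis unfolding sobolev_norm_def H1_norm_def Lp_norm_2 by (simp add: real_sqrt_mult)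
qed

text \<open>As in Arzela-Ascoli: a diagonal extraction gives convergence at the rationals, and the
  common modulus of continuity carries the Cauchy property to every other point.\<close>

lemma H1_plus_pointwise_subsequence:
  assumes G: "\<And>n. G n \<in> Lp 2" "\<And>n. xmult (G n) \<in> Lp 2" and S: "\<And>n. sobolev_norm (G n) \<le> S"
  obtains k U where "strict_mono (k :: nat \<Rightarrow> nat)" "\<And>t. (\<lambda>n. ift (G (k n)) t) \<longlonglongrightarrow> U t"
proof -
  define M where "M = l2norm sobolev_kernel * S"
  have M: "cmod (ift (G n) t) \<le> M" for n t
    using ift_bound(1)[OF G, of n t] mult_left_mono[OF S[of n] l2norm_nonneg[of sobolev_kernel]] by (simp add: M_def)
  have eq: "cmod (ift (G n) t - ift (G n) s) \<le> sobolev_modulus (t - s) * S" for n t s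
    using ift_bound(2)[OF G, of n t s] mult_left_mono[OF S[of n], of "sobolev_modulus (t - s)"]
    by (simp add: sobolev_modulus_def)
  obtain k :: "nat \<Rightarrow> nat" where k: "strict_mono k" and conv: "\<And>q. q \<in> \<rat> \<Longrightarrow> \<exists>l. (\<lambda>n. ift (G (k n)) q) \<longlonglongrightarrow> l"
    by (rule function_convergent_subsequence[where f="\<lambda>n. ift (G n)", OF countable_rat M]) (rule that)
  have "convergent (\<lambda>n. ift (G (k n)) t)" for t
  proof -
    have "Cauchy (\<lambda>n. ift (G (k n)) t)"
    proof (rule CauchyI)
      fix e :: real assume e: "e > 0"
      \<comment> \<open>A whole sequence of rationals is chosen because the decay of the modulus is
        stated along sequences; one sufficiently close member is then used.\<close>
      have "\<forall>j. \<exists>q\<in>\<rat>. t < q \<and> q < t + 1 / real (Suc j)"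
        by (intro allI Rats_dense_in_real) simp
      then obtain q where q: "\<And>j. q j \<in> \<rat>" "\<And>j. t < q j" "\<And>j. q j < t + 1 / real (Suc j)" by metis
      have "(\<lambda>j. t - q j) \<longlonglongrightarrow> 0"
      proof (rule Lim_null_comparison)
        show "\<forall>\<^sub>F j in sequentially. norm (t - q j) \<le> 1 / real (Suc j)"
        proof (intro always_eventually allI)
          fix j show "norm (t - q j) \<le> 1 / real (Suc j)" using q(2,3)[of j] by simp
        qed
        show "(\<lambda>j. 1 / real (Suc j)) \<longlonglongrightarrow> 0" using LIMSEQ_inverse_real_of_nat by (simp add: inverse_eq_divide)
      qed
      then have "(\<lambda>j. sobolev_modulus (t - q j) * S) \<longlonglongrightarrow> 0 * S"
        by (intro tendsto_mult tendsto_const sobolev_modulus_tendsto)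
      from LIMSEQ_D[OF this, of "e/3"] e obtain j where "norm (sobolev_modulus (t - q j) * S - 0 * S) < e / 3" by auto
      then have j: "sobolev_modulus (t - q j) * S < e / 3" by simp
      have "Cauchy (\<lambda>n. ift (G (k n)) (q j))" using conv[OF q(1)] convergent_def convergent_Cauchy by blast
      from CauchyD[OF this, of "e/3"] e obtain N
        where N: "\<And>m n. m \<ge> N \<Longrightarrow> n \<ge> N \<Longrightarrow> cmod (ift (G (k m)) (q j) - ift (G (k n)) (q j)) < e / 3" by auto
      have "cmod (ift (G (k m)) t - ift (G (k n)) t) < e" if "m \<ge> N" "n \<ge> N" for m n
      proof -
        define a b c d where "a = ift (G (k m)) t" and "b = ift (G (k m)) (q j)" and "c = ift (G (k n)) (q j)" and "d = ift (G (k n)) t"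
        have "cmod (a - b) < e / 3" "cmod (d - c) < e / 3" "cmod (b - c) < e / 3"
          using eq[of "k m" t "q j"] eq[of "k n" t "q j"] N[OF that] j unfolding a_def b_def c_def d_def by linarith+
        moreover have "cmod (a - d) \<le> cmod (a - b) + cmod (b - c) + cmod (d - c)"
        proof -
          have "a - d = (a - b) + (b - c) - (d - c)" by simp
          then show ?thesis using norm_triangle_ineq4[of "(a - b) + (b - c)" "d - c"] norm_triangle_ineq[of "a - b" "b - c"] by simp
        qed
        ultimately show ?thesis unfolding a_def d_def by linarith
      qed
      then show "\<exists>M. \<forall>m\<ge>M. \<forall>n\<ge>M. norm (ift (G (k m)) t - ift (G (k n)) t) < e" by blast
    qed
    then show ?thesis by (simp add: Cauchy_convergent_iff)
  qed
  then show ?thesis using that[OF k, of "\<lambda>t. lim (\<lambda>n. ift (G (k n)) t)"] by (simp add: convergent_LIMSEQ_iff)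
qed

text \<open>If \<open>xmult V\<close> vanishes almost everywhere then so does \<open>V\<close>, one
  point being null. Strict positivity is what later turns a vanishing cross term into a vanishing
  factor.\<close>

lemma weak_deriv_pos:
  assumes U: "U \<in> H1_plus_nz" shows "l2norm (weak_deriv U) > 0" "l2norm U > 0"
proof -
  have U': "U \<in> H1_plus" and nz: "\<not> (AE x in lborel. U x = 0)" using U by (auto simp: H1_plus_nz_def)
  note UL = H1_plus_L2[OF U']
  have n: "l2norm U \<noteq> 0" using nz l2norm_eq_0[OF UL] by simp
  then show "l2norm U > 0" using l2norm_nonneg[of U] by linarith
  obtain V where V: "has_fourier_L2 U V" using has_fourier_exists[OF UL] by blast
  have xV: "xmult V \<in> Lp 2" using H1_plus_iff_fourier[OF UL V] U' by auto
  have "l2norm (weak_deriv U) \<noteq> 0"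
  proof
    assume "l2norm (weak_deriv U) = 0"
    then have "l2norm (xmult V) = 0" using l2norm_weak_deriv[OF H1_plus_H1[OF U'] V] by simp
    then have "AE \<xi> in lborel. xmult V \<xi> = 0" using l2norm_eq_0[OF xV] by simp
    moreover have "AE \<xi> in lborel. \<xi> \<noteq> (0::real)" by (rule AE_lborel_singleton)
    ultimately have "AE \<xi> in lborel. V \<xi> = 0" by eventually_elim simp
    then have "l2norm V = 0" using l2norm_eq_0[OF has_fourier_L2_L2[OF V]] by simp
    then show False using has_fourier_norm[OF UL V] n by simp
  qed
  then show "l2norm (weak_deriv U) > 0" using l2norm_nonneg[of "weak_deriv U"] by linarith
qed

theorem theorem1p4:
  fixes m \<gamma> :: real and f :: "nat \<Rightarrow> real \<Rightarrow> complex"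
  assumes "m \<ge> 2" and "\<gamma> \<ge> 0"
    and "\<And>n. f n \<in> H1_plus"
    and "\<And>n. Lp_norm 2 (f n) = 1"
    and "\<And>n. Lp_norm (2 * m + 2) (f n) = 1"
    and "(\<lambda>n. I_fun m \<gamma> (f n)) \<longlonglongrightarrow> J_inf m \<gamma>"
  shows "\<exists>U \<in> G_normalized m \<gamma> 1 1. \<exists>\<psi> :: nat \<Rightarrow> nat. \<exists>x :: nat \<Rightarrow> real.
           strict_mono \<psi> \<and>
           (\<lambda>n. H1_norm (\<lambda>t. f (\<psi> n) t - U (t - x n))) \<longlonglongrightarrow> 0"
proof -
  note m = assms(1) and \<gamma> = assms(2) and f = assms(3)
  let ?p = "2 * m + 2"
  have p2: "?p \<ge> 2" using m by simp
  have f1: "l2norm (f n) = 1" for n using assms(4) by (simp add: Lp_norm_2)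
  have fp: "Lp_mass ?p (f n) = 1" for n
    using Lp_norm_powr[of ?p "f n"] assms(5)[of n] m by simp
  have J: "(\<lambda>n. energy m \<gamma> (f n)) \<longlonglongrightarrow> J_inf m \<gamma>"
    using assms(6) unfolding I_fun_eq[OF m] fp by simp
  note fL = H1_plus_L2[OF f]

  have "Bseq (\<lambda>n. energy m \<gamma> (f n))" using J by (intro convergent_imp_Bseq convergentI)
  then obtain E where E: "\<And>n. \<bar>energy m \<gamma> (f n)\<bar> \<le> E" by (auto simp: Bseq_def)
  \<comment> \<open>If the derivative norm \<open>d\<close> exceeds 1 then
    \<open>d \<le> d powr m\<close>, which with unit L2 norm is one summand of the energy and hence
    at most \<open>E\<close>; the 1 covers the other case.\<close>
  define D where "D = max 1 E"
  have D: "l2norm (weak_deriv (f n)) \<le> D" for n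
  proof (cases "l2norm (weak_deriv (f n)) \<le> 1")
    case False
    define d where "d = l2norm (weak_deriv (f n))"
    have d: "d > 1" using False by (simp add: d_def)
    have "d = d powr 1" using d by simp
    also have "\<dots> \<le> d powr m" using d m by (intro powr_mono) auto
    also have "\<dots> = (d\<^sup>2) powr (m / 2)" using d by (simp add: powr_sq_half)
    also have "\<dots> \<le> energy m \<gamma> (f n)" unfolding GN_energy_def f1 using \<gamma> by (simp add: d_def)
    also have "\<dots> \<le> D" using E[of n] unfolding D_def by linarith
    finally show ?thesis by (simp add: d_def)
  qed (simp add: D_def)

  have "\<forall>n. \<exists>F. has_fourier_L2 (f n) F" using has_fourier_exists[OF fL] by blast
  then obtain F where F: "\<And>n. has_fourier_L2 (f n) (F n)" by metis
  note FL = has_fourier_L2_L2[OF F]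
  have xF: "xmult (F n) \<in> Lp 2" for n using H1_plus_iff_fourier[OF fL F] f by auto
  have "\<exists>y. cmod (ift (F n) y) \<ge> 1/2" for n
    by (rule exists_large_value[OF m fL ift_representative[OF fL F xF] f1 fp])
  then obtain y where y: "\<And>n. cmod (ift (F n) (y n)) \<ge> 1/2" by metis
  define g where "g n t = f n (t + y n)" for n t
  define G where "G n \<xi> = iexp (y n * \<xi>) * F n \<xi>" for n \<xi>
  have g: "g n \<in> H1_plus" for n unfolding g_def[abs_def] by (rule H1_plus_shift[OF f])
  note gL = H1_plus_L2[OF g]
  have G: "has_fourier_L2 (g n) (G n)" for n
    unfolding g_def[abs_def] G_def[abs_def] by (rule has_fourier_shift[OF fL F])
  note GL = has_fourier_L2_L2[OF G]
  have xG: "xmult (G n) \<in> Lp 2" for n using H1_plus_iff_fourier[OF gL G] g by auto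
  have g1: "l2norm (g n) = 1" for n unfolding g_def[abs_def] l2norm_shift by (rule f1)
  have gp: "Lp_mass ?p (g n) = 1" for n
    using fp[of n] lborel_integral_real_affine[of 1 "\<lambda>x. cmod (f n x) powr ?p" "y n"]
    by (simp add: Lp_mass_def g_def add.commute)
  have gw: "l2norm (weak_deriv (g n)) = l2norm (weak_deriv (f n))" for n
    unfolding g_def[abs_def] by (rule l2norm_weak_deriv_shift[OF f])
  have ga: "l2norm (abs_D (1/2) (g n)) = l2norm (abs_D (1/2) (f n))" for n
    unfolding g_def[abs_def] by (rule l2norm_abs_D_half_shift[OF f])
  have gD: "l2norm (weak_deriv (g n)) \<le> D" for n unfolding gw by (rule D)
  have Jg: "(\<lambda>n. energy m \<gamma> (g n)) \<longlonglongrightarrow> J_inf m \<gamma>" unfolding gw ga using J by (simp add: g1 f1)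
  define S where "S = sqrt (2 * pi) * sqrt (1 + D\<^sup>2)"
  have S: "sobolev_norm (G n) \<le> S" for n
    unfolding sobolev_norm_fourier[OF H1_plus_H1[OF g] G] S_def H1_norm_def Lp_norm_2 g1
    using gD[of n] by (intro mult_left_mono real_sqrt_le_mono add_mono power_mono) auto
  define M where "M = l2norm sobolev_kernel * S"
  have M: "cmod (ift (G n) t) \<le> M" for n t
    using ift_bound(1)[OF GL xG, of n t] mult_left_mono[OF S[of n] l2norm_nonneg[of sobolev_kernel]] by (simp add: M_def)
  have rep: "AE t in lborel. g n t = ift (G n) t" for n by (rule ift_representative[OF gL G xG])
  have G0: "cmod (ift (G n) 0) \<ge> 1/2" for n
    using y[of n] unfolding G_def[abs_def] ift_shift by simp

  obtain k1 U where k1: "strict_mono (k1 :: nat \<Rightarrow> nat)" and U1: "\<And>t. (\<lambda>n. ift (G (k1 n)) t) \<longlonglongrightarrow> U t"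
    using H1_plus_pointwise_subsequence[of G S, OF GL xG S] by blast
  \<comment> \<open>The L2 norms are constantly 1, but the other two quadratic quantities need not
    converge yet. As pairs they stay in a compact rectangle, so one further extraction settles
    both.\<close>
  define h where "h n = ((l2norm (weak_deriv (g (k1 n))))\<^sup>2, (l2norm (abs_D (1/2) (g (k1 n))))\<^sup>2)" for n
  have "bounded (range h)"
  proof -
    have "(l2norm (weak_deriv (g n)))\<^sup>2 \<in> {0..D\<^sup>2}" for n using gD by (simp add: power_mono)
    moreover have "(l2norm (abs_D (1/2) (g n)))\<^sup>2 \<in> {0..D}" for n
      using abs_D_half_interpolation[OF g, of n] gD[of n] g1[of n] by simp
    ultimately have "range h \<subseteq> {0..D\<^sup>2} \<times> {0..D}" unfolding h_def by blast
    then show ?thesis by (rule bounded_subset[rotated]) (intro bounded_Times bounded_closed_interval)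
  qed
  from bounded_imp_convergent_subsequence[OF this] obtain l k2 where k2: "strict_mono (k2 :: nat \<Rightarrow> nat)" and l: "(h \<circ> k2) \<longlonglongrightarrow> l"
    by blast
  define \<psi> where "\<psi> n = k1 (k2 n)" for n
  have \<psi>: "strict_mono \<psi>" using strict_mono_o[OF k1 k2] by (simp add: \<psi>_def[abs_def] o_def)
  have U: "(\<lambda>n. ift (G (\<psi> n)) t) \<longlonglongrightarrow> U t" for t
    using LIMSEQ_subseq_LIMSEQ[OF U1 k2] by (simp add: \<psi>_def o_def)
  define A P where "A = fst l" and "P = snd l"
  have A: "(\<lambda>n. (l2norm (weak_deriv (g (\<psi> n))))\<^sup>2) \<longlonglongrightarrow> A"
    using tendsto_fst[OF l] by (simp add: h_def o_def \<psi>_def A_def)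
  have P: "(\<lambda>n. (l2norm (abs_D (1/2) (g (\<psi> n))))\<^sup>2) \<longlonglongrightarrow> P"
    using tendsto_snd[OF l] by (simp add: h_def o_def \<psi>_def P_def)

  \<comment> \<open>A single null set for all \<open>n\<close>, off which convergence of the
    continuous representatives is convergence of the functions.\<close>
  have rep_all: "AE t in lborel. \<forall>n. g (\<psi> n) t = ift (G (\<psi> n)) t"
    unfolding AE_all_countable using rep by blast
  have UM: "cmod (U t) \<le> M" for t
    by (rule LIMSEQ_le_const2[OF tendsto_norm[OF U]]) (use M in blast)
  have [measurable]: "g n \<in> borel_measurable lborel" for n by (rule L2_measurable[OF gL])
  have ift_meas[measurable]: "ift (G n) \<in> borel_measurable borel" for n
    using L2_measurable[OF GL] unfolding ift_def[abs_def] by measurable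
  have Um[measurable]: "U \<in> borel_measurable borel"
    by (rule borel_measurable_LIMSEQ_metric[of "\<lambda>n. ift (G (\<psi> n))"]) (use U in auto)
  have UL: "U \<in> Lp 2"
  proof (rule L2_Fatou(1))
    show "g (\<psi> n) \<in> Lp 2" for n by (rule gL)
    show "l2norm (g (\<psi> n)) \<le> 1" for n by (simp add: g1)
    show "U \<in> borel_measurable lborel" by simp
    show "AE x in lborel. (\<lambda>n. g (\<psi> n) x) \<longlonglongrightarrow> U x"
      using rep_all by eventually_elim (simp add: U)
  qed
  define r where "r n t = g (\<psi> n) t - U t" for n t
  have rL: "r n \<in> Lp 2" for n unfolding r_def[abs_def] by (rule L2_diff[OF gL UL])
  have rM: "AE t in lborel. cmod (r n t) \<le> 2 * M" for n
    using rep_all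
  proof eventually_elim
    case (elim t)
    then show ?case using norm_triangle_ineq4[of "g (\<psi> n) t" "U t"] M[of "\<psi> n" t] UM[of t] by (simp add: r_def)
  qed
  have r0: "AE t in lborel. (\<lambda>n. r n t) \<longlonglongrightarrow> 0"
    using rep_all
  proof eventually_elim
    case (elim t)
    have "(\<lambda>n. ift (G (\<psi> n)) t - U t) \<longlonglongrightarrow> 0" using U by (rule LIM_zero)
    then show ?case using elim by (simp add: r_def)
  qed
  have rC: "l2norm (r n) \<le> 1 + l2norm U" for n
    using l2norm_triangle[OF gL L2_uminus[OF UL], of "\<psi> n"] by (simp add: r_def[abs_def] g1)
  have wn: "weakly_null (\<lambda>n x. g (\<psi> n) x - U x)"
    using weakly_nullI_pointwise[OF rL rC rM r0] unfolding r_def[abs_def] .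
  have UH: "U \<in> H1_plus"
    by (rule H1_plus_weak_limit[where g="\<lambda>n. g (\<psi> n)", OF g gD UL wn])
  have r: "r n \<in> H1_plus" for n unfolding r_def[abs_def] by (rule H1_plus_diff[OF g UH])

  have U0: "cmod (U 0) \<ge> 1/2"
    by (rule LIMSEQ_le_const[OF tendsto_norm[OF U]]) (use G0 in blast)
  \<comment> \<open>The value at 0 alone says nothing about the almost everywhere class. If
    \<open>U\<close> vanished almost everywhere, it would have zeros \<open>t j\<close> tending to
    0, while the modulus of continuity inherited from the sequence would force
    \<open>cmod (U 0)\<close> below every positive bound.\<close>
  have "\<not> (AE x in lborel. U x = 0)"
  proof
    assume ae: "AE x in lborel. U x = 0"
    have "\<forall>j. \<exists>t. 0 < t \<and> t < 1 / real (Suc j) \<and> U t = 0"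
      by (intro allI AE_lborel_exists_Ioo[OF ae]) simp
    then obtain t where t: "\<And>j. 0 < t j" "\<And>j. t j < 1 / real (Suc j)" "\<And>j. U (t j) = 0" by metis
    have t0: "(\<lambda>j. t j - 0) \<longlonglongrightarrow> 0"
    proof (rule Lim_null_comparison)
      show "\<forall>\<^sub>F j in sequentially. norm (t j - 0) \<le> 1 / real (Suc j)"
      proof (intro always_eventually allI)
        fix j show "norm (t j - 0) \<le> 1 / real (Suc j)" using t(1,2)[of j] by simp
      qed
      show "(\<lambda>j. 1 / real (Suc j)) \<longlonglongrightarrow> 0" using LIMSEQ_inverse_real_of_nat by (simp add: inverse_eq_divide)
    qed
    have "cmod (U (t j) - U 0) \<le> sobolev_modulus (t j - 0) * S" for j
    proof (rule LIMSEQ_le_const2)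
      show "(\<lambda>n. cmod (ift (G (\<psi> n)) (t j) - ift (G (\<psi> n)) 0)) \<longlonglongrightarrow> cmod (U (t j) - U 0)"
        by (intro tendsto_intros U)
      have "cmod (ift (G n) (t j) - ift (G n) 0) \<le> sobolev_modulus (t j - 0) * S" for n
        using ift_bound(2)[OF GL xG, of n "t j" 0] mult_left_mono[OF S[of n], of "sobolev_modulus (t j - 0)"]
        by (simp add: sobolev_modulus_def)
      then show "\<exists>N. \<forall>n\<ge>N. cmod (ift (G (\<psi> n)) (t j) - ift (G (\<psi> n)) 0) \<le> sobolev_modulus (t j - 0) * S" by blast
    qed
    then have le: "1/2 \<le> sobolev_modulus (t j - 0) * S" for j
      using U0 t(3)[of j] by (metis diff_0 norm_minus_cancel order_trans)
    have "(\<lambda>j. sobolev_modulus (t j - 0) * S) \<longlonglongrightarrow> 0 * S"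
      by (intro tendsto_mult tendsto_const sobolev_modulus_tendsto t0)
    then have "1/2 \<le> 0 * S" by (rule LIMSEQ_le_const) (use le in blast)
    then show False by simp
  qed
  then have Unz: "U \<in> H1_plus_nz" using UH by (simp add: H1_plus_nz_def)

  define AU BU PU where "AU = (l2norm (weak_deriv U))\<^sup>2" and "BU = (l2norm U)\<^sup>2" and "PU = (l2norm (abs_D (1/2) U))\<^sup>2"
  define a b q where "a n = (l2norm (weak_deriv (r n)))\<^sup>2" and "b n = (l2norm (r n))\<^sup>2"
    and "q n = (l2norm (abs_D (1/2) (r n)))\<^sup>2" for n
  have nn: "a n \<ge> 0" "b n \<ge> 0" "q n \<ge> 0" "AU > 0" "BU > 0" "PU \<ge> 0" for n
    using weak_deriv_pos[OF Unz] by (auto simp: a_def b_def q_def AU_def BU_def PU_def)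
  note split = energy_splitting[where g="\<lambda>n. g (\<psi> n)", OF g UH wn gD]
  have blim: "b \<longlonglongrightarrow> 1 - BU"
    using tendsto_diff[OF tendsto_const[of 1] split(1)] by (simp add: g1 b_def[abs_def] r_def[abs_def] BU_def)
  have alim: "a \<longlonglongrightarrow> A - AU"
    using tendsto_diff[OF A split(2)] by (simp add: a_def[abs_def] r_def[abs_def] AU_def)
  have qlim: "q \<longlonglongrightarrow> P - PU"
    using tendsto_diff[OF P split(3)] by (simp add: q_def[abs_def] r_def[abs_def] PU_def)
  have lim_nn: "A - AU \<ge> 0" "1 - BU \<ge> 0" "P - PU \<ge> 0"
    using LIMSEQ_le_const[OF alim, of 0] LIMSEQ_le_const[OF blim, of 0] LIMSEQ_le_const[OF qlim, of 0] nn by auto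
  have EJ: "GN_energy m \<gamma> A 1 P = J_inf m \<gamma>"
  proof (rule LIMSEQ_unique)
    show "(\<lambda>n. energy m \<gamma> (g (\<psi> n))) \<longlonglongrightarrow> GN_energy m \<gamma> A 1 P"
      by (rule GN_energy_tendsto[OF m A _ P]) (simp_all add: g1)
    show "(\<lambda>n. energy m \<gamma> (g (\<psi> n))) \<longlonglongrightarrow> J_inf m \<gamma>"
      using LIMSEQ_subseq_LIMSEQ[OF Jg \<psi>] by (simp add: o_def)
  qed
  have M0: "M \<ge> 0" using UM[of 0] norm_ge_zero[of "U 0"] by linarith
  \<comment> \<open>Brezis-Lieb takes one bound for remainders and profile; that of the remainders,
    \<open>2 * M\<close>, is used for both.\<close>
  have UM2: "AE x in lborel. cmod (U x) \<le> 2 * M"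
    using UM M0 by (intro AE_I2) (smt (verit))
  have "(\<lambda>n. Lp_mass ?p (\<lambda>x. r n x + U x) - Lp_mass ?p (r n)) \<longlonglongrightarrow> Lp_mass ?p U"
    by (rule Brezis_Lieb[OF p2 rL rC rM r0 UL UM2])
  then have "(\<lambda>n. 1 - Lp_mass ?p (r n)) \<longlonglongrightarrow> Lp_mass ?p U"
    using gp by (simp add: r_def)
  then have Qlim: "(\<lambda>n. Lp_mass ?p (r n)) \<longlonglongrightarrow> 1 - Lp_mass ?p U"
    using tendsto_diff[OF tendsto_const[of 1]] by fastforce
  have EU: "J_inf m \<gamma> * Lp_mass ?p U \<le> GN_energy m \<gamma> AU BU PU"
    unfolding AU_def BU_def PU_def by (rule J_inf_le[OF m \<gamma> UH UM2])
  have Er: "J_inf m \<gamma> * (1 - Lp_mass ?p U) \<le> GN_energy m \<gamma> (A - AU) (1 - BU) (P - PU)"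
  proof (rule LIMSEQ_le)
    show "(\<lambda>n. J_inf m \<gamma> * Lp_mass ?p (r n)) \<longlonglongrightarrow> J_inf m \<gamma> * (1 - Lp_mass ?p U)"
      by (intro tendsto_intros Qlim)
    show "(\<lambda>n. GN_energy m \<gamma> (a n) (b n) (q n)) \<longlonglongrightarrow> GN_energy m \<gamma> (A - AU) (1 - BU) (P - PU)"
      by (rule GN_energy_tendsto[OF m alim blim qlim]) (use nn in auto)
    show "\<exists>N. \<forall>n\<ge>N. J_inf m \<gamma> * Lp_mass ?p (r n) \<le> GN_energy m \<gamma> (a n) (b n) (q n)"
      unfolding a_def b_def q_def using J_inf_le[OF m \<gamma> r rM] by blast
  qed
  \<comment> \<open>The variational inequalities for \<open>U\<close> and for the limiting remainder
    add up to \<open>J_inf m \<gamma>\<close>, because the two masses sum to 1. The same number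
    bounds the two energies together with the cross terms, which are therefore squeezed to
    0.\<close>
  have "GN_energy m \<gamma> AU BU PU + GN_energy m \<gamma> (A - AU) (1 - BU) (P - PU)
      + AU powr (m/2) * (1 - BU) powr (m/2 + 1) + (A - AU) powr (m/2) * BU powr (m/2 + 1) \<le> J_inf m \<gamma>"
    using GN_energy_superadditive[OF m \<gamma>, of AU BU PU "A - AU" "1 - BU" "P - PU"] nn lim_nn EJ
    by (simp add: less_imp_le)
  moreover have "J_inf m \<gamma> * Lp_mass ?p U + J_inf m \<gamma> * (1 - Lp_mass ?p U) = J_inf m \<gamma>" by (simp add: algebra_simps)
  moreover have "AU powr (m/2) * (1 - BU) powr (m/2 + 1) \<ge> 0" "(A - AU) powr (m/2) * BU powr (m/2 + 1) \<ge> 0" by auto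
  ultimately have "AU powr (m/2) * (1 - BU) powr (m/2 + 1) = 0" "(A - AU) powr (m/2) * BU powr (m/2 + 1) = 0"
    using EU Er by linarith+
  \<comment> \<open>One factor of each product is positive: \<open>AU > 0\<close> forces
    \<open>1 - BU = 0\<close>, and \<open>BU > 0\<close> forces \<open>A - AU = 0\<close>.\<close>
  then have BU1: "BU = 1" and AUA: "AU = A" using nn by auto
  have b0: "b \<longlonglongrightarrow> 0" and a0: "a \<longlonglongrightarrow> 0" using blim alim BU1 AUA by simp_all
  \<comment> \<open>The half-derivative does not occur in the cross terms, so its remainder is
    controlled by interpolation between the two that already vanish. This gives
    \<open>PU = P\<close>, without which \<open>U\<close> would not be seen to attain the
    infimum.\<close>
  have q0: "q \<longlonglongrightarrow> 0"
  proof (rule Lim_null_comparison)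
    have "(\<lambda>n. sqrt (a n) * sqrt (b n)) \<longlonglongrightarrow> sqrt 0 * sqrt 0" by (intro tendsto_intros a0 b0)
    then show "(\<lambda>n. sqrt (a n) * sqrt (b n)) \<longlonglongrightarrow> 0" by simp
    show "\<forall>\<^sub>F n in sequentially. norm (q n) \<le> sqrt (a n) * sqrt (b n)"
      using abs_D_half_interpolation[OF r] by (simp add: q_def a_def b_def)
  qed
  have PUP: "PU = P" using LIMSEQ_unique[OF qlim q0] by simp
  \<comment> \<open>The sup bound turns L2 convergence of the remainders into vanishing mass, so
    \<open>U\<close> carries the full mass 1.\<close>
  have "(\<lambda>n. Lp_mass ?p (r n)) \<longlonglongrightarrow> 0"
  proof (rule Lim_null_comparison)
    show "(\<lambda>n. (2 * M) powr (?p - 2) * b n) \<longlonglongrightarrow> 0" by (rule tendsto_mult_right_zero[OF b0])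
    show "\<forall>\<^sub>F n in sequentially. norm (Lp_mass ?p (r n)) \<le> (2 * M) powr (?p - 2) * b n"
      using Lp_mass_bounded(2)[OF rL rM p2] by (simp add: b_def)
  qed
  from LIMSEQ_unique[OF Qlim this] have QU: "Lp_mass ?p U = 1" by simp
  have "I_fun m \<gamma> U = J_inf m \<gamma>"
    unfolding I_fun_eq[OF m] QU using EJ BU1 AUA PUP by (simp add: AU_def BU_def PU_def)
  moreover have "Lp_norm 2 U = 1"
    using BU1 l2norm_nonneg[of U] by (simp add: Lp_norm_2 BU_def power2_eq_1_iff)
  moreover have "Lp_norm ?p U = 1" unfolding Lp_norm_def using QU by (simp add: Lp_mass_def)
  ultimately have UG: "U \<in> G_normalized m \<gamma> 1 1" using Unz by (simp add: G_normalized_def G_set_def)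
  \<comment> \<open>The witness for the shifts is \<open>y (\<psi> n)\<close>: the difference is a
    translate of \<open>r n\<close>, and both parts of the H1 norm are translation
    invariant.\<close>
  have "H1_norm (\<lambda>t. f (\<psi> n) t - U (t - y (\<psi> n))) = sqrt (b n + a n)" for n
  proof -
    have eq: "(\<lambda>t. f (\<psi> n) t - U (t - y (\<psi> n))) = (\<lambda>t. r n (t + - y (\<psi> n)))"
      by (simp add: r_def g_def)
    show ?thesis
      unfolding eq H1_norm_def Lp_norm_2 l2norm_weak_deriv_shift[OF r] l2norm_shift[of "r n"] a_def b_def ..
  qed
  moreover have "(\<lambda>n. sqrt (b n + a n)) \<longlonglongrightarrow> sqrt (0 + 0)" by (intro tendsto_intros a0 b0)
  ultimately have "(\<lambda>n. H1_norm (\<lambda>t. f (\<psi> n) t - U (t - y (\<psi> n)))) \<longlonglongrightarrow> 0" by simp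
  then show ?thesis using UG \<psi> by (intro bexI[of _ U] exI[of _ \<psi>] exI[of _ "\<lambda>n. y (\<psi> n)"] conjI)
qed

end
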